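(* Let $1\le p<\infty$, and let $\gamma_k=(s_k,\xi_k)$ be a sequence of scale-frequency pairs ($s_k>0$, $\xi_k\in\mathbb{R}$) with $\lim_{k\to\infty}s_k=0$ and $\lim_{k\to\infty}s_k\xi_k=L\in\mathbb{R}$. (i) If $X(t)$ is a symmetric $\alpha$-stable (Lévy) process with $p<\alpha\le2$, then $$\lim_{k\to\infty}\frac{SX(\gamma_k,p)}{s_k^{p/\alpha}}=\mathbb{E}\left[\left|\int_0^1w(u)e^{iLu}\,dX(u)\right|^p\right].$$ (ii) If $X(t)$ is a fractional Brownian motion with Hurst parameter $H\in(0,1)$ and $w$ has bounded variation on $[0,1]$, then $$\lim_{k\to\infty}\frac{SX(\gamma_k,p)}{s_k^{pH}}=\mathbb{E}\left[\left|\int_0^1w(u)e^{iLu}\,dX(u)\right|^p\right].$$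
   Context: Here the dimension is $1$. $w\in L^2(\mathbb{R})$ is a continuous window function with support contained in $[0,1]$. For $\gamma=(s,\xi)$ with $s>0$, $\xi\in\mathbb{R}$, set $g_\gamma(t)=w(t/s)e^{i\xi t}$. For a stochastic process $X=(X(t))_{t\in\mathbb{R}}$, $(g_\gamma*dX)(t)=\int_{\mathbb{R}}g_\gamma(t-u)\,dX(u)$, and $S_{\gamma,p}X(t)=\mathbb{E}[|(g_\gamma*dX)(t)|^p]$. For processes with stationary increments, in particular both processes considered here, $S_{\gamma,p}X(t)$ does not depend on $t$ and its common value is denoted $SX(\gamma,p)$. A symmetric $\alpha$-stable process has stationary independent increments and satisfies the self-similarity relation $X(st)=_d s^{1/\alpha}X(t)$ (as processes, $s>0$), and integrals against it are the usual stochastic integrals. For fractional Brownian motion the integrals (against functions of bounded variation) are defined pathwise, as limits of Riemann sums, using a Hölder continuous modification of $X$. *)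

theory Defs
  imports "HOL-Probability.Probability"
begin

section \<open>Processes indexed by the real line\<close>

text \<open>A real process \<open>(X(t))\<close> over the probability space \<open>M\<close> is a function \<open>X\<close> with
  \<open>X t \<omega>\<close> the value at time \<open>t\<close>. Equality in law as processes is equality of
  \<open>process_law\<close>, i.e. of all finite-dimensional distributions.\<close>

definition process_law :: "'a measure \<Rightarrow> (real \<Rightarrow> 'a \<Rightarrow> real) \<Rightarrow> (real \<Rightarrow> real) measure" where
  "process_law M X = distr M (PiM UNIV (\<lambda>_. borel)) (\<lambda>\<omega> t. X t \<omega>)"

definition tendsto_in_prob ::
    "'a measure \<Rightarrow> ('i \<Rightarrow> 'a \<Rightarrow> 'b::real_normed_vector) \<Rightarrow> ('a \<Rightarrow> 'b) \<Rightarrow> 'i filter \<Rightarrow> bool" where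
  "tendsto_in_prob M Z Y F \<longleftrightarrow>
     (\<forall>\<epsilon>>0. ((\<lambda>i. measure M {\<omega> \<in> space M. \<epsilon> < norm (Z i \<omega> - Y \<omega>)}) \<longlongrightarrow> 0) F)"

definition independent_increments :: "'a measure \<Rightarrow> (real \<Rightarrow> 'a \<Rightarrow> real) \<Rightarrow> bool" where
  "independent_increments M X \<longleftrightarrow>
     (\<forall>n. \<forall>t::nat \<Rightarrow> real. (\<forall>j<n. t j \<le> t (Suc j)) \<longrightarrow>
        prob_space.indep_vars M (\<lambda>_. borel) (\<lambda>j \<omega>. X (t (Suc j)) \<omega> - X (t j) \<omega>) {..<n})"

definition stationary_increments :: "'a measure \<Rightarrow> (real \<Rightarrow> 'a \<Rightarrow> real) \<Rightarrow> bool" where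
  "stationary_increments M X \<longleftrightarrow>
     (\<forall>s t h. distr M borel (\<lambda>\<omega>. X (t + h) \<omega> - X (s + h) \<omega>) =
              distr M borel (\<lambda>\<omega>. X t \<omega> - X s \<omega>))"

definition self_similar :: "real \<Rightarrow> 'a measure \<Rightarrow> (real \<Rightarrow> 'a \<Rightarrow> real) \<Rightarrow> bool" where
  "self_similar h M X \<longleftrightarrow>
     (\<forall>s>0. process_law M (\<lambda>t. X (s * t)) = process_law M (\<lambda>t \<omega>. s powr h * X t \<omega>))"

definition levy_process :: "'a measure \<Rightarrow> (real \<Rightarrow> 'a \<Rightarrow> real) \<Rightarrow> bool" where
  "levy_process M X \<longleftrightarrow>
     prob_space M \<and> (\<forall>t. X t \<in> borel_measurable M) \<and> (AE \<omega> in M. X 0 \<omega> = 0) \<and>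
     independent_increments M X \<and> stationary_increments M X \<and>
     (\<forall>t. tendsto_in_prob M X (X t) (at t))"

text \<open>The law \<open>S\<^sub>\<alpha>(\<sigma>, 0, 0)\<close>; for \<open>\<alpha> = 2\<close> this is the centred normal law with
  variance \<open>2 \<sigma>\<^sup>2\<close>.\<close>

definition symmetric_stable_law :: "real \<Rightarrow> real measure \<Rightarrow> bool" where
  "symmetric_stable_law \<alpha> \<mu> \<longleftrightarrow>
     (\<exists>\<sigma>>0. \<forall>\<theta>. char \<mu> \<theta> = complex_of_real (exp (- ((\<sigma> * \<bar>\<theta>\<bar>) powr \<alpha>))))"

definition symmetric_stable_process :: "real \<Rightarrow> 'a measure \<Rightarrow> (real \<Rightarrow> 'a \<Rightarrow> real) \<Rightarrow> bool" where
  "symmetric_stable_process \<alpha> M X \<longleftrightarrow>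
     levy_process M X \<and> symmetric_stable_law \<alpha> (distr M borel (X 1)) \<and>
     self_similar (1 / \<alpha>) M X"

text \<open>Constants count as (degenerate) Gaussian variables.\<close>

definition gaussian_rv :: "'a measure \<Rightarrow> ('a \<Rightarrow> real) \<Rightarrow> bool" where
  "gaussian_rv M Y \<longleftrightarrow> Y \<in> borel_measurable M \<and>
     ((\<exists>\<mu> \<sigma>. 0 < \<sigma> \<and> distributed M lborel Y (\<lambda>x. ennreal (normal_density \<mu> \<sigma> x))) \<or>
      (\<exists>c. AE \<omega> in M. Y \<omega> = c))"

definition gaussian_process :: "'a measure \<Rightarrow> (real \<Rightarrow> 'a \<Rightarrow> real) \<Rightarrow> bool" where
  "gaussian_process M X \<longleftrightarrow> prob_space M \<and>
     (\<forall>I a. finite I \<longrightarrow> gaussian_rv M (\<lambda>\<omega>. \<Sum>t\<in>I. a t * X t \<omega>))"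

text \<open>The constant \<open>\<sigma>\<^sup>2\<close> is the variance of \<open>X(1)\<close>; no normalisation is imposed.\<close>

definition fractional_brownian_motion ::
    "real \<Rightarrow> 'a measure \<Rightarrow> (real \<Rightarrow> 'a \<Rightarrow> real) \<Rightarrow> bool" where
  "fractional_brownian_motion H M X \<longleftrightarrow>
     gaussian_process M X \<and> (\<forall>t. (\<integral>\<omega>. X t \<omega> \<partial>M) = 0) \<and>
     (\<exists>\<sigma>>0. \<forall>s t. (\<integral>\<omega>. X s \<omega> * X t \<omega> \<partial>M) =
        \<sigma>\<^sup>2 / 2 * (\<bar>s\<bar> powr (2 * H) + \<bar>t\<bar> powr (2 * H) - \<bar>s - t\<bar> powr (2 * H)))"

definition modification ::
    "'a measure \<Rightarrow> (real \<Rightarrow> 'a \<Rightarrow> real) \<Rightarrow> (real \<Rightarrow> 'a \<Rightarrow> real) \<Rightarrow> bool" where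
  "modification M X X' \<longleftrightarrow>
     (\<forall>t. X' t \<in> borel_measurable M \<and> (AE \<omega> in M. X' t \<omega> = X t \<omega>))"

text \<open>Paths are Hoelder continuous on bounded intervals. Every path is required to be so, since
  \<open>M\<close> need not be complete and pathwise functionals must be measurable.\<close>

definition holder_paths :: "'a measure \<Rightarrow> (real \<Rightarrow> 'a \<Rightarrow> real) \<Rightarrow> bool" where
  "holder_paths M X \<longleftrightarrow>
     (\<exists>\<beta>>0. \<forall>\<omega>\<in>space M. \<forall>a b. \<exists>C. \<forall>s\<in>{a..b}. \<forall>t\<in>{a..b}.
        \<bar>X s \<omega> - X t \<omega>\<bar> \<le> C * \<bar>s - t\<bar> powr \<beta>)"


section \<open>Stochastic integrals of deterministic functions against a stable process\<close>

text \<open>The step function \<open>\<Sum>\<^sub>j c\<^sub>j 1\<^bsub>(t\<^sub>j, t\<^sub>j\<^sub>+\<^sub>1]\<^esub>\<close> and its elementary integral.\<close>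

definition step_fun :: "nat \<Rightarrow> (nat \<Rightarrow> real) \<Rightarrow> (nat \<Rightarrow> complex) \<Rightarrow> real \<Rightarrow> complex" where
  "step_fun n t c u = (\<Sum>j<n. c j * indicator {t j<..t (Suc j)} u)"

definition step_integral ::
    "nat \<Rightarrow> (nat \<Rightarrow> real) \<Rightarrow> (nat \<Rightarrow> complex) \<Rightarrow> (real \<Rightarrow> 'a \<Rightarrow> real) \<Rightarrow> 'a \<Rightarrow> complex" where
  "step_integral n t c X \<omega> = (\<Sum>j<n. c j * complex_of_real (X (t (Suc j)) \<omega> - X (t j) \<omega>))"

text \<open>\<open>Y\<close> is a version of \<open>\<integral>\<^sub>\<real> f dX\<close>: the limit in probability of the elementary integrals of
  step functions that converge to \<open>f\<close> in \<open>L\<^sup>\<alpha>(\<real>)\<close>.\<close>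

definition has_stable_integral ::
    "real \<Rightarrow> 'a measure \<Rightarrow> (real \<Rightarrow> 'a \<Rightarrow> real) \<Rightarrow> (real \<Rightarrow> complex) \<Rightarrow> ('a \<Rightarrow> complex) \<Rightarrow> bool" where
  "has_stable_integral \<alpha> M X f Y \<longleftrightarrow>
     Y \<in> borel_measurable M \<and>
     (\<exists>n t c.
        (\<forall>k. \<forall>j<n k. t k j \<le> t k (Suc j)) \<and>
        (\<lambda>k. \<integral>\<^sup>+u. ennreal (norm (step_fun (n k) (t k) (c k) u - f u) powr \<alpha>) \<partial>lborel)
           \<longlonglongrightarrow> 0 \<and>
        tendsto_in_prob M (\<lambda>k::nat. step_integral (n k) (t k) (c k) X) Y sequentially)"

text \<open>The integral is determined up to almost sure equality.\<close>

definition stable_integral ::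
    "real \<Rightarrow> 'a measure \<Rightarrow> (real \<Rightarrow> 'a \<Rightarrow> real) \<Rightarrow> (real \<Rightarrow> complex) \<Rightarrow> 'a \<Rightarrow> complex" where
  "stable_integral \<alpha> M X f = (SOME Y. has_stable_integral \<alpha> M X f Y)"


section \<open>Pathwise integrals\<close>

definition has_bounded_variation_on :: "(real \<Rightarrow> complex) \<Rightarrow> real \<Rightarrow> real \<Rightarrow> bool" where
  "has_bounded_variation_on f a b \<longleftrightarrow>
     (\<exists>V. \<forall>n. \<forall>t::nat \<Rightarrow> real.
        (\<forall>j\<le>n. t j \<in> {a..b}) \<and> (\<forall>j<n. t j \<le> t (Suc j)) \<longrightarrow>
        (\<Sum>j<n. norm (f (t (Suc j)) - f (t j))) \<le> V)"

text \<open>Riemann sums with partition points \<open>t\<close>, arbitrary tags \<open>\<tau>\<close> and mesh tending to \<open>0\<close>.\<close>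

definition has_rs_integral ::
    "real \<Rightarrow> real \<Rightarrow> (real \<Rightarrow> complex) \<Rightarrow> (real \<Rightarrow> real) \<Rightarrow> complex \<Rightarrow> bool" where
  "has_rs_integral a b f x I \<longleftrightarrow>
     (\<forall>\<epsilon>>0. \<exists>\<delta>>0. \<forall>n t \<tau>.
        t 0 = a \<and> t n = b \<and>
        (\<forall>j<n. t j \<le> t (Suc j) \<and> t (Suc j) - t j < \<delta> \<and> \<tau> j \<in> {t j..t (Suc j)}) \<longrightarrow>
        norm ((\<Sum>j<n. f (\<tau> j) * complex_of_real (x (t (Suc j)) - x (t j))) - I) < \<epsilon>)"

definition rs_integral :: "real \<Rightarrow> real \<Rightarrow> (real \<Rightarrow> complex) \<Rightarrow> (real \<Rightarrow> real) \<Rightarrow> complex" where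
  "rs_integral a b f x = (THE I. has_rs_integral a b f x I)"

text \<open>Integral over the whole line; only used for compactly supported \<open>f\<close>.\<close>

definition rs_integral_line :: "(real \<Rightarrow> complex) \<Rightarrow> (real \<Rightarrow> real) \<Rightarrow> complex" where
  "rs_integral_line f x = lim (\<lambda>N::nat. rs_integral (- real N) (real N) f x)"


section \<open>Moments of the filtered process\<close>

definition gabor_filter :: "(real \<Rightarrow> complex) \<Rightarrow> real \<Rightarrow> real \<Rightarrow> real \<Rightarrow> complex" where
  "gabor_filter w s \<xi> t = w (t / s) * iexp (\<xi> * t)"

text \<open>The argument \<open>J\<close> is the integration operator \<open>f \<mapsto> \<integral>\<^sub>\<real> f(u) dX(u)\<close> against the
  process under consideration, so that \<open>J (\<lambda>u. g (t - u))\<close> is \<open>(g * dX)(t)\<close>.\<close>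

definition filter_moment_at ::
    "'a measure \<Rightarrow> ((real \<Rightarrow> complex) \<Rightarrow> 'a \<Rightarrow> complex) \<Rightarrow> (real \<Rightarrow> complex) \<Rightarrow> real \<Rightarrow> real \<Rightarrow> real"
  where
  "filter_moment_at M J g p t = (\<integral>\<omega>. norm (J (\<lambda>u. g (t - u)) \<omega>) powr p \<partial>M)"

text \<open>\<open>SX((s, \<xi>), p)\<close>: the common value over all times \<open>t\<close>.\<close>

definition filter_moment ::
    "'a measure \<Rightarrow> ((real \<Rightarrow> complex) \<Rightarrow> 'a \<Rightarrow> complex) \<Rightarrow> (real \<Rightarrow> complex) \<Rightarrow>
     real \<Rightarrow> real \<Rightarrow> real \<Rightarrow> real" where
  "filter_moment M J w s \<xi> p =
     (THE c. \<forall>t. filter_moment_at M J (gabor_filter w s \<xi>) p t = c)"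

end

theory Submission
  imports Defs
begin

text \<open>
  The \<open>p\<close>-th absolute moment of a complex variable \<open>Y\<close> is, up to a constant, the average over
  \<open>\<theta> \<in> [0, 2\<pi>]\<close> of the moments of the real projections \<open>Re (e\<^sup>i\<^sup>\<theta> Y)\<close>. Hence only
  one-dimensional laws matter, and these are compared through their characteristic functions.

  For a stable process, the projection of any version of \<open>\<integral> f dX\<close> has the law of
  \<open>(\<integral> \<bar>Re (e\<^sup>i\<^sup>\<theta> f)\<bar>\<^sup>\<alpha>)\<^sup>1\<^sup>/\<^sup>\<alpha> (X(1) - X(0))\<close>. The moment is therefore an explicit
  functional of \<open>f\<close>, homogeneous under affine changes of the variable and continuous in the
  frequency \<open>s \<xi>\<close>.

  For fractional Brownian motion, Riemann sums are Gaussian, so the covariance gives the scaling of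
  their projections, which passes to the limit. Summation by parts bounds the \<open>p\<close>-th moment of
  \<open>\<integral> f dX\<close> by the \<open>p\<close>-th power of the variation of \<open>f\<close>, and the functions
  \<open>w(u) (e\<^sup>i\<^sup>a\<^sup>u - e\<^sup>i\<^sup>L\<^sup>u)\<close> have variation \<open>O(\<bar>a - L\<bar>)\<close>.
\<close>

section \<open>Moments, projections and characteristic functions\<close>

text \<open>Projections enter because the real and imaginary parts of a complex integral are
  dependent, with a joint law that varies with the integrand, whereas each single projection is
  symmetric stable or centred Gaussian and so is known up to one scale parameter. The two cases take
  the limit in the frequency differently. A stable integral is fixed only up to almost sure equality
  and is chosen separately for every integrand, so differences of integrals are never formed; the
  limit is taken by dominated convergence inside the moment functional. Pathwise integrals are
  linear in the integrand on each path, so there the difference of two integrals can be estimated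
  directly. Moments are computed in \<open>ennreal\<close>, where Fubini and scaling require no
  prior integrability. Finiteness is shown separately, for stable laws from p < \<alpha>, and
  real-valued integrals appear only at the end. As \<open>filter_moment\<close> is a definite
  description, the moment has to be evaluated at every time t and the value seen to be free of
  t.\<close>

lemma convex_on_powr_nonneg:
  fixes p :: real
  assumes "1 \<le> p"
  shows "convex_on {0..} (\<lambda>x. x powr p)"
proof (rule convex_onI)
  fix l x y :: real
  assume l: "0 < l" "l < 1" and xy: "x \<in> {0..}" "y \<in> {0..}"
  have scale: "(r * z) powr p \<le> r * z powr p" if "0 \<le> r" "r \<le> 1" "0 \<le> z" for r z :: real
  proof (cases "r = 0")
    case False
    have "(r * z) powr p = r powr p * z powr p" using that by (simp add: powr_mult)
    moreover have "r powr p \<le> r powr 1" using that assms False by (intro powr_mono') auto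
    ultimately show ?thesis using that by (auto intro!: mult_right_mono)
  qed auto
  show "((1 - l) *\<^sub>R x + l *\<^sub>R y) powr p \<le> (1 - l) * x powr p + l * y powr p"
  proof (cases "x = 0 \<or> y = 0")
    case True
    then show ?thesis using scale[of "1 - l" x] scale[of l y] l xy by auto
  next
    case False
    then show ?thesis
      using convex_onD[OF powr_convex[OF assms], of l x y] l xy by auto
  qed
qed simp

text \<open>Convexity applied to a + b = l (a / l) + (1 - l) (b / (1 - l)). The free weight l is the
  point: the factor of the main term tends to 1 as l tends to 1, which replaces Minkowski's
  inequality and avoids p-th roots.\<close>

lemma norm_add_powr_le:
  fixes a b :: "'b::real_normed_vector" and p l :: real
  assumes "1 \<le> p" "0 < l" "l < 1"
  shows "norm (a + b) powr p \<le> l powr (1 - p) * norm a powr p + (1 - l) powr (1 - p) * norm b powr p"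
proof -
  have *: "r * (z / r) powr p = r powr (1 - p) * z powr p" if "0 < r" "0 \<le> z" for r z :: real
    using that by (simp add: powr_divide powr_diff)
  have "norm (a + b) powr p \<le> (norm a + norm b) powr p"
    using assms norm_triangle_ineq by (intro powr_mono2) auto
  also have "norm a + norm b = (1 - (1 - l)) *\<^sub>R (norm a / l) + (1 - l) *\<^sub>R (norm b / (1 - l))"
    using assms by simp
  also have "\<dots> powr p \<le> (1 - (1 - l)) * (norm a / l) powr p + (1 - l) * (norm b / (1 - l)) powr p"
    using assms by (intro convex_onD[OF convex_on_powr_nonneg]) auto
  also have "\<dots> = l powr (1 - p) * norm a powr p + (1 - l) powr (1 - p) * norm b powr p"
    using *[of l "norm a"] *[of "1 - l" "norm b"] assms by simp
  finally show ?thesis .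
qed

text \<open>The order of choices matters: B l may blow up as l tends to 1, so l is fixed first to
  bring A l close to 1, and only then k is taken large to make B l * e k small.\<close>

lemma tendsto_from_quasi_norm_bounds:
  fixes f e :: "nat \<Rightarrow> real" and g :: real and A B :: "real \<Rightarrow> real"
  assumes up: "\<And>k l. 0 < l \<Longrightarrow> l < 1 \<Longrightarrow> f k \<le> A l * g + B l * e k"
    and lo: "\<And>k l. 0 < l \<Longrightarrow> l < 1 \<Longrightarrow> g \<le> A l * f k + B l * e k"
    and e: "e \<longlonglongrightarrow> 0" and A: "(A \<longlongrightarrow> 1) (at_left 1)"
  shows "f \<longlonglongrightarrow> g"
proof (rule tendstoI)
  fix \<epsilon> :: real assume "0 < \<epsilon>"
  have "((\<lambda>l. A l * g) \<longlongrightarrow> 1 * g) (at_left 1)" "((\<lambda>l. A l * (g - \<epsilon>)) \<longlongrightarrow> 1 * (g - \<epsilon>)) (at_left 1)"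
    by (intro tendsto_intros A)+
  then have "\<forall>\<^sub>F l in at_left 1. A l * g < g + \<epsilon>" "\<forall>\<^sub>F l in at_left 1. A l * (g - \<epsilon>) < g"
    using \<open>0 < \<epsilon>\<close> by (auto elim!: order_tendstoD)
  moreover have "\<forall>\<^sub>F l in at_left 1. 0 < A l"
    using A by (rule order_tendstoD) simp
  moreover have "\<forall>\<^sub>F l in at_left (1::real). l \<in> {0<..<1}"
    by (rule eventually_at_leftI) auto
  ultimately have "\<forall>\<^sub>F l in at_left 1. 0 < A l \<and> A l * g < g + \<epsilon> \<and> A l * (g - \<epsilon>) < g \<and> l \<in> {0<..<1}"
    by eventually_elim auto
  then obtain l where l: "0 < A l" "A l * g < g + \<epsilon>" "A l * (g - \<epsilon>) < g" "0 < l" "l < 1"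
    using eventually_happens'[OF trivial_limit_at_left_real] by (smt (verit) greaterThanLessThan_iff)
  have "(\<lambda>k. A l * g + B l * e k) \<longlonglongrightarrow> A l * g + B l * 0"
    "(\<lambda>k. g - B l * e k) \<longlonglongrightarrow> g - B l * 0"
    by (intro tendsto_intros e)+
  then have "\<forall>\<^sub>F k in sequentially. A l * g + B l * e k < g + \<epsilon>"
    "\<forall>\<^sub>F k in sequentially. A l * (g - \<epsilon>) < g - B l * e k"
    using l by (auto elim!: order_tendstoD)
  then show "\<forall>\<^sub>F k in sequentially. dist (f k) g < \<epsilon>"
  proof eventually_elim
    case (elim k)
    have "A l * (g - \<epsilon>) < A l * f k" using elim lo[OF l(4,5), of k] by linarith
    then have "g - \<epsilon> < f k" using l(1) by simp
    then show ?case using elim up[OF l(4,5), of k] by (auto simp: dist_real_def)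
  qed
qed

lemma nn_integral_powr_add_le:
  fixes F G :: "'a \<Rightarrow> 'b::{real_normed_vector, second_countable_topology}"
  assumes [measurable]: "F \<in> borel_measurable M" "G \<in> borel_measurable M"
    and "1 \<le> p" "0 < l" "l < 1"
  shows "(\<integral>\<^sup>+x. ennreal (norm (F x + G x) powr p) \<partial>M) \<le>
    ennreal (l powr (1 - p)) * (\<integral>\<^sup>+x. ennreal (norm (F x) powr p) \<partial>M) +
    ennreal ((1 - l) powr (1 - p)) * (\<integral>\<^sup>+x. ennreal (norm (G x) powr p) \<partial>M)"
proof -
  have "(\<integral>\<^sup>+x. ennreal (norm (F x + G x) powr p) \<partial>M) \<le>
    (\<integral>\<^sup>+x. ennreal (l powr (1 - p)) * ennreal (norm (F x) powr p) +
       ennreal ((1 - l) powr (1 - p)) * ennreal (norm (G x) powr p) \<partial>M)"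
    using norm_add_powr_le[OF assms(3-5)]
    by (intro nn_integral_mono) (simp flip: ennreal_mult' ennreal_plus)
  also have "\<dots> = ennreal (l powr (1 - p)) * (\<integral>\<^sup>+x. ennreal (norm (F x) powr p) \<partial>M) +
    ennreal ((1 - l) powr (1 - p)) * (\<integral>\<^sup>+x. ennreal (norm (G x) powr p) \<partial>M)"
    by (subst nn_integral_add) (auto simp: nn_integral_cmult)
  finally show ?thesis .
qed

text \<open>Splitting F k = G + (F k - G) and G = F k + (G - F k) with weight l gives the two bounds
  of \<open>tendsto_from_quasi_norm_bounds\<close>, where A l = l powr (1 - p).\<close>

lemma tendsto_nn_integral_powr:
  fixes F :: "nat \<Rightarrow> 'a \<Rightarrow> 'b::{real_normed_vector, second_countable_topology}"
  assumes F[measurable]: "\<And>k. F k \<in> borel_measurable M" and G[measurable]: "G \<in> borel_measurable M"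
    and p: "1 \<le> p"
    and lim: "(\<lambda>k. \<integral>\<^sup>+x. ennreal (norm (F k x - G x) powr p) \<partial>M) \<longlonglongrightarrow> 0"
    and fin: "(\<integral>\<^sup>+x. ennreal (norm (G x) powr p) \<partial>M) < \<infinity>"
  shows "(\<lambda>k. \<integral>\<^sup>+x. ennreal (norm (F k x) powr p) \<partial>M) \<longlonglongrightarrow> (\<integral>\<^sup>+x. ennreal (norm (G x) powr p) \<partial>M)"
proof -
  define e where "e k = (\<integral>\<^sup>+x. ennreal (norm (F k x - G x) powr p) \<partial>M)" for k
  define f where "f k = (\<integral>\<^sup>+x. ennreal (norm (F k x) powr p) \<partial>M)" for k
  define g where "g = (\<integral>\<^sup>+x. ennreal (norm (G x) powr p) \<partial>M)"
  have "\<forall>\<^sub>F k in sequentially. e k < \<infinity>"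
    using lim unfolding e_def by (rule order_tendstoD) simp
  then obtain K where K: "e k < \<infinity>" if "k \<ge> K" for k
    by (auto simp: eventually_sequentially)
  have up: "f k \<le> ennreal (l powr (1 - p)) * g + ennreal ((1 - l) powr (1 - p)) * e k"
    if "0 < l" "l < 1" for k l
    using nn_integral_powr_add_le[OF G _ p that, of "\<lambda>x. F k x - G x"] unfolding f_def g_def e_def by simp
  have lo: "g \<le> ennreal (l powr (1 - p)) * f k + ennreal ((1 - l) powr (1 - p)) * e k"
    if "0 < l" "l < 1" for k l
    using nn_integral_powr_add_le[OF F _ p that, of "\<lambda>x. G x - F k x" k] unfolding f_def g_def e_def
    by (simp add: norm_minus_commute)
  \<comment> \<open>One fixed weight suffices for finiteness; l = 1/2 is an arbitrary
    choice.\<close>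
  have ff: "f k < \<infinity>" if "k \<ge> K" for k
    by (rule le_less_trans[OF up[of "1/2"]])
      (use K[OF that] fin in \<open>auto simp: g_def ennreal_mult_less_top\<close>)
  have A: "((\<lambda>l. l powr (1 - p)) \<longlongrightarrow> 1) (at_left (1::real))"
  proof -
    have "((\<lambda>l::real. l powr (1 - p)) \<longlongrightarrow> 1 powr (1 - p)) (at_left 1)"
      by (intro tendsto_intros) auto
    then show ?thesis by simp
  qed
  \<comment> \<open>From index K on all quantities are finite, so the bounds can be moved from
    \<open>ennreal\<close> to the reals.\<close>
  have "(\<lambda>k. enn2real (f (k + K))) \<longlonglongrightarrow> enn2real g"
  proof (rule tendsto_from_quasi_norm_bounds)
    fix k and l :: real assume l: "0 < l" "l < 1"
    have fin': "f (k + K) < \<infinity>" "e (k + K) < \<infinity>" "g < \<infinity>"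
      using ff K fin by (auto simp: g_def)
    show "enn2real (f (k + K)) \<le> l powr (1 - p) * enn2real g + (1 - l) powr (1 - p) * enn2real (e (k + K))"
      using enn2real_mono[OF up[OF l, of "k + K"]] fin'
      by (simp add: enn2real_plus enn2real_mult ennreal_mult_less_top)
    show "enn2real g \<le> l powr (1 - p) * enn2real (f (k + K)) + (1 - l) powr (1 - p) * enn2real (e (k + K))"
      using enn2real_mono[OF lo[OF l, of "k + K"]] fin'
      by (simp add: enn2real_plus enn2real_mult ennreal_mult_less_top)
  next
    have "(\<lambda>k. e (k + K)) \<longlonglongrightarrow> 0"
      using lim unfolding e_def by (rule LIMSEQ_ignore_initial_segment)
    then have "(\<lambda>k. enn2real (e (k + K))) \<longlonglongrightarrow> enn2real 0"
      by (intro tendsto_enn2real) auto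
    then show "(\<lambda>k. enn2real (e (k + K))) \<longlonglongrightarrow> 0" by simp
  qed (rule A)
  then have "(\<lambda>k. ennreal (enn2real (f (k + K)))) \<longlonglongrightarrow> ennreal (enn2real g)"
    by (intro tendsto_ennrealI)
  then have "(\<lambda>k. f (k + K)) \<longlonglongrightarrow> g"
    using ff[of "k + K" for k] fin unfolding g_def[symmetric] ennreal_enn2real_if by (simp add: less_top[symmetric])
  then show ?thesis unfolding f_def[symmetric] g_def[symmetric] by (rule LIMSEQ_offset)
qed

lemma tendsto_enn2real_finite:
  assumes "(u \<longlongrightarrow> c) F" "c < \<infinity>"
  shows "((\<lambda>n. enn2real (u n)) \<longlongrightarrow> enn2real c) F"
  using assms by (intro tendsto_enn2real) auto

section \<open>Averaging over real projections\<close>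

definition cos_moment :: "real \<Rightarrow> ennreal" where
  "cos_moment p = (\<integral>\<^sup>+\<theta>\<in>{0..2 * pi}. ennreal (\<bar>cos \<theta>\<bar> powr p) \<partial>lborel)"

text \<open>The piece of [a, T + a] beyond T is moved back by one period. The range 0 \<le> a \<le>
  T fits its use, where a is an argument in [0, 2 pi).\<close>

lemma nn_integral_period_shift:
  fixes f :: "real \<Rightarrow> ennreal"
  assumes [measurable]: "f \<in> borel_measurable borel" and per: "\<And>x. f (x + T) = f x"
    and a: "0 \<le> a" "a \<le> T"
  shows "(\<integral>\<^sup>+x\<in>{0..T}. f (x + a) \<partial>lborel) = (\<integral>\<^sup>+x\<in>{0..T}. f x \<partial>lborel)"
proof -
  have shift: "(\<integral>\<^sup>+x\<in>S. f (x + c) \<partial>lborel) = (\<integral>\<^sup>+x\<in>(\<lambda>x. x - c) -` S. f x \<partial>lborel)"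
    if [measurable]: "S \<in> sets borel" for S c
    by (subst nn_integral_real_affine[where c=1 and t="-c"]) (auto intro!: nn_integral_cong simp: indicator_def)
  have null: "(\<integral>\<^sup>+x\<in>insert y S. f x \<partial>lborel) = (\<integral>\<^sup>+x\<in>S. f x \<partial>lborel)" for S y
    by (rule nn_integral_cong_AE, rule AE_mp[OF AE_lborel_singleton[of y]]) (auto simp: indicator_def)
  have vi: "(\<lambda>x. x - c) -` {u..v} = {u + c..v + c}" for c u v :: real by auto
  have un: "(\<integral>\<^sup>+x\<in>{u..w}. f x \<partial>lborel) = (\<integral>\<^sup>+x\<in>{u..v}. f x \<partial>lborel) + (\<integral>\<^sup>+x\<in>{v..w}. f x \<partial>lborel)"
    if "u \<le> v" "v \<le> w" for u v w
  proof -
    have "(\<integral>\<^sup>+x\<in>{u..w}. f x \<partial>lborel) = (\<integral>\<^sup>+x. f x * indicator {u..v} x + f x * indicator {v<..w} x \<partial>lborel)"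
      using that by (intro nn_integral_cong) (auto simp: indicator_def)
    also have "\<dots> = (\<integral>\<^sup>+x\<in>{u..v}. f x \<partial>lborel) + (\<integral>\<^sup>+x\<in>{v<..w}. f x \<partial>lborel)"
      by (rule nn_integral_add) auto
    also have "(\<integral>\<^sup>+x\<in>{v<..w}. f x \<partial>lborel) = (\<integral>\<^sup>+x\<in>insert v {v<..w}. f x \<partial>lborel)"
      by (rule null[symmetric])
    also have "insert v {v<..w} = {v..w}" using that by auto
    finally show ?thesis .
  qed
  have "(\<integral>\<^sup>+x\<in>{0..T}. f (x + a) \<partial>lborel) = (\<integral>\<^sup>+x\<in>{a..T + a}. f x \<partial>lborel)"
    by (subst shift) (auto simp: vi)
  also have "\<dots> = (\<integral>\<^sup>+x\<in>{a..T}. f x \<partial>lborel) + (\<integral>\<^sup>+x\<in>{T..T + a}. f x \<partial>lborel)"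
    using a by (intro un) auto
  also have "(\<integral>\<^sup>+x\<in>{T..T + a}. f x \<partial>lborel) = (\<integral>\<^sup>+x\<in>{0..a}. f (x + T) \<partial>lborel)"
    by (subst shift) (auto simp: vi add.commute)
  also have "\<dots> = (\<integral>\<^sup>+x\<in>{0..a}. f x \<partial>lborel)" by (simp add: per)
  also have "(\<integral>\<^sup>+x\<in>{a..T}. f x \<partial>lborel) + \<dots> = (\<integral>\<^sup>+x\<in>{0..T}. f x \<partial>lborel)"
    using un[of 0 a T] a by (simp add: add.commute)
  finally show ?thesis .
qed

text \<open>In polar form the projection is |z| cos (\<theta> + arg z), and integrating over a full
  period removes the phase. The constant \<open>cos_moment p\<close> is the value at z = 1.\<close>

lemma nn_integral_projection_powr:
  "(\<integral>\<^sup>+\<theta>\<in>{0..2 * pi}. ennreal (\<bar>Re (cis \<theta> * z)\<bar> powr p) \<partial>lborel) = cos_moment p * ennreal (norm z powr p)"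
proof -
  define r a where "r = norm z" and "a = Arg2pi z"
  have z: "z = rcis r a" "0 \<le> r" "0 \<le> a" "a < 2 * pi"
    using Arg2pi[of z] by (auto simp: r_def a_def rcis_def cis_conv_exp is_Arg_def)
  have "(\<integral>\<^sup>+\<theta>\<in>{0..2 * pi}. ennreal (\<bar>Re (cis \<theta> * z)\<bar> powr p) \<partial>lborel)
    = (\<integral>\<^sup>+\<theta>\<in>{0..2 * pi}. ennreal (r powr p) * ennreal (\<bar>cos (\<theta> + a)\<bar> powr p) \<partial>lborel)"
  proof (intro nn_integral_cong arg_cong2[where f="(*)"] refl)
    fix \<theta> :: real
    have "cis \<theta> * z = rcis r (\<theta> + a)"
      unfolding z(1) by (simp add: rcis_def cis_mult algebra_simps flip: cis_mult)
    then have "\<bar>Re (cis \<theta> * z)\<bar> powr p = r powr p * \<bar>cos (\<theta> + a)\<bar> powr p"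
      using z(2) by (simp add: abs_mult powr_mult)
    then show "ennreal (\<bar>Re (cis \<theta> * z)\<bar> powr p) = ennreal (r powr p) * ennreal (\<bar>cos (\<theta> + a)\<bar> powr p)"
      by (simp add: ennreal_mult')
  qed
  also have "\<dots> = ennreal (r powr p) * (\<integral>\<^sup>+\<theta>\<in>{0..2 * pi}. ennreal (\<bar>cos (\<theta> + a)\<bar> powr p) \<partial>lborel)"
    by (simp add: nn_integral_cmult mult.assoc)
  also have "\<dots> = ennreal (r powr p) * cos_moment p"
    unfolding cos_moment_def using z by (subst nn_integral_period_shift) auto
  finally show ?thesis using z by (simp add: mult.commute)
qed

text \<open>Exactly what is needed to cancel the constant in \<open>ennreal\<close>.\<close>

lemma cos_moment_bounds:
  assumes "0 \<le> p"
  shows "cos_moment p \<noteq> 0" "cos_moment p < \<infinity>"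
proof -
  have "cos_moment p \<le> (\<integral>\<^sup>+\<theta>. indicator {0..2 * pi} \<theta> \<partial>lborel)"
    unfolding cos_moment_def
  proof (intro nn_integral_mono)
    fix x :: real
    have "\<bar>cos x\<bar> powr p \<le> 1 powr p" using assms by (intro powr_mono2) auto
    then show "ennreal (\<bar>cos x\<bar> powr p) * indicator {0..2 * pi} x \<le> indicator {0..2 * pi} x"
      by (auto simp: indicator_def)
  qed
  also have "\<dots> < \<infinity>" by simp
  finally show "cos_moment p < \<infinity>" .
  \<comment> \<open>Lower bound from the angles in [0, pi/3], where the cosine is at least
    1/2.\<close>
  have "ennreal ((1/2) powr p) * emeasure lborel {0..pi/3} = (\<integral>\<^sup>+\<theta>. ennreal ((1/2) powr p) * indicator {0..pi/3} \<theta> \<partial>lborel)"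
    by (subst nn_integral_cmult_indicator) auto
  also have "\<dots> \<le> cos_moment p"
    unfolding cos_moment_def
  proof (intro nn_integral_mono)
    fix x :: real
    have "(1/2) powr p \<le> \<bar>cos x\<bar> powr p" if "x \<in> {0..pi/3}"
    proof -
      have "cos (pi/3) \<le> cos x" using that by (intro cos_monotone_0_pi_le) auto
      then show ?thesis using assms by (intro powr_mono2) (auto simp: cos_60)
    qed
    then show "ennreal ((1/2) powr p) * indicator {0..pi/3} x \<le> ennreal (\<bar>cos x\<bar> powr p) * indicator {0..2 * pi} x"
      by (auto simp: indicator_def)
  qed
  finally show "cos_moment p \<noteq> 0"
    by (auto simp flip: ennreal_mult')
qed

text \<open>Fubini for nonnegative functions turns the pointwise average over angles into an average
  of real moments. This is the bridge from one-dimensional laws to the complex moment.\<close>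

lemma nn_integral_norm_powr_projections:
  fixes Y :: "'a \<Rightarrow> complex"
  assumes "sigma_finite_measure M" and [measurable]: "Y \<in> borel_measurable M"
  shows "cos_moment p * (\<integral>\<^sup>+\<omega>. ennreal (norm (Y \<omega>) powr p) \<partial>M) =
    (\<integral>\<^sup>+\<theta>\<in>{0..2 * pi}. (\<integral>\<^sup>+\<omega>. ennreal (\<bar>Re (cis \<theta> * Y \<omega>)\<bar> powr p) \<partial>M) \<partial>lborel)"
proof -
  interpret pair_sigma_finite M lborel
    using assms(1) lborel.sigma_finite_measure_axioms by (simp add: pair_sigma_finite_def)
  have [measurable]: "cis \<in> borel_measurable borel"
    by (intro borel_measurable_continuous_onI continuous_intros)
  have "cos_moment p * (\<integral>\<^sup>+\<omega>. ennreal (norm (Y \<omega>) powr p) \<partial>M) =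
    (\<integral>\<^sup>+\<omega>. (\<integral>\<^sup>+\<theta>\<in>{0..2 * pi}. ennreal (\<bar>Re (cis \<theta> * Y \<omega>)\<bar> powr p) \<partial>lborel) \<partial>M)"
    unfolding nn_integral_projection_powr by (simp add: nn_integral_cmult)
  also have "\<dots> = (\<integral>\<^sup>+\<theta>. (\<integral>\<^sup>+\<omega>. ennreal (\<bar>Re (cis \<theta> * Y \<omega>)\<bar> powr p) * indicator {0..2 * pi} \<theta> \<partial>M) \<partial>lborel)"
    by (rule Fubini'[symmetric]) measurable
  finally show ?thesis by (simp add: nn_integral_multc)
qed

text \<open>A factor common to all angles survives the averaging. It is taken in
  \<open>ennreal\<close> and no moment is presupposed finite; only \<open>cos_moment p\<close> has
  to be cancelled.\<close>

lemma nn_integral_norm_powr_eq_projections: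
  fixes Y Y' :: "'a \<Rightarrow> complex"
  assumes "sigma_finite_measure M" "Y \<in> borel_measurable M" "Y' \<in> borel_measurable M" "0 \<le> p"
    and eq: "\<And>\<theta>. (\<integral>\<^sup>+\<omega>. ennreal (\<bar>Re (cis \<theta> * Y \<omega>)\<bar> powr p) \<partial>M) =
      c * (\<integral>\<^sup>+\<omega>. ennreal (\<bar>Re (cis \<theta> * Y' \<omega>)\<bar> powr p) \<partial>M)"
  shows "(\<integral>\<^sup>+\<omega>. ennreal (norm (Y \<omega>) powr p) \<partial>M) = c * (\<integral>\<^sup>+\<omega>. ennreal (norm (Y' \<omega>) powr p) \<partial>M)"
proof -
  interpret pair_sigma_finite M lborel
    using assms(1) lborel.sigma_finite_measure_axioms by (simp add: pair_sigma_finite_def)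
  have [measurable]: "cis \<in> borel_measurable borel"
    by (intro borel_measurable_continuous_onI continuous_intros)
  note [measurable] = assms(2,3)
  interpret M: sigma_finite_measure M by fact
  have "cos_moment p * (\<integral>\<^sup>+\<omega>. ennreal (norm (Y \<omega>) powr p) \<partial>M) =
    (\<integral>\<^sup>+\<theta>. c * ((\<integral>\<^sup>+\<omega>. ennreal (\<bar>Re (cis \<theta> * Y' \<omega>)\<bar> powr p) \<partial>M) * indicator {0..2 * pi} \<theta>) \<partial>lborel)"
    unfolding nn_integral_norm_powr_projections[OF assms(1,2)] eq mult.assoc ..
  also have "\<dots> = c * (cos_moment p * (\<integral>\<^sup>+\<omega>. ennreal (norm (Y' \<omega>) powr p) \<partial>M))"
    unfolding nn_integral_norm_powr_projections[OF assms(1,3)] by (intro nn_integral_cmult) measurable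
  finally have "cos_moment p * (\<integral>\<^sup>+\<omega>. ennreal (norm (Y \<omega>) powr p) \<partial>M) =
    cos_moment p * (c * (\<integral>\<^sup>+\<omega>. ennreal (norm (Y' \<omega>) powr p) \<partial>M))" by (simp add: ac_simps)
  then show ?thesis using cos_moment_bounds[OF assms(4)] by (auto simp add: ennreal_mult_cancel_left)
qed

section \<open>Laws compared through characteristic functions\<close>

context prob_space
begin

lemma char_distr:
  fixes U :: "'a \<Rightarrow> real"
  assumes "U \<in> borel_measurable M"
  shows "char (distr M borel U) t = (\<integral>\<omega>. iexp (t * U \<omega>) \<partial>M)"
  using assms unfolding char_def by (subst integral_distr) auto

text \<open>By Levy's uniqueness theorem U has the law of K * Z, and absolute moments are
  homogeneous. Both the stable and the Gaussian scaling pass through this statement.\<close>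

lemma nn_integral_powr_eq_if_char_eq:
  fixes U Z :: "'a \<Rightarrow> real"
  assumes [measurable]: "U \<in> borel_measurable M" "Z \<in> borel_measurable M" and "0 \<le> K"
    and eq: "\<And>t. char (distr M borel U) t = char (distr M borel Z) (K * t)"
  shows "(\<integral>\<^sup>+\<omega>. ennreal (\<bar>U \<omega>\<bar> powr p) \<partial>M) = ennreal (K powr p) * (\<integral>\<^sup>+\<omega>. ennreal (\<bar>Z \<omega>\<bar> powr p) \<partial>M)"
proof -
  have "distr M borel U = distr M borel (\<lambda>\<omega>. K * Z \<omega>)"
  proof (rule Levy_uniqueness)
    show "char (distr M borel U) = char (distr M borel (\<lambda>\<omega>. K * Z \<omega>))"
      by (rule ext) (simp add: eq, simp add: char_distr ac_simps)
  qed (auto intro!: real_distribution_distr)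
  then have "(\<integral>\<^sup>+x. ennreal (\<bar>x\<bar> powr p) \<partial>distr M borel U) = (\<integral>\<^sup>+x. ennreal (\<bar>x\<bar> powr p) \<partial>distr M borel (\<lambda>\<omega>. K * Z \<omega>))"
    by simp
  then have "(\<integral>\<^sup>+\<omega>. ennreal (\<bar>U \<omega>\<bar> powr p) \<partial>M) = (\<integral>\<^sup>+\<omega>. ennreal (\<bar>K * Z \<omega>\<bar> powr p) \<partial>M)"
    by (simp add: nn_integral_distr)
  also have "\<dots> = (\<integral>\<^sup>+\<omega>. ennreal (K powr p) * ennreal (\<bar>Z \<omega>\<bar> powr p) \<partial>M)"
    using \<open>0 \<le> K\<close> by (intro nn_integral_cong) (simp add: abs_mult powr_mult ennreal_mult')
  finally show ?thesis by (simp add: nn_integral_cmult)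
qed

lemma tendsto_char_pointwise:
  fixes U :: "nat \<Rightarrow> 'a \<Rightarrow> real"
  assumes [measurable]: "\<And>k. U k \<in> borel_measurable M" "V \<in> borel_measurable M"
    and lim: "AE \<omega> in M. (\<lambda>k. U k \<omega>) \<longlonglongrightarrow> V \<omega>"
  shows "(\<lambda>k. char (distr M borel (U k)) t) \<longlonglongrightarrow> char (distr M borel V) t"
  unfolding char_distr[OF assms(1)] char_distr[OF assms(2)]
proof (rule integral_dominated_convergence[where w="\<lambda>_. 1"])
  show "AE \<omega> in M. (\<lambda>k. iexp (t * U k \<omega>)) \<longlonglongrightarrow> iexp (t * V \<omega>)"
    using lim by eventually_elim (intro tendsto_intros)
qed auto

text \<open>Where U k and V are close, the exponentials differ by at most |t| times their distance;
  elsewhere the difference is at most 2 and the event has small probability.\<close>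

lemma tendsto_char_in_prob:
  fixes U :: "nat \<Rightarrow> 'a \<Rightarrow> real"
  assumes [measurable]: "\<And>k. U k \<in> borel_measurable M" "V \<in> borel_measurable M"
    and lim: "tendsto_in_prob M U V sequentially"
  shows "(\<lambda>k. char (distr M borel (U k)) t) \<longlonglongrightarrow> char (distr M borel V) t"
proof (rule tendstoI)
  fix e :: real assume "0 < e"
  \<comment> \<open>Half of e pays for the good event, since |t| * \<epsilon> < e / 2; the other
    half for the bad event, of probability below e / 4. The summand 1 covers t = 0.\<close>
  define \<epsilon> where "\<epsilon> = e / (2 * (\<bar>t\<bar> + 1))"
  have \<epsilon>: "0 < \<epsilon>" "\<bar>t\<bar> * \<epsilon> < e / 2"
    using \<open>0 < e\<close> by (auto simp: \<epsilon>_def field_simps)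
  define P where "P k = measure M {\<omega> \<in> space M. \<epsilon> < norm (U k \<omega> - V \<omega>)}" for k
  have "P \<longlonglongrightarrow> 0" using lim \<epsilon>(1) unfolding tendsto_in_prob_def P_def by blast
  then have "\<forall>\<^sub>F k in sequentially. P k < e / 4"
    by (rule order_tendstoD) (use \<open>0 < e\<close> in auto)
  then show "\<forall>\<^sub>F k in sequentially. dist (char (distr M borel (U k)) t) (char (distr M borel V) t) < e"
  proof eventually_elim
    case (elim k)
    let ?B = "{\<omega> \<in> space M. \<epsilon> < norm (U k \<omega> - V \<omega>)}"
    have ind: "integrable M (\<lambda>\<omega>. 2 * indicator ?B \<omega> :: real)"
      by (intro integrable_mult_right integrable_real_indicator) (auto simp: less_top[symmetric])
    then have int: "integrable M (\<lambda>\<omega>. \<bar>t\<bar> * \<epsilon> + 2 * indicator ?B \<omega>)"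
      by (intro Bochner_Integration.integrable_add) auto
    have "dist (char (distr M borel (U k)) t) (char (distr M borel V) t) =
       norm (\<integral>\<omega>. iexp (t * U k \<omega>) - iexp (t * V \<omega>) \<partial>M)"
      by (simp add: char_distr dist_norm Bochner_Integration.integral_diff integrable_iexp)
    also have "\<dots> \<le> (\<integral>\<omega>. norm (iexp (t * U k \<omega>) - iexp (t * V \<omega>)) \<partial>M)"
      by (rule integral_norm_bound)
    also have "\<dots> \<le> (\<integral>\<omega>. \<bar>t\<bar> * \<epsilon> + 2 * indicator ?B \<omega> \<partial>M)"
    proof (rule integral_mono)
      show "integrable M (\<lambda>\<omega>. \<bar>t\<bar> * \<epsilon> + 2 * indicator ?B \<omega>)" by (rule int)
      show "integrable M (\<lambda>\<omega>. norm (iexp (t * U k \<omega>) - iexp (t * V \<omega>)))"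
        by (intro integrable_norm Bochner_Integration.integrable_diff integrable_iexp) auto
      fix \<omega> assume "\<omega> \<in> space M"
      show "norm (iexp (t * U k \<omega>) - iexp (t * V \<omega>)) \<le> \<bar>t\<bar> * \<epsilon> + 2 * indicator ?B \<omega>"
      proof (cases "\<omega> \<in> ?B")
        case True
        have "norm (iexp (t * U k \<omega>) - iexp (t * V \<omega>)) \<le> 1 + 1"
          by (rule order.trans[OF norm_triangle_ineq4]) simp
        moreover have "0 \<le> \<bar>t\<bar> * \<epsilon>" using \<epsilon> by simp
        ultimately show ?thesis using True by simp
      next
        case False
        have "iexp (t * U k \<omega>) - iexp (t * V \<omega>) = iexp (t * V \<omega>) * (iexp (t * (U k \<omega> - V \<omega>)) - 1)"
          by (simp only: right_diff_distrib mult_1_right of_real_diff exp_diff) simp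
        then have "norm (iexp (t * U k \<omega>) - iexp (t * V \<omega>)) = norm (iexp (t * (U k \<omega> - V \<omega>)) - 1)"
          by (simp add: norm_mult)
        also have "\<dots> \<le> \<bar>t * (U k \<omega> - V \<omega>)\<bar>"
          using iexp_approx1[of "t * (U k \<omega> - V \<omega>)" 0] by simp
        also have "\<dots> \<le> \<bar>t\<bar> * \<epsilon>"
          using False \<open>\<omega> \<in> space M\<close> by (auto simp: abs_mult intro!: mult_left_mono)
        finally show ?thesis using False by simp
      qed
    qed
    also have "\<dots> = \<bar>t\<bar> * \<epsilon> + 2 * P k"
      unfolding P_def by (subst Bochner_Integration.integral_add[OF _ ind]) (auto simp: prob_space)
    also have "\<dots> < e" using \<epsilon> elim by linarith
    finally show ?case .
  qed
qed

end

section \<open>Stable processes\<close>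

text \<open>The integral of (1 - cos (t z)) t^(-1-q) over t > 0 dominates a multiple of |z|^q.
  Exchanging it with the expectation leaves the integral of (1 - exp (-(\<sigma> t)^\<alpha>))
  t^(-1-q), which converges at 0 because q < \<alpha> and at infinity because q > 0.\<close>

lemma (in prob_space) nn_integral_powr_finite_if_char_exp:
  fixes Z :: "'a \<Rightarrow> real"
  assumes [measurable]: "Z \<in> borel_measurable M"
    and char: "\<And>t. char (distr M borel Z) t = complex_of_real (exp (- ((\<sigma> * \<bar>t\<bar>) powr \<alpha>)))"
    and "0 < \<sigma>" "0 < q" "q < \<alpha>"
  shows "(\<integral>\<^sup>+\<omega>. ennreal (\<bar>Z \<omega>\<bar> powr q) \<partial>M) < \<infinity>"
proof -
  \<comment> \<open>Restricting the integral to 1/|z| \<le> t \<le> 2/|z| keeps t |z| in [1, 2], so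
    1 - cos (t z) is at least 1 - cos 1; the power of t is smallest at 2/|z| and the interval has
    length 1/|z|.\<close>
  define c :: real where "c = (1 - cos 1) * 2 powr (-1 - q)"
  have "cos 1 < cos (0::real)" using pi_gt3 by (intro cos_monotone_0_pi) auto
  then have c: "0 < c" by (auto simp: c_def)
  define h where "h z = (\<integral>\<^sup>+t. ennreal ((1 - cos (t * z)) * t powr (-1 - q)) * indicator {0<..} t \<partial>lborel)" for z
  have lower: "ennreal (c * \<bar>z\<bar> powr q) \<le> h z" for z
  proof (cases "z = 0")
    case False
    have "ennreal (c * \<bar>z\<bar> powr q) = ennreal ((1 - cos 1) * (2 / \<bar>z\<bar>) powr (-1 - q)) * ennreal (2 / \<bar>z\<bar> - 1 / \<bar>z\<bar>)"
      using False c by (subst ennreal_mult'[symmetric])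
        (auto simp: c_def powr_divide powr_diff powr_minus field_simps)
    also have "\<dots> = (\<integral>\<^sup>+t. ennreal ((1 - cos 1) * (2 / \<bar>z\<bar>) powr (-1 - q)) * indicator {1 / \<bar>z\<bar>..2 / \<bar>z\<bar>} t \<partial>lborel)"
      using False by (subst nn_integral_cmult_indicator) (auto simp: divide_right_mono)
    also have "\<dots> \<le> h z"
      unfolding h_def
    proof (intro nn_integral_mono)
      fix t :: real
      have "(1 - cos 1) * (2 / \<bar>z\<bar>) powr (-1 - q) \<le> (1 - cos (t * z)) * t powr (-1 - q) \<and> 0 < t"
        if t: "t \<in> {1 / \<bar>z\<bar>..2 / \<bar>z\<bar>}"
      proof -
        have t0: "0 < t" using t False by (auto intro: less_le_trans[of 0 "1 / \<bar>z\<bar>"])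
        have "1 \<le> t * \<bar>z\<bar>" "t * \<bar>z\<bar> \<le> 2" using t False by (auto simp: field_simps)
        then have "cos (t * \<bar>z\<bar>) \<le> cos 1" using pi_gt3 by (intro cos_monotone_0_pi_le) auto
        moreover have "cos (t * \<bar>z\<bar>) = cos (t * z)" by (cases "z \<ge> 0") auto
        ultimately have "1 - cos 1 \<le> 1 - cos (t * z)" by simp
        moreover have "(2 / \<bar>z\<bar>) powr (-1 - q) \<le> t powr (-1 - q)"
          using t t0 \<open>0 < q\<close> by (intro powr_mono2') auto
        ultimately show ?thesis using t0 by (auto intro!: mult_mono)
      qed
      then show "ennreal ((1 - cos 1) * (2 / \<bar>z\<bar>) powr (-1 - q)) * indicator {1 / \<bar>z\<bar>..2 / \<bar>z\<bar>} t
        \<le> ennreal ((1 - cos (t * z)) * t powr (-1 - q)) * indicator {0<..} t"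
        by (auto simp: indicator_def intro!: ennreal_leI)
    qed
    finally show ?thesis .
  qed (use assms in simp)
  have Re_char: "(\<integral>\<^sup>+\<omega>. ennreal (1 - cos (t * Z \<omega>)) \<partial>M) = ennreal (1 - exp (- ((\<sigma> * \<bar>t\<bar>) powr \<alpha>)))" for t
  proof -
    have "integrable M (\<lambda>\<omega>. cos (t * Z \<omega>))" by (rule integrable_const_bound[where B=1]) auto
    moreover have "(\<integral>\<omega>. cos (t * Z \<omega>) \<partial>M) = Re (\<integral>\<omega>. iexp (t * Z \<omega>) \<partial>M)"
      by (subst integral_Re[symmetric]) (auto intro!: integrable_iexp simp: Re_exp)
    moreover have "\<dots> = exp (- ((\<sigma> * \<bar>t\<bar>) powr \<alpha>))"
      using char[of t] by (simp add: char_distr)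
    ultimately show ?thesis
      by (subst nn_integral_eq_integral) (auto simp: prob_space)
  qed
  interpret pair_sigma_finite M lborel
    by (simp add: pair_sigma_finite_def sigma_finite_measure_axioms lborel.sigma_finite_measure_axioms)
  have "ennreal c * (\<integral>\<^sup>+\<omega>. ennreal (\<bar>Z \<omega>\<bar> powr q) \<partial>M) = (\<integral>\<^sup>+\<omega>. ennreal (c * \<bar>Z \<omega>\<bar> powr q) \<partial>M)"
    using c by (simp add: ennreal_mult' nn_integral_cmult)
  also have "\<dots> \<le> (\<integral>\<^sup>+\<omega>. h (Z \<omega>) \<partial>M)"
    by (intro nn_integral_mono lower)
  also have "\<dots> = (\<integral>\<^sup>+t. (\<integral>\<^sup>+\<omega>. ennreal ((1 - cos (t * Z \<omega>)) * t powr (-1 - q)) * indicator {0<..} t \<partial>M) \<partial>lborel)"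
    unfolding h_def by (rule Fubini'[symmetric]) measurable
  also have "\<dots> = (\<integral>\<^sup>+t. ennreal ((1 - exp (- ((\<sigma> * \<bar>t\<bar>) powr \<alpha>))) * t powr (-1 - q)) * indicator {0<..} t \<partial>lborel)"
    by (intro nn_integral_cong, subst ennreal_mult'', simp, subst ennreal_mult'', simp)
       (simp add: nn_integral_multc Re_char)
  \<comment> \<open>On [0, 1] the inequality 1 - exp (-x) \<le> x gains the power t^\<alpha>; beyond
    1 the trivial bound 1 is enough.\<close>
  also have "\<dots> \<le> (\<integral>\<^sup>+t. ennreal (\<sigma> powr \<alpha> * t powr (\<alpha> - 1 - q)) * indicator {0..1} t
      + ennreal (t powr (-1 - q)) * indicator {1..} t \<partial>lborel)"
  proof (intro nn_integral_mono)
    fix t :: real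
    have "1 - exp (- ((\<sigma> * \<bar>t\<bar>) powr \<alpha>)) \<le> (\<sigma> * \<bar>t\<bar>) powr \<alpha>"
      using exp_ge_add_one_self[of "- ((\<sigma> * \<bar>t\<bar>) powr \<alpha>)"] by simp
    then have "(1 - exp (- ((\<sigma> * \<bar>t\<bar>) powr \<alpha>))) * t powr (-1 - q) \<le> (\<sigma> * \<bar>t\<bar>) powr \<alpha> * t powr (-1 - q)"
      by (rule mult_right_mono) simp
    also have "\<dots> = \<sigma> powr \<alpha> * t powr (\<alpha> - 1 - q)" if "0 < t"
      using that assms by (simp add: powr_mult mult.assoc flip: powr_add) (simp add: algebra_simps)
    finally have 1: "(1 - exp (- ((\<sigma> * \<bar>t\<bar>) powr \<alpha>))) * t powr (-1 - q) \<le> \<sigma> powr \<alpha> * t powr (\<alpha> - 1 - q)" if "0 < t"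
      using that by simp
    have 2: "(1 - exp (- ((\<sigma> * \<bar>t\<bar>) powr \<alpha>))) * t powr (-1 - q) \<le> t powr (-1 - q)"
      using mult_right_mono[of "1 - exp (- ((\<sigma> * \<bar>t\<bar>) powr \<alpha>))" 1 "t powr (-1 - q)"] by simp
    show "ennreal ((1 - exp (- ((\<sigma> * \<bar>t\<bar>) powr \<alpha>))) * t powr (-1 - q)) * indicator {0<..} t
      \<le> ennreal (\<sigma> powr \<alpha> * t powr (\<alpha> - 1 - q)) * indicator {0..1} t + ennreal (t powr (-1 - q)) * indicator {1..} t"
      using 1 2 by (auto simp: indicator_def intro!: ennreal_leI add_increasing2)
  qed
  also have "\<dots> = (\<integral>\<^sup>+t. ennreal (\<sigma> powr \<alpha> * t powr (\<alpha> - 1 - q)) * indicator {0..1} t \<partial>lborel)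
      + (\<integral>\<^sup>+t. ennreal (t powr (-1 - q)) * indicator {1..} t \<partial>lborel)"
    by (rule nn_integral_add) auto
  also have "(\<integral>\<^sup>+t. ennreal (\<sigma> powr \<alpha> * t powr (\<alpha> - 1 - q)) * indicator {0..1} t \<partial>lborel) = ennreal (\<sigma> powr \<alpha> * (1 / (\<alpha> - q)))"
    using has_integral_mult_right[OF has_integral_powr_from_0[of "\<alpha> - 1 - q" 1], of "\<sigma> powr \<alpha>"] assms
    by (intro nn_integral_has_integral_lebesgue') auto
  also have "(\<integral>\<^sup>+t. ennreal (t powr (-1 - q)) * indicator {1..} t \<partial>lborel) = ennreal (1 / q)"
    using has_integral_powr_to_inf[of "-1 - q" 1] assms
    by (intro nn_integral_has_integral_lebesgue') auto
  finally have "ennreal c * (\<integral>\<^sup>+\<omega>. ennreal (\<bar>Z \<omega>\<bar> powr q) \<partial>M) < \<infinity>"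
    by (rule le_less_trans) simp
  then show ?thesis using c by (auto simp: ennreal_mult_less_top)
qed

text \<open>The half-open cells are disjoint, so at each point at most one summand is nonzero and
  the power acts termwise. In the induction the earlier cells vanish to the right of t n.\<close>

lemma nn_integral_step_powr:
  fixes t d :: "nat \<Rightarrow> real"
  assumes "\<forall>j<n. t j \<le> t (Suc j)" "0 < \<alpha>"
  shows "(\<integral>\<^sup>+u. ennreal (\<bar>\<Sum>j<n. d j * indicator {t j<..t (Suc j)} u\<bar> powr \<alpha>) \<partial>lborel) =
    ennreal (\<Sum>j<n. \<bar>d j\<bar> powr \<alpha> * (t (Suc j) - t j))"
  using assms(1)
proof (induction n)
  case (Suc n)
  define S where "S u = (\<Sum>j<n. d j * indicator {t j<..t (Suc j)} u)" for u
  have mono: "t i \<le> t j" if "i \<le> j" "j \<le> n" for i j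
    using that Suc.prems by (induction rule: dec_induct) (auto intro: order.trans)
  have S0: "S u = 0" if "t n < u" for u
  proof -
    have "u \<notin> {t j<..t (Suc j)}" if "j < n" for j using mono[of "Suc j" n] that \<open>t n < u\<close> by auto
    then show ?thesis unfolding S_def by (intro sum.neutral) auto
  qed
  have [measurable]: "S \<in> borel_measurable borel" unfolding S_def by measurable
  have "(\<integral>\<^sup>+u. ennreal (\<bar>\<Sum>j<Suc n. d j * indicator {t j<..t (Suc j)} u\<bar> powr \<alpha>) \<partial>lborel) =
    (\<integral>\<^sup>+u. ennreal (\<bar>S u\<bar> powr \<alpha>) + ennreal (\<bar>d n\<bar> powr \<alpha>) * indicator {t n<..t (Suc n)} u \<partial>lborel)"
  proof (intro nn_integral_cong)
    fix u
    show "ennreal (\<bar>\<Sum>j<Suc n. d j * indicator {t j<..t (Suc j)} u\<bar> powr \<alpha>)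
      = ennreal (\<bar>S u\<bar> powr \<alpha>) + ennreal (\<bar>d n\<bar> powr \<alpha>) * indicator {t n<..t (Suc n)} u"
      using S0[of u] assms(2) by (cases "u \<in> {t n<..t (Suc n)}") (auto simp: S_def)
  qed
  also have "\<dots> = (\<integral>\<^sup>+u. ennreal (\<bar>S u\<bar> powr \<alpha>) \<partial>lborel) + ennreal (\<bar>d n\<bar> powr \<alpha>) * ennreal (t (Suc n) - t n)"
    using Suc.prems by (subst nn_integral_add) (auto simp: nn_integral_cmult_indicator)
  also have "(\<integral>\<^sup>+u. ennreal (\<bar>S u\<bar> powr \<alpha>) \<partial>lborel) = ennreal (\<Sum>j<n. \<bar>d j\<bar> powr \<alpha> * (t (Suc j) - t j))"
    unfolding S_def using Suc by auto
  finally show ?case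
    using Suc.prems by (subst sum.lessThan_Suc, subst ennreal_plus) (auto simp: ennreal_mult' intro!: sum_nonneg)
qed simp

text \<open>The form in which the process is used: independent increments with an explicit
  characteristic function, linear in the length of the interval in the exponent. \<sigma> is the
  scale of the increment over a unit interval.\<close>

locale stable_process = prob_space M for M :: "'a measure" +
  fixes X :: "real \<Rightarrow> 'a \<Rightarrow> real" and \<alpha> \<sigma> :: real
  assumes measurable_X[measurable]: "\<And>t. X t \<in> borel_measurable M"
    and \<alpha>: "1 < \<alpha>" and \<sigma>: "0 < \<sigma>"
    and independent: "independent_increments M X"
    and char_increment: "\<And>a b t. a \<le> b \<Longrightarrow> char (distr M borel (\<lambda>\<omega>. X b \<omega> - X a \<omega>)) t =
      complex_of_real (exp (- ((\<sigma> * \<bar>t\<bar>) powr \<alpha> * (b - a))))"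
begin

definition unit_moment :: "real \<Rightarrow> ennreal" where
  "unit_moment q = (\<integral>\<^sup>+\<omega>. ennreal (\<bar>X 1 \<omega> - X 0 \<omega>\<bar> powr q) \<partial>M)"

lemma unit_moment_finite:
  assumes "0 < q" "q < \<alpha>"
  shows "unit_moment q < \<infinity>"
  unfolding unit_moment_def using char_increment[of 0 1] \<sigma> assms
  by (intro nn_integral_powr_finite_if_char_exp[where \<sigma>=\<sigma> and \<alpha>=\<alpha>]) auto

text \<open>Independence makes the characteristic function a product, so exponents add. The
  resulting sum is the integral of the \<alpha>-th power of the step function, as evaluated in
  \<open>nn_integral_step_powr\<close>.\<close>

lemma char_step_sum:
  fixes t d :: "nat \<Rightarrow> real"
  assumes "\<forall>j<n. t j \<le> t (Suc j)"
  shows "char (distr M borel (\<lambda>\<omega>. \<Sum>j<n. d j * (X (t (Suc j)) \<omega> - X (t j) \<omega>))) \<theta> =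
    complex_of_real (exp (- ((\<sigma> * \<bar>\<theta>\<bar>) powr \<alpha> * (\<Sum>j<n. \<bar>d j\<bar> powr \<alpha> * (t (Suc j) - t j)))))"
proof -
  have "indep_vars (\<lambda>_. borel) (\<lambda>j \<omega>. X (t (Suc j)) \<omega> - X (t j) \<omega>) {..<n}"
    using independent assms unfolding independent_increments_def by blast
  then have "indep_vars (\<lambda>_. borel) (\<lambda>j \<omega>. d j * (X (t (Suc j)) \<omega> - X (t j) \<omega>)) {..<n}"
    by (rule indep_vars_compose2[where Y="\<lambda>j x. d j * x"]) measurable
  then have "char (distr M borel (\<lambda>\<omega>. \<Sum>j<n. d j * (X (t (Suc j)) \<omega> - X (t j) \<omega>))) \<theta> =
    (\<Prod>j<n. char (distr M borel (\<lambda>\<omega>. d j * (X (t (Suc j)) \<omega> - X (t j) \<omega>))) \<theta>)"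
    by (rule char_distr_sum)
  also have "\<dots> = (\<Prod>j<n. char (distr M borel (\<lambda>\<omega>. X (t (Suc j)) \<omega> - X (t j) \<omega>)) (\<theta> * d j))"
    by (simp add: char_distr mult.assoc)
  also have "\<dots> = (\<Prod>j<n. complex_of_real (exp (- ((\<sigma> * \<bar>\<theta>\<bar>) powr \<alpha> * (\<bar>d j\<bar> powr \<alpha> * (t (Suc j) - t j))))))"
  proof (intro prod.cong refl)
    fix j assume "j \<in> {..<n}"
    then have "t j \<le> t (Suc j)" using assms by auto
    moreover have "(\<sigma> * \<bar>\<theta> * d j\<bar>) powr \<alpha> = (\<sigma> * \<bar>\<theta>\<bar>) powr \<alpha> * \<bar>d j\<bar> powr \<alpha>"
      using \<sigma> by (simp add: abs_mult powr_mult mult.assoc)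
    ultimately show "char (distr M borel (\<lambda>\<omega>. X (t (Suc j)) \<omega> - X (t j) \<omega>)) (\<theta> * d j) =
      complex_of_real (exp (- ((\<sigma> * \<bar>\<theta>\<bar>) powr \<alpha> * (\<bar>d j\<bar> powr \<alpha> * (t (Suc j) - t j)))))"
      by (simp add: char_increment mult.assoc)
  qed
  also have "\<dots> = complex_of_real (exp (- ((\<sigma> * \<bar>\<theta>\<bar>) powr \<alpha> * (\<Sum>j<n. \<bar>d j\<bar> powr \<alpha> * (t (Suc j) - t j)))))"
    by (simp add: sum_distrib_left exp_sum flip: of_real_prod sum_negf)
  finally show ?thesis .
qed

text \<open>Such a U has the law of \<open>A powr (1 / \<alpha>)\<close> times the unit increment; A
  = 0 is the degenerate case.\<close>

lemma nn_integral_powr_if_char_stable: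
  assumes [measurable]: "U \<in> borel_measurable M" and "0 \<le> A"
    and "\<And>\<theta>. char (distr M borel U) \<theta> = complex_of_real (exp (- ((\<sigma> * \<bar>\<theta>\<bar>) powr \<alpha> * A)))"
  shows "(\<integral>\<^sup>+\<omega>. ennreal (\<bar>U \<omega>\<bar> powr q) \<partial>M) = ennreal (A powr (q / \<alpha>)) * unit_moment q"
proof -
  have "(\<integral>\<^sup>+\<omega>. ennreal (\<bar>U \<omega>\<bar> powr q) \<partial>M) = ennreal ((A powr (1 / \<alpha>)) powr q) * unit_moment q"
    unfolding unit_moment_def
  proof (rule nn_integral_powr_eq_if_char_eq)
    fix \<theta>
    have "(\<sigma> * \<bar>A powr (1 / \<alpha>) * \<theta>\<bar>) powr \<alpha> = (\<sigma> * \<bar>\<theta>\<bar>) powr \<alpha> * (A powr (1 / \<alpha>)) powr \<alpha>"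
      using \<sigma> by (simp add: abs_mult powr_mult)
    also have "(A powr (1 / \<alpha>)) powr \<alpha> = A"
      using \<alpha> \<open>0 \<le> A\<close> by (simp add: powr_powr)
    finally show "char (distr M borel U) \<theta> = char (distr M borel (\<lambda>\<omega>. X 1 \<omega> - X 0 \<omega>)) (A powr (1 / \<alpha>) * \<theta>)"
      by (simp add: assms char_increment)
  qed auto
  then show ?thesis by (simp add: powr_powr)
qed

lemma nn_integral_step_sum_powr:
  fixes t d :: "nat \<Rightarrow> real"
  assumes "\<forall>j<n. t j \<le> t (Suc j)"
  shows "(\<integral>\<^sup>+\<omega>. ennreal (\<bar>\<Sum>j<n. d j * (X (t (Suc j)) \<omega> - X (t j) \<omega>)\<bar> powr q) \<partial>M) =
    ennreal ((\<Sum>j<n. \<bar>d j\<bar> powr \<alpha> * (t (Suc j) - t j)) powr (q / \<alpha>)) * unit_moment q"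
  using assms by (intro nn_integral_powr_if_char_stable char_step_sum sum_nonneg) auto

lemma Re_step_integral:
  "Re (z * step_integral n t c X \<omega>) = (\<Sum>j<n. Re (z * c j) * (X (t (Suc j)) \<omega> - X (t j) \<omega>))"
  by (simp add: step_integral_def sum_distrib_left algebra_simps sum_subtractf sum.distrib)

lemma Re_step_fun:
  "Re (z * step_fun n t c u) = (\<Sum>j<n. Re (z * c j) * indicator {t j<..t (Suc j)} u)"
  unfolding step_fun_def sum_distrib_left Re_sum by (intro sum.cong) (auto simp: indicator_def)

lemma measurable_step_integral[measurable]: "step_integral n t c X \<in> borel_measurable M"
  unfolding step_integral_def by measurable

lemma measurable_step_fun[measurable]: "step_fun n t c \<in> borel_measurable borel"
  unfolding step_fun_def by measurable

text \<open>Up to the factor \<sigma>^\<alpha>, this is the \<alpha>-th power of the scale parameter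
  of the projected integral at angle \<theta>.\<close>

definition proj_integral :: "(real \<Rightarrow> complex) \<Rightarrow> real \<Rightarrow> real" where
  "proj_integral f \<theta> = enn2real (\<integral>\<^sup>+u. ennreal (\<bar>Re (cis \<theta> * f u)\<bar> powr \<alpha>) \<partial>lborel)"

lemma nn_integral_proj_le:
  "(\<integral>\<^sup>+u. ennreal (\<bar>Re (cis \<theta> * f u)\<bar> powr \<alpha>) \<partial>lborel) \<le> (\<integral>\<^sup>+u. ennreal (norm (f u) powr \<alpha>) \<partial>lborel)"
proof (intro nn_integral_mono ennreal_leI powr_mono2)
  fix u show "\<bar>Re (cis \<theta> * f u)\<bar> \<le> norm (f u)"
    using abs_Re_le_cmod[of "cis \<theta> * f u"] by (simp add: norm_mult)
qed (use \<alpha> in auto)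

text \<open>Along the approximating step functions the exponents converge by convergence in the
  space L^\<alpha>, and the characteristic functions converge by convergence in probability;
  comparing the limits gives the law. It holds for every version Y, so the arbitrary choice in
  \<open>stable_integral\<close> has no effect on moments.\<close>

lemma char_stable_integral:
  assumes Y: "has_stable_integral \<alpha> M X f Y" and [measurable]: "f \<in> borel_measurable borel"
    and fin: "(\<integral>\<^sup>+u. ennreal (norm (f u) powr \<alpha>) \<partial>lborel) < \<infinity>"
  shows "char (distr M borel (\<lambda>\<omega>. Re (cis \<theta> * Y \<omega>))) l =
    complex_of_real (exp (- ((\<sigma> * \<bar>l\<bar>) powr \<alpha> * proj_integral f \<theta>)))"
proof -
  from Y obtain n t c where t: "\<And>k. \<forall>j<n k. t k j \<le> t k (Suc j)"
    and lim: "(\<lambda>k::nat. \<integral>\<^sup>+u. ennreal (norm (step_fun (n k) (t k) (c k) u - f u) powr \<alpha>) \<partial>lborel) \<longlonglongrightarrow> 0"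
    and prob: "tendsto_in_prob M (\<lambda>k::nat. step_integral (n k) (t k) (c k) X) Y sequentially"
    and [measurable]: "Y \<in> borel_measurable M"
    unfolding has_stable_integral_def by blast
  define F where "F k u = Re (cis \<theta> * step_fun (n k) (t k) (c k) u)" for k u
  define a where "a k = (\<Sum>j<n k. \<bar>Re (cis \<theta> * c k j)\<bar> powr \<alpha> * (t k (Suc j) - t k j))" for k
  have a: "0 \<le> a k" for k using t[of k] unfolding a_def by (intro sum_nonneg) auto
  have [measurable]: "F k \<in> borel_measurable borel" for k unfolding F_def by measurable
  have "(\<lambda>k. \<integral>\<^sup>+u. ennreal (norm (F k u) powr \<alpha>) \<partial>lborel) \<longlonglongrightarrow> (\<integral>\<^sup>+u. ennreal (norm (Re (cis \<theta> * f u)) powr \<alpha>) \<partial>lborel)"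
  proof (rule tendsto_nn_integral_powr)
    show "(\<lambda>k. \<integral>\<^sup>+u. ennreal (norm (F k u - Re (cis \<theta> * f u)) powr \<alpha>) \<partial>lborel) \<longlonglongrightarrow> 0"
    proof (rule tendsto_sandwich[OF _ _ tendsto_const lim])
      have "F k u - Re (cis \<theta> * f u) = Re (cis \<theta> * (step_fun (n k) (t k) (c k) u - f u))" for k u
        unfolding F_def by (simp add: right_diff_distrib del: Re_complex_of_real)
      then show "\<forall>\<^sub>F k in sequentially. (\<integral>\<^sup>+u. ennreal (norm (F k u - Re (cis \<theta> * f u)) powr \<alpha>) \<partial>lborel)
        \<le> (\<integral>\<^sup>+u. ennreal (norm (step_fun (n k) (t k) (c k) u - f u) powr \<alpha>) \<partial>lborel)"
        by (simp only: real_norm_def) (intro always_eventually allI nn_integral_proj_le)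
    qed simp
    show "(\<integral>\<^sup>+u. ennreal (norm (Re (cis \<theta> * f u)) powr \<alpha>) \<partial>lborel) < \<infinity>"
      unfolding real_norm_def using nn_integral_proj_le fin by (rule le_less_trans)
  qed (use \<alpha> in auto)
  moreover have "(\<integral>\<^sup>+u. ennreal (norm (F k u) powr \<alpha>) \<partial>lborel) = ennreal (a k)" for k
    unfolding F_def Re_step_fun a_def real_norm_def using \<alpha> t[of k] by (intro nn_integral_step_powr) auto
  ultimately have "(\<lambda>k. ennreal (a k)) \<longlonglongrightarrow> (\<integral>\<^sup>+u. ennreal (\<bar>Re (cis \<theta> * f u)\<bar> powr \<alpha>) \<partial>lborel)"
    by simp
  moreover have "(\<integral>\<^sup>+u. ennreal (\<bar>Re (cis \<theta> * f u)\<bar> powr \<alpha>) \<partial>lborel) \<noteq> \<infinity>"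
    using le_less_trans[OF nn_integral_proj_le fin, of \<theta>] by auto
  ultimately have "(\<lambda>k. enn2real (ennreal (a k))) \<longlonglongrightarrow> proj_integral f \<theta>"
    unfolding proj_integral_def by (intro tendsto_enn2real) (auto simp: top.not_eq_extremum)
  then have alim: "a \<longlonglongrightarrow> proj_integral f \<theta>" using a by simp
  have "(\<lambda>k. char (distr M borel (\<lambda>\<omega>. Re (cis \<theta> * step_integral (n k) (t k) (c k) X \<omega>))) l)
    \<longlonglongrightarrow> char (distr M borel (\<lambda>\<omega>. Re (cis \<theta> * Y \<omega>))) l"
  proof (rule tendsto_char_in_prob)
    show "tendsto_in_prob M (\<lambda>k \<omega>. Re (cis \<theta> * step_integral (n k) (t k) (c k) X \<omega>)) (\<lambda>\<omega>. Re (cis \<theta> * Y \<omega>)) sequentially"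
      unfolding tendsto_in_prob_def
    proof (intro allI impI)
      fix \<epsilon> :: real assume "0 < \<epsilon>"
      then have lim': "(\<lambda>k. measure M {\<omega> \<in> space M. \<epsilon> < norm (step_integral (n k) (t k) (c k) X \<omega> - Y \<omega>)}) \<longlonglongrightarrow> 0"
        using prob unfolding tendsto_in_prob_def by blast
      show "(\<lambda>k. measure M {\<omega> \<in> space M. \<epsilon> < norm (Re (cis \<theta> * step_integral (n k) (t k) (c k) X \<omega>) - Re (cis \<theta> * Y \<omega>))}) \<longlonglongrightarrow> 0"
      proof (rule tendsto_sandwich[OF _ _ tendsto_const lim'])
        \<comment> \<open>Projections are contractions, so a deviation of the projection forces one
          of the complex integrals.\<close>
        have "norm (Re (cis \<theta> * z) - Re (cis \<theta> * y)) \<le> norm (z - y)" for z y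
          using abs_Re_le_cmod[of "cis \<theta> * (z - y)"] 
          unfolding right_diff_distrib minus_complex.sel(1)[symmetric] norm_mult[symmetric] real_norm_def 
          by (simp only: minus_complex.sel right_diff_distrib[symmetric] norm_mult norm_cis mult_1)
        then show "\<forall>\<^sub>F k in sequentially. measure M {\<omega> \<in> space M. \<epsilon> < norm (Re (cis \<theta> * step_integral (n k) (t k) (c k) X \<omega>) - Re (cis \<theta> * Y \<omega>))}
          \<le> measure M {\<omega> \<in> space M. \<epsilon> < norm (step_integral (n k) (t k) (c k) X \<omega> - Y \<omega>)}"
          by (intro always_eventually allI finite_measure_mono) (auto intro: less_le_trans)
      qed simp
    qed
  qed auto
  moreover have "char (distr M borel (\<lambda>\<omega>. Re (cis \<theta> * step_integral (n k) (t k) (c k) X \<omega>))) l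
      = complex_of_real (exp (- ((\<sigma> * \<bar>l\<bar>) powr \<alpha> * a k)))" for k
    unfolding Re_step_integral a_def by (rule char_step_sum[OF t])
  moreover have "(\<lambda>k. complex_of_real (exp (- ((\<sigma> * \<bar>l\<bar>) powr \<alpha> * a k)))) \<longlonglongrightarrow>
      complex_of_real (exp (- ((\<sigma> * \<bar>l\<bar>) powr \<alpha> * proj_integral f \<theta>)))"
    by (intro tendsto_intros alim)
  ultimately show ?thesis using LIMSEQ_unique by auto
qed

text \<open>The integrand enters only through \<open>proj_integral\<close>; the process contributes
  the single factor \<open>unit_moment p\<close>. Scaling and limits thus become questions about
  Lebesgue integrals.\<close>

lemma nn_integral_stable_integral_powr:
  assumes Y: "has_stable_integral \<alpha> M X f Y" and [measurable]: "f \<in> borel_measurable borel"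
    and fin: "(\<integral>\<^sup>+u. ennreal (norm (f u) powr \<alpha>) \<partial>lborel) < \<infinity>"
  shows "cos_moment p * (\<integral>\<^sup>+\<omega>. ennreal (norm (Y \<omega>) powr p) \<partial>M) =
    unit_moment p * (\<integral>\<^sup>+\<theta>\<in>{0..2 * pi}. ennreal (proj_integral f \<theta> powr (p / \<alpha>)) \<partial>lborel)"
proof -
  interpret pair_sigma_finite lborel lborel ..
  have [measurable]: "cis \<in> borel_measurable borel"
    by (intro borel_measurable_continuous_onI continuous_intros)
  have [measurable]: "proj_integral f \<in> borel_measurable borel"
    unfolding proj_integral_def by measurable
  have [measurable]: "Y \<in> borel_measurable M" using Y by (simp add: has_stable_integral_def)
  have "cos_moment p * (\<integral>\<^sup>+\<omega>. ennreal (norm (Y \<omega>) powr p) \<partial>M) =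
    (\<integral>\<^sup>+\<theta>\<in>{0..2 * pi}. (\<integral>\<^sup>+\<omega>. ennreal (\<bar>Re (cis \<theta> * Y \<omega>)\<bar> powr p) \<partial>M) \<partial>lborel)"
    by (rule nn_integral_norm_powr_projections) (auto simp: sigma_finite_measure_axioms)
  also have "\<dots> = (\<integral>\<^sup>+\<theta>. unit_moment p * (ennreal (proj_integral f \<theta> powr (p / \<alpha>)) * indicator {0..2 * pi} \<theta>) \<partial>lborel)"
    by (subst nn_integral_powr_if_char_stable[OF _ _ char_stable_integral[OF assms]])
       (auto simp: proj_integral_def ac_simps)
  also have "\<dots> = unit_moment p * (\<integral>\<^sup>+\<theta>\<in>{0..2 * pi}. ennreal (proj_integral f \<theta> powr (p / \<alpha>)) \<partial>lborel)"
    by (rule nn_integral_cmult) measurable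
  finally show ?thesis .
qed

end

section \<open>Existence of the stable integral\<close>

lemma (in prob_space) tendsto_in_prob_AE:
  fixes S :: "nat \<Rightarrow> 'a \<Rightarrow> 'b::{second_countable_topology, real_normed_vector}"
  assumes [measurable]: "\<And>k. S k \<in> borel_measurable M" "Y \<in> borel_measurable M"
    and lim: "AE \<omega> in M. (\<lambda>k. S k \<omega>) \<longlonglongrightarrow> Y \<omega>"
  shows "tendsto_in_prob M S Y sequentially"
  unfolding tendsto_in_prob_def
proof (intro allI impI)
  fix \<epsilon> :: real assume "0 < \<epsilon>"
  define B where "B k = {\<omega> \<in> space M. \<epsilon> < norm (S k \<omega> - Y \<omega>)}" for k
  have [measurable]: "B k \<in> sets M" for k unfolding B_def by measurable
  have "(\<lambda>k. \<integral>\<omega>. indicator (B k) \<omega> \<partial>M) \<longlonglongrightarrow> (\<integral>\<omega>. 0 \<partial>M :: real)"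
  proof (rule integral_dominated_convergence[where w="\<lambda>_. 1"])
    show "AE \<omega> in M. (\<lambda>k. indicator (B k) \<omega> :: real) \<longlonglongrightarrow> 0"
      using lim
    proof eventually_elim
      case (elim \<omega>)
      then have "\<forall>\<^sub>F k in sequentially. dist (S k \<omega>) (Y \<omega>) < \<epsilon>"
        using \<open>0 < \<epsilon>\<close> by (rule tendstoD)
      then have "\<forall>\<^sub>F k in sequentially. indicator (B k) \<omega> = (0::real)"
        by eventually_elim (auto simp: B_def dist_norm)
      then show ?case by (rule tendsto_eventually)
    qed
  qed (auto simp: indicator_def)
  then show "(\<lambda>k. measure M {\<omega> \<in> space M. \<epsilon> < norm (S k \<omega> - Y \<omega>)}) \<longlonglongrightarrow> 0"
    by (simp add: B_def[symmetric])
qed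

lemma sum_indicator_consecutive:
  fixes t :: "nat \<Rightarrow> real"
  assumes "\<forall>j<n. t j \<le> t (Suc j)"
  shows "t 0 \<le> t n \<and> (\<Sum>j<n. indicator {t j<..t (Suc j)} u) = (indicator {t 0<..t n} u :: real)"
  using assms
proof (induction n)
  case (Suc n)
  then have "t 0 \<le> t n" "t n \<le> t (Suc n)" by auto
  then show ?case using Suc by (auto simp: indicator_def)
qed simp

context stable_process
begin

text \<open>First moments of the projections are explicit, so small coefficients give a small
  integral in L^1(M). This turns uniform closeness of step functions into summability;
  \<open>unit_moment 1\<close> is finite because \<alpha> > 1.\<close>

lemma nn_integral_step_integral_norm_le:
  assumes t: "\<forall>j<n. t j \<le> t (Suc j)" and c: "\<And>j. j < n \<Longrightarrow> norm (c j) \<le> \<epsilon>" and "0 \<le> \<epsilon>"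
  shows "(\<integral>\<^sup>+\<omega>. ennreal (norm (step_integral n t c X \<omega>)) \<partial>M) \<le>
    ennreal (\<epsilon> * (2 * (t n - t 0) powr (1 / \<alpha>))) * unit_moment 1"
proof -
  \<comment> \<open>Used with z = 1 and z = - \<i>, which produce the real and the imaginary part;
    hence the factor 2 in the result.\<close>
  have bound: "(\<integral>\<^sup>+\<omega>. ennreal \<bar>Re (z * step_integral n t c X \<omega>)\<bar> \<partial>M) \<le>
    ennreal (\<epsilon> * (t n - t 0) powr (1 / \<alpha>)) * unit_moment 1" if "norm z = 1" for z
  proof -
    have eq: "(\<integral>\<^sup>+\<omega>. ennreal \<bar>Re (z * step_integral n t c X \<omega>)\<bar> \<partial>M) =
      ennreal ((\<Sum>j<n. \<bar>Re (z * c j)\<bar> powr \<alpha> * (t (Suc j) - t j)) powr (1 / \<alpha>)) * unit_moment 1"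
      using nn_integral_step_sum_powr[OF t, of "\<lambda>j. Re (z * c j)" 1] unfolding Re_step_integral by simp
    have "(\<Sum>j<n. \<bar>Re (z * c j)\<bar> powr \<alpha> * (t (Suc j) - t j)) \<le> (\<Sum>j<n. \<epsilon> powr \<alpha> * (t (Suc j) - t j))"
    proof (intro sum_mono mult_right_mono powr_mono2)
      fix j assume "j \<in> {..<n}"
      then show "\<bar>Re (z * c j)\<bar> \<le> \<epsilon>"
        using abs_Re_le_cmod[of "z * c j"] c[of j] that by (simp add: norm_mult)
    qed (use t \<alpha> in auto)
    also have "\<dots> = \<epsilon> powr \<alpha> * (t n - t 0)"
      by (simp add: sum_distrib_left[symmetric] sum_lessThan_telescope)
    finally have "(\<Sum>j<n. \<bar>Re (z * c j)\<bar> powr \<alpha> * (t (Suc j) - t j)) powr (1 / \<alpha>) \<le> (\<epsilon> powr \<alpha> * (t n - t 0)) powr (1 / \<alpha>)"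
      using t \<alpha> by (intro powr_mono2 sum_nonneg) auto
    also have "\<dots> = \<epsilon> * (t n - t 0) powr (1 / \<alpha>)"
      using \<alpha> sum_indicator_consecutive[OF t] \<open>0 \<le> \<epsilon>\<close> by (simp add: powr_mult powr_powr)
    finally show ?thesis
      unfolding eq by (intro mult_right_mono ennreal_leI) auto
  qed
  have "(\<integral>\<^sup>+\<omega>. ennreal (norm (step_integral n t c X \<omega>)) \<partial>M) \<le>
    (\<integral>\<^sup>+\<omega>. ennreal \<bar>Re (1 * step_integral n t c X \<omega>)\<bar> + ennreal \<bar>Re (- \<i> * step_integral n t c X \<omega>)\<bar> \<partial>M)"
    using cmod_le by (intro nn_integral_mono) (simp flip: ennreal_plus)
  also have "\<dots> \<le> ennreal (\<epsilon> * (t n - t 0) powr (1 / \<alpha>)) * unit_moment 1 + ennreal (\<epsilon> * (t n - t 0) powr (1 / \<alpha>)) * unit_moment 1"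
    by (subst nn_integral_add) (auto intro!: add_mono bound[of 1, simplified] bound[of "- \<i>", simplified])
  also have "\<dots> = ennreal (\<epsilon> * (2 * (t n - t 0) powr (1 / \<alpha>))) * unit_moment 1"
    using \<open>0 \<le> \<epsilon>\<close> by (simp add: distrib_right[symmetric] mult.assoc mult.left_commute[of \<epsilon>] flip: ennreal_plus)
  finally show ?thesis .
qed

text \<open>Step functions on dyadic grids that are fine enough to make the consecutive elementary
  integrals summable in \<open>L\<^sup>1(M)\<close>; their sum then converges almost surely.\<close>

lemma ex_stable_integral:
  assumes cont: "continuous_on UNIV f" and "a < b" and zero: "\<And>u. u \<notin> {a<..b} \<Longrightarrow> f u = 0"
  shows "\<exists>Y. has_stable_integral \<alpha> M X f Y"
proof -
  define t where "t r j = a + (b - a) / 2 ^ r * real j" for r j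
  have t_le: "t r j \<le> t r i \<longleftrightarrow> j \<le> i" for r i j   proof -
    have "0 < (b - a) / 2 ^ r" using \<open>a < b\<close> by simp
    then show ?thesis unfolding t_def by (simp only: add_le_cancel_left mult_le_cancel_left_pos of_nat_le_iff)
  qed
  have t_0: "t r 0 = a" and t_n: "t r (2 ^ r) = b" for r by (auto simp: t_def)
  have t_Suc: "t r (Suc j) - t r j = (b - a) / 2 ^ r" for r j by (simp add: t_def field_simps)
  have t_refine: "t r j = t (r + d) (j * 2 ^ d)" for r d j by (simp add: t_def power_add)
  have "\<exists>r. \<forall>u\<in>{a..b}. \<forall>v\<in>{a..b}. \<bar>u - v\<bar> \<le> (b - a) / 2 ^ r \<longrightarrow> norm (f u - f v) \<le> (1/2) ^ k" for k
  proof -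
    have "uniformly_continuous_on {a..b} f"
      using cont by (intro compact_uniformly_continuous) (auto intro: continuous_on_subset)
    then obtain \<delta> where \<delta>: "0 < \<delta>" "\<And>u v. u \<in> {a..b} \<Longrightarrow> v \<in> {a..b} \<Longrightarrow> dist u v < \<delta> \<Longrightarrow> dist (f u) (f v) < (1/2) ^ k"
      unfolding uniformly_continuous_on_def by (metis zero_less_power half_gt_zero zero_less_one)
    obtain r where "(1/2) ^ r < \<delta> / (b - a)"
      using real_arch_pow_inv[of "\<delta> / (b - a)" "1/2"] \<delta> \<open>a < b\<close> by auto
    then have "(b - a) / 2 ^ r < \<delta>" using \<open>a < b\<close> by (simp add: field_simps)
    then show ?thesis using \<delta>(2) by (intro exI[of _ r]) (force simp: dist_norm intro!: less_imp_le)
  qed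
  then obtain R0 where R0: "\<And>k u v. u \<in> {a..b} \<Longrightarrow> v \<in> {a..b} \<Longrightarrow> \<bar>u - v\<bar> \<le> (b - a) / 2 ^ R0 k \<Longrightarrow> norm (f u - f v) \<le> (1/2) ^ k"
    by metis
  \<comment> \<open>Cumulative exponents make each grid a refinement of the previous one, while
    \<open>R0 k \<le> R k\<close> keeps it fine enough.\<close>
  define R where "R k = (\<Sum>i\<le>k. R0 i)" for k
  have R: "norm (f u - f v) \<le> (1/2) ^ k" if "u \<in> {a..b}" "v \<in> {a..b}" "\<bar>u - v\<bar> \<le> (b - a) / 2 ^ R k" for k u v
  proof (rule R0[OF that(1,2)])
    have "R0 k \<le> R k" unfolding R_def by (intro member_le_sum) auto
    then have "(b - a) / 2 ^ R k \<le> (b - a) / 2 ^ R0 k"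
      using \<open>a < b\<close> by (intro divide_left_mono power_increasing) auto
    then show "\<bar>u - v\<bar> \<le> (b - a) / 2 ^ R0 k" using that(3) by simp
  qed
  define n :: "nat \<Rightarrow> nat" where "n k = 2 ^ R k" for k
  define T where "T k = t (R k)" for k
  define c where "c k j = f (T k (Suc j))" for k j
  have T_mono: "\<forall>j<n k. T k j \<le> T k (Suc j)" for k by (simp add: T_def t_le)
  have T_in: "T k j \<in> {a..b}" if "j \<le> n k" for k j
    using t_le[of "R k" 0 j] t_le[of "R k" j "2 ^ R k"] that by (simp add: T_def n_def t_0 t_n)
  have T_ends: "T k 0 = a" "T k (n k) = b" for k by (simp_all add: T_def n_def t_0 t_n)
  define S where "S k = step_integral (n k) (T k) (c k) X" for k

  have approx: "norm (step_fun (n k) (T k) (c k) u - f u) \<le> (1/2) ^ k * indicator {a<..b} u" for k u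
  proof -
    let ?I = "\<lambda>j. indicator {T k j<..T k (Suc j)} u :: real"
    have one: "(\<Sum>j<n k. ?I j) = indicator {a<..b} u"
      using sum_indicator_consecutive[OF T_mono, of k u] by (simp add: T_ends)
    have "f u = f u * complex_of_real (indicator {a<..b} u)" using zero by (auto simp: indicator_def)
    also have "\<dots> = (\<Sum>j<n k. f u * complex_of_real (?I j))"
      by (simp add: one[symmetric] sum_distrib_left)
    finally have "step_fun (n k) (T k) (c k) u - f u = (\<Sum>j<n k. c k j * complex_of_real (?I j)) - (\<Sum>j<n k. f u * complex_of_real (?I j))"
      by (simp add: step_fun_def indicator_def of_bool_def if_distrib cong: if_cong)
    also have "\<dots> = (\<Sum>j<n k. (c k j - f u) * complex_of_real (?I j))"
      by (simp add: sum_subtractf left_diff_distrib)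
    finally have "norm (step_fun (n k) (T k) (c k) u - f u) \<le> (\<Sum>j<n k. norm ((c k j - f u) * complex_of_real (?I j)))"
      by (simp only: norm_sum)
    also have "\<dots> \<le> (\<Sum>j<n k. (1/2) ^ k * ?I j)"
    proof (intro sum_mono)
      fix j assume j: "j \<in> {..<n k}"
      have "norm (c k j - f u) \<le> (1/2) ^ k" if "u \<in> {T k j<..T k (Suc j)}"
        unfolding c_def
      proof (rule R)
        show "T k (Suc j) \<in> {a..b}" "u \<in> {a..b}"
          using T_in[of j k] T_in[of "Suc j" k] j that by auto
        show "\<bar>T k (Suc j) - u\<bar> \<le> (b - a) / 2 ^ R k"
          using that t_Suc[of "R k" j] by (auto simp: T_def)
      qed
      then show "norm ((c k j - f u) * complex_of_real (?I j)) \<le> (1/2) ^ k * ?I j"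
        by (auto simp: indicator_def)
    qed
    finally show ?thesis by (simp add: one sum_distrib_left[symmetric])
  qed

  have lim: "(\<lambda>k. \<integral>\<^sup>+u. ennreal (norm (step_fun (n k) (T k) (c k) u - f u) powr \<alpha>) \<partial>lborel) \<longlonglongrightarrow> 0"
  proof (rule tendsto_sandwich[OF _ _ tendsto_const])
    have "(\<integral>\<^sup>+u. ennreal (norm (step_fun (n k) (T k) (c k) u - f u) powr \<alpha>) \<partial>lborel) \<le> ennreal (((1/2) ^ k) powr \<alpha> * (b - a))" for k
    proof -
      have "(\<integral>\<^sup>+u. ennreal (norm (step_fun (n k) (T k) (c k) u - f u) powr \<alpha>) \<partial>lborel)
        \<le> (\<integral>\<^sup>+u. ennreal (((1/2) ^ k) powr \<alpha>) * indicator {a<..b} u \<partial>lborel)"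
      proof (intro nn_integral_mono)
        fix u
        have "norm (step_fun (n k) (T k) (c k) u - f u) powr \<alpha> \<le> ((1/2) ^ k * indicator {a<..b} u) powr \<alpha>"
          using approx[of k u] \<alpha> by (intro powr_mono2) auto
        then show "ennreal (norm (step_fun (n k) (T k) (c k) u - f u) powr \<alpha>) \<le> ennreal (((1/2) ^ k) powr \<alpha>) * indicator {a<..b} u"
          by (auto simp: indicator_def ennreal_leI split: if_splits)
      qed
      also have "\<dots> = ennreal (((1/2) ^ k) powr \<alpha> * (b - a))"
        using \<open>a < b\<close> by (subst nn_integral_cmult_indicator) (auto simp: ennreal_mult')
      finally show ?thesis .
    qed
    then show "\<forall>\<^sub>F k in sequentially. (\<integral>\<^sup>+u. ennreal (norm (step_fun (n k) (T k) (c k) u - f u) powr \<alpha>) \<partial>lborel)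
      \<le> ennreal (((1/2) ^ k) powr \<alpha> * (b - a))" by simp
    have "(\<lambda>k. ((1/2::real) ^ k) powr \<alpha> * (b - a)) \<longlonglongrightarrow> 0 powr \<alpha> * (b - a)"
      using \<alpha> by (intro tendsto_intros tendsto_powr' LIMSEQ_realpow_zero) auto
    then show "(\<lambda>k. ennreal (((1/2) ^ k) powr \<alpha> * (b - a))) \<longlonglongrightarrow> 0"
      by (intro tendsto_ennrealI[where x=0, simplified]) simp
  qed simp

  \<comment> \<open>Each coarse cell is a union of \<open>2 ^ R0 (Suc k)\<close> fine cells over
    which the increments telescope. On the fine grid the coarse coefficient is the one with index i
    div that number.\<close>
  have diff: "S (Suc k) \<omega> - S k \<omega> = step_integral (n (Suc k)) (T (Suc k))
     (\<lambda>i. c (Suc k) i - c k (i div 2 ^ R0 (Suc k))) X \<omega>" for k \<omega>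
  proof -
    define q :: nat where "q = 2 ^ R0 (Suc k)"
    have q: "0 < q" "n (Suc k) = n k * q" "\<And>j. T k j = T (Suc k) (j * q)"
      by (auto simp: q_def n_def R_def power_add T_def t_refine[of "\<Sum>i\<le>k. R0 i" _ "R0 (Suc k)"])
    define x where "x i = complex_of_real (X (T (Suc k) i) \<omega>)" for i
    have "S k \<omega> = (\<Sum>j<n k. \<Sum>i\<in>{j * q..<j * q + q}. c k (i div q) * (x (Suc i) - x i))"
      unfolding S_def step_integral_def
    proof (intro sum.cong refl)
      fix j
      have "(\<Sum>i\<in>{j * q..<j * q + q}. c k (i div q) * (x (Suc i) - x i)) = (\<Sum>i\<in>{j * q..<j * q + q}. c k j * (x (Suc i) - x i))"
      proof (intro sum.cong refl)
        fix i assume "i \<in> {j * q..<j * q + q}"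
        then have "i div q = j" by (intro div_nat_eqI) (auto simp: mult.commute)
        then show "c k (i div q) * (x (Suc i) - x i) = c k j * (x (Suc i) - x i)" by simp
      qed
      also have "\<dots> = c k j * (x (j * q + q) - x (j * q))"
        by (simp add: sum_distrib_left[symmetric] sum_Suc_diff')
      finally show "c k j * complex_of_real (X (T k (Suc j)) \<omega> - X (T k j) \<omega>) = (\<Sum>i\<in>{j * q..<j * q + q}. c k (i div q) * (x (Suc i) - x i))"
        by (simp add: q(3) x_def add.commute)
    qed
    also have "\<dots> = (\<Sum>i<n (Suc k). c k (i div q) * (x (Suc i) - x i))"
      unfolding q(2) by (rule sum.nat_group)
    finally show ?thesis
      unfolding S_def step_integral_def q_def[symmetric] by (simp add: x_def left_diff_distrib sum_subtractf)
  qed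
  \<comment> \<open>Both tags lie in the same coarse cell, where f varies by at most
    (1/2)^k.\<close>
  have coeff: "norm (c (Suc k) i - c k (i div 2 ^ R0 (Suc k))) \<le> (1/2) ^ k" if "i < n (Suc k)" for k i
  proof -
    define q :: nat where "q = 2 ^ R0 (Suc k)"
    have q: "0 < q" "n (Suc k) = n k * q" "\<And>j. T k j = T (Suc k) (j * q)"
      by (auto simp: q_def n_def R_def power_add T_def t_refine[of "\<Sum>i\<le>k. R0 i" _ "R0 (Suc k)"])
    define j where "j = i div q"
    have j: "j * q \<le> i" "i < Suc j * q"
      using q(1) div_times_less_eq_dividend[of i q] dividend_less_div_times[of q i] by (auto simp: j_def add.commute)
    have "j < n k" using that q by (simp add: j_def less_mult_imp_div_less)
    have "norm (f (T (Suc k) (Suc i)) - f (T k (Suc j))) \<le> (1/2) ^ k"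
    proof (rule R)
      show "T (Suc k) (Suc i) \<in> {a..b}" using that by (intro T_in) simp
      show "T k (Suc j) \<in> {a..b}" using \<open>j < n k\<close> by (intro T_in) simp
      have "T k j \<le> T (Suc k) (Suc i)" unfolding q(3) using j by (simp add: T_def t_le)
      moreover have "T (Suc k) (Suc i) \<le> T k (Suc j)" unfolding q(3) using j by (simp add: T_def t_le)
      ultimately show "\<bar>T (Suc k) (Suc i) - T k (Suc j)\<bar> \<le> (b - a) / 2 ^ R k"
        using t_Suc[of "R k" j] by (simp add: T_def)
    qed
    then show ?thesis by (simp add: c_def j_def q_def)
  qed
  define K where "K = 2 * (b - a) powr (1 / \<alpha>)"
  have "0 \<le> K" by (simp add: K_def)
  have [measurable]: "S k \<in> borel_measurable M" for k unfolding S_def by measurable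
  have E: "(\<integral>\<^sup>+\<omega>. ennreal (norm (S (Suc k) \<omega> - S k \<omega>)) \<partial>M) \<le> ennreal ((1/2) ^ k * K) * unit_moment 1" for k
    unfolding diff K_def
    using nn_integral_step_integral_norm_le[OF T_mono, of "Suc k" "\<lambda>i. c (Suc k) i - c k (i div 2 ^ R0 (Suc k))" "(1/2) ^ k"] coeff[of _ k]
    by (simp add: T_ends)
  have "(\<integral>\<^sup>+\<omega>. (\<Sum>k. ennreal (norm (S (Suc k) \<omega> - S k \<omega>))) \<partial>M) = (\<Sum>k. \<integral>\<^sup>+\<omega>. ennreal (norm (S (Suc k) \<omega> - S k \<omega>)) \<partial>M)"
    by (rule nn_integral_suminf) measurable
  also have "\<dots> \<le> (\<Sum>k. ennreal ((1/2) ^ k * K) * unit_moment 1)"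
    by (intro suminf_le E) auto
  also have "\<dots> = ennreal (\<Sum>k. (1/2) ^ k * K) * unit_moment 1"
    using \<open>0 \<le> K\<close> by (subst ennreal_suminf_multc, subst suminf_ennreal2) (auto intro!: summable_mult2 summable_geometric)
  also have "\<dots> < \<infinity>" using unit_moment_finite[of 1] \<alpha> by (simp add: ennreal_mult_less_top)
  finally have "AE \<omega> in M. (\<Sum>k. ennreal (norm (S (Suc k) \<omega> - S k \<omega>))) \<noteq> \<infinity>"
    by (intro nn_integral_PInf_AE) auto
  then have "AE \<omega> in M. (\<lambda>k. S k \<omega>) \<longlonglongrightarrow> lim (\<lambda>k. S k \<omega>)"
  proof eventually_elim
    case (elim \<omega>)
    then have "summable (\<lambda>k. norm (S (Suc k) \<omega> - S k \<omega>))"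
      by (intro summable_suminf_not_top) auto
    then have "summable (\<lambda>k. S (Suc k) \<omega> - S k \<omega>)" by (rule summable_norm_cancel)
    then have "convergent (\<lambda>k. \<Sum>i<k. S (Suc i) \<omega> - S i \<omega>)" by (simp add: summable_iff_convergent)
    moreover have "(\<Sum>i<k. S (Suc i) \<omega> - S i \<omega>) = S k \<omega> - S 0 \<omega>" for k
      by (rule sum_lessThan_telescope)
    ultimately have "convergent (\<lambda>k. S k \<omega> - S 0 \<omega>)" by simp
    then have "convergent (\<lambda>k. (S k \<omega> - S 0 \<omega>) + S 0 \<omega>)" by (rule convergent_add) (rule convergent_const)
    then show ?case by (simp add: convergent_LIMSEQ_iff)
  qed
  then have "tendsto_in_prob M S (\<lambda>\<omega>. lim (\<lambda>k. S k \<omega>)) sequentially"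
    by (intro tendsto_in_prob_AE borel_measurable_lim_metric) auto
  then have "has_stable_integral \<alpha> M X f (\<lambda>\<omega>. lim (\<lambda>k. S k \<omega>))"
    unfolding has_stable_integral_def using T_mono lim
    by (intro conjI exI[of _ n] exI[of _ T] exI[of _ c] borel_measurable_lim_metric) (auto simp: S_def[abs_def])
  then show ?thesis by blast
qed

end

text \<open>The support condition leaves the endpoints open; continuity settles them, because the
  zero set is closed and contains both outer open half-lines. Vanishing at 0 and 1 removes the
  boundary terms later on.\<close>

lemma window_eq_0:
  fixes w :: "real \<Rightarrow> complex"
  assumes cont: "continuous_on UNIV w" and supp: "closure {t. w t \<noteq> 0} \<subseteq> {0..1}"
    and "v \<notin> {0<..<1}"
  shows "w v = 0"
proof -
  have out: "w u = 0" if "u \<notin> {0..1}" for u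
    using closure_subset[of "{t. w t \<noteq> 0}"] supp that by blast
  have closed: "closed (w -` {0})" using cont by (intro closed_vimage) (auto simp: continuous_on_eq_continuous_at)
  have "closure {..<0} \<subseteq> w -` {0}" "closure {1<..} \<subseteq> w -` {0}"
    using out by (intro closure_minimal closed; force)+
  then show ?thesis using \<open>v \<notin> {0<..<1}\<close> by (cases "v \<le> 0") (auto simp: closure_lessThan closure_greaterThan subset_iff)
qed

section \<open>The limit for stable processes\<close>

lemma stable_process_if_symmetric_stable_process:
  assumes X: "symmetric_stable_process \<alpha> M X" and "1 < \<alpha>"
  obtains \<sigma> where "stable_process M X \<alpha> \<sigma>"
proof -
  from X have "prob_space M" and [measurable]: "\<And>t. X t \<in> borel_measurable M" and X0: "AE \<omega> in M. X 0 \<omega> = 0"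
    and indep: "independent_increments M X" and stat: "stationary_increments M X" and self: "self_similar (1 / \<alpha>) M X"
    unfolding symmetric_stable_process_def levy_process_def by auto
  interpret prob_space M by fact
  from X obtain \<sigma> where \<sigma>: "0 < \<sigma>" "\<And>\<theta>. char (distr M borel (X 1)) \<theta> = complex_of_real (exp (- ((\<sigma> * \<bar>\<theta>\<bar>) powr \<alpha>)))"
    unfolding symmetric_stable_process_def symmetric_stable_law_def by auto
  have [measurable]: "(\<lambda>\<omega> t. Y t \<omega>) \<in> M \<rightarrow>\<^sub>M (\<Pi>\<^sub>M t\<in>UNIV. borel)"
    if "\<And>t. Y t \<in> borel_measurable M" for Y :: "real \<Rightarrow> 'a \<Rightarrow> real"
    using that by (intro measurable_PiM_single') auto
  have "char (distr M borel (\<lambda>\<omega>. X b \<omega> - X a \<omega>)) t = complex_of_real (exp (- ((\<sigma> * \<bar>t\<bar>) powr \<alpha> * (b - a))))"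
    if "a \<le> b" for a b t
  proof (cases "a = b")
    case True
    then have "(\<lambda>\<omega>. X b \<omega> - X a \<omega>) = (\<lambda>_. 0)" by simp
    then show ?thesis using True by (simp only: char_distr[OF borel_measurable_const]) (simp add: prob_space)
  next
    case False
    define h where "h = b - a"
    have "0 < h" using that False by (simp add: h_def)
    \<comment> \<open>Stationarity and X 0 = 0 almost surely reduce the increment to X h.
      Self-similarity, an equality of process laws, is then read off at time 1.\<close>
    have "distr M borel (\<lambda>\<omega>. X (h + a) \<omega> - X (0 + a) \<omega>) = distr M borel (\<lambda>\<omega>. X h \<omega> - X 0 \<omega>)"
      using stat unfolding stationary_increments_def by blast
    also have "\<dots> = distr M borel (X h)"
      using X0 by (intro distr_cong_AE) auto
    also have "\<dots> = distr (process_law M (\<lambda>t. X (h * t))) borel (\<lambda>x. x 1)"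
      unfolding process_law_def by (subst distr_distr) (auto simp: comp_def)
    also have "process_law M (\<lambda>t. X (h * t)) = process_law M (\<lambda>t \<omega>. h powr (1 / \<alpha>) * X t \<omega>)"
      using self \<open>0 < h\<close> unfolding self_similar_def by blast
    also have "distr \<dots> borel (\<lambda>x. x 1) = distr M borel (\<lambda>\<omega>. h powr (1 / \<alpha>) * X 1 \<omega>)"
      unfolding process_law_def by (subst distr_distr) (auto simp: comp_def)
    finally have "char (distr M borel (\<lambda>\<omega>. X b \<omega> - X a \<omega>)) t = char (distr M borel (X 1)) (t * h powr (1 / \<alpha>))"
      by (simp add: h_def char_distr mult.assoc)
    moreover have "(\<sigma> * \<bar>t * h powr (1 / \<alpha>)\<bar>) powr \<alpha> = (\<sigma> * \<bar>t\<bar>) powr \<alpha> * h"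
      using \<sigma>(1) \<open>0 < h\<close> \<open>1 < \<alpha>\<close> by (simp add: abs_mult powr_mult powr_powr)
    ultimately show ?thesis by (simp add: \<sigma>(2) h_def)
  qed
  then have "stable_process M X \<alpha> \<sigma>"
    using indep \<sigma>(1) \<open>1 < \<alpha>\<close> by unfold_locales auto
  then show thesis by (rule that)
qed

text \<open>The substitution v = (t - u) / s turns the filter into w(v) exp (i a v) with a = s \<xi>
  and contributes the factor s^(p/\<alpha>). What remains depends on a alone and is continuous at L,
  as the modulus |w| of the integrand does not depend on a.\<close>

lemma (in stable_process) filter_moment_tendsto:
  fixes w :: "real \<Rightarrow> complex" and s \<xi> :: "nat \<Rightarrow> real"
  assumes cont: "continuous_on UNIV w" and zero: "\<And>v. v \<notin> {0<..<1} \<Longrightarrow> w v = 0"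
    and p: "1 \<le> p" "p < \<alpha>" and s: "\<And>k. 0 < s k" and lim: "(\<lambda>k. s k * \<xi> k) \<longlonglongrightarrow> L"
  shows "(\<lambda>k. filter_moment M (stable_integral \<alpha> M X) w (s k) (\<xi> k) p / s k powr (p / \<alpha>))
    \<longlonglongrightarrow> (\<integral>\<omega>. norm (stable_integral \<alpha> M X (\<lambda>u. w u * iexp (L * u)) \<omega>) powr p \<partial>M)"
proof -
  define \<phi> where "\<phi> a v = w v * iexp (a * v)" for a v :: real
  define N where "N = (\<integral>\<^sup>+v. ennreal (norm (w v) powr \<alpha>) \<partial>lborel)"
  \<comment> \<open>The moment of the integral of \<phi> a, still multiplied by
    \<open>cos_moment p\<close>.\<close>
  define G where "G a = unit_moment p * (\<integral>\<^sup>+\<theta>\<in>{0..2 * pi}. ennreal (proj_integral (\<phi> a) \<theta> powr (p / \<alpha>)) \<partial>lborel)" for a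
  have \<kappa>: "cos_moment p \<noteq> 0" "cos_moment p < \<infinity>" using cos_moment_bounds[of p] p by auto
  have [measurable]: "w \<in> borel_measurable borel" using cont by (rule borel_measurable_continuous_onI)
  have [measurable]: "cis \<in> borel_measurable borel"
    by (intro borel_measurable_continuous_onI continuous_intros)
  have [measurable]: "\<phi> a \<in> borel_measurable borel" for a unfolding \<phi>_def by measurable
  interpret pair_sigma_finite lborel lborel ..
  have [measurable]: "proj_integral (\<phi> a) \<in> borel_measurable borel" for a
    unfolding proj_integral_def by measurable
  have norm_\<phi>: "norm (\<phi> a v) = norm (w v)" for a v by (simp add: \<phi>_def norm_mult)
  have N: "N < \<infinity>"
  proof -
    have "compact (w ` {0..1})" using cont by (intro compact_continuous_image) (auto intro: continuous_on_subset)
    then have "bounded (w ` {0..1})" by (rule compact_imp_bounded)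
    then obtain B where B: "\<And>v. v \<in> {0..1} \<Longrightarrow> norm (w v) \<le> B"
      unfolding bounded_iff by (metis imageI)
    have "N \<le> (\<integral>\<^sup>+v. ennreal (B powr \<alpha>) * indicator {0..1::real} v \<partial>lborel)"
      unfolding N_def
    proof (intro nn_integral_mono)
      fix v :: real
      show "ennreal (norm (w v) powr \<alpha>) \<le> ennreal (B powr \<alpha>) * indicator {0..1} v"
        using B[of v] zero[of v] \<alpha> by (cases "v \<in> {0..1}") (auto intro!: ennreal_leI powr_mono2)
    qed
    also have "\<dots> < \<infinity>" by (simp add: nn_integral_cmult_indicator ennreal_mult_less_top)
    finally show ?thesis .
  qed
  have proj_le: "(\<integral>\<^sup>+v. ennreal (\<bar>Re (cis \<theta> * \<phi> a v)\<bar> powr \<alpha>) \<partial>lborel) \<le> N" for a \<theta>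
    using nn_integral_proj_le[of \<theta> "\<phi> a"] by (simp add: norm_\<phi> N_def)
  \<comment> \<open>One affine family covers both sides of the limit: r = - s k with arbitrary t for
    the filters, r = 1 and t = 0 for the limiting integrand.\<close>
  have moment: "cos_moment p * (\<integral>\<^sup>+\<omega>. ennreal (norm (stable_integral \<alpha> M X f \<omega>) powr p) \<partial>M) =
      ennreal (\<bar>r\<bar> powr (p / \<alpha>)) * G a \<and> stable_integral \<alpha> M X f \<in> borel_measurable M"
    if f: "\<And>u. f u = \<phi> a ((u - t) / r)" and "r \<noteq> 0" for f a t r
  proof -
    have f': "f = (\<lambda>u. \<phi> a ((u - t) / r))" using f by auto
    have "\<exists>Y. has_stable_integral \<alpha> M X f Y"
    proof (rule ex_stable_integral)
      show "continuous_on UNIV f" unfolding f' \<phi>_def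
        using \<open>r \<noteq> 0\<close> by (intro continuous_intros continuous_on_compose2[OF cont]) auto
      \<comment> \<open>This symmetric interval contains the support for either sign of r.\<close>
      show "t - \<bar>r\<bar> < t + \<bar>r\<bar>" using \<open>r \<noteq> 0\<close> by simp
      show "f u = 0" if "u \<notin> {t - \<bar>r\<bar><..t + \<bar>r\<bar>}" for u
      proof -
        have "\<bar>r\<bar> \<le> \<bar>u - t\<bar>" using that by auto
        then have "1 \<le> \<bar>(u - t) / r\<bar>" using \<open>r \<noteq> 0\<close> by (simp add: abs_divide)
        then have "(u - t) / r \<notin> {0<..<1}" unfolding greaterThanLessThan_iff by linarith
        then show ?thesis using zero[of "(u - t) / r"] unfolding f' \<phi>_def by auto
      qed
    qed
    then have Y: "has_stable_integral \<alpha> M X f (stable_integral \<alpha> M X f)"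
      unfolding stable_integral_def by (rule someI_ex)
    have scale: "(\<integral>\<^sup>+u. F ((u - t) / r) \<partial>lborel) = ennreal \<bar>r\<bar> * (\<integral>\<^sup>+v. F v \<partial>lborel)"
      if [measurable]: "F \<in> borel_measurable borel" for F :: "real \<Rightarrow> ennreal"
      using \<open>r \<noteq> 0\<close> by (subst nn_integral_real_affine[where c=r and t=t]) auto
    have "(\<integral>\<^sup>+u. ennreal (norm (f u) powr \<alpha>) \<partial>lborel) = ennreal \<bar>r\<bar> * N"
      unfolding f' norm_\<phi> N_def by (rule scale) measurable
    then have fin: "(\<integral>\<^sup>+u. ennreal (norm (f u) powr \<alpha>) \<partial>lborel) < \<infinity>"
      using N by (simp add: ennreal_mult_less_top)
    have "proj_integral f \<theta> = \<bar>r\<bar> * proj_integral (\<phi> a) \<theta>" for \<theta>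
      unfolding proj_integral_def f' using \<open>r \<noteq> 0\<close>
      by (subst scale[of "\<lambda>v. ennreal (\<bar>Re (cis \<theta> * \<phi> a v)\<bar> powr \<alpha>)"]) (simp_all add: enn2real_mult)
    then have "proj_integral f \<theta> powr (p / \<alpha>) = \<bar>r\<bar> powr (p / \<alpha>) * proj_integral (\<phi> a) \<theta> powr (p / \<alpha>)" for \<theta>
      by (simp add: powr_mult proj_integral_def)
    moreover have [measurable]: "f \<in> borel_measurable borel" unfolding f' by measurable
    ultimately have "cos_moment p * (\<integral>\<^sup>+\<omega>. ennreal (norm (stable_integral \<alpha> M X f \<omega>) powr p) \<partial>M) =
      unit_moment p * (\<integral>\<^sup>+\<theta>. ennreal (\<bar>r\<bar> powr (p / \<alpha>)) * (ennreal (proj_integral (\<phi> a) \<theta> powr (p / \<alpha>)) * indicator {0..2 * pi} \<theta>) \<partial>lborel)"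
      by (subst nn_integral_stable_integral_powr[OF Y _ fin]) (simp_all add: ennreal_mult' mult.assoc)
    also have "\<dots> = ennreal (\<bar>r\<bar> powr (p / \<alpha>)) * G a"
      unfolding G_def by (subst nn_integral_cmult) (auto simp: mult.left_commute)
    finally show ?thesis using Y by (simp add: has_stable_integral_def)
  qed
  \<comment> \<open>The majorant |w|^\<alpha> is independent of the frequency.\<close>
  have proj_lim: "(\<lambda>k. proj_integral (\<phi> (s k * \<xi> k)) \<theta>) \<longlonglongrightarrow> proj_integral (\<phi> L) \<theta>" for \<theta>
    unfolding proj_integral_def
  proof (rule tendsto_enn2real_finite)
    show "(\<lambda>k. \<integral>\<^sup>+v. ennreal (\<bar>Re (cis \<theta> * \<phi> (s k * \<xi> k) v)\<bar> powr \<alpha>) \<partial>lborel) \<longlonglongrightarrow>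
       (\<integral>\<^sup>+v. ennreal (\<bar>Re (cis \<theta> * \<phi> L v)\<bar> powr \<alpha>) \<partial>lborel)"
    proof (rule nn_integral_dominated_convergence[where w="\<lambda>v. ennreal (norm (w v) powr \<alpha>)"])
      show "AE v in lborel. ennreal (\<bar>Re (cis \<theta> * \<phi> (s k * \<xi> k) v)\<bar> powr \<alpha>) \<le> ennreal (norm (w v) powr \<alpha>)" for k
      proof (intro AE_I2 ennreal_leI powr_mono2)
        fix v show "\<bar>Re (cis \<theta> * \<phi> (s k * \<xi> k) v)\<bar> \<le> norm (w v)"
          using abs_Re_le_cmod[of "cis \<theta> * \<phi> (s k * \<xi> k) v"] unfolding norm_mult norm_\<phi> norm_cis mult_1 .
      qed (use \<alpha> in auto)
      show "AE v in lborel. (\<lambda>k. ennreal (\<bar>Re (cis \<theta> * \<phi> (s k * \<xi> k) v)\<bar> powr \<alpha>)) \<longlonglongrightarrow> ennreal (\<bar>Re (cis \<theta> * \<phi> L v)\<bar> powr \<alpha>)"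
        unfolding \<phi>_def using \<alpha> by (intro AE_I2 tendsto_ennrealI tendsto_powr' tendsto_intros lim) auto
    qed (use N in \<open>auto simp: N_def\<close>)
    show "(\<integral>\<^sup>+v. ennreal (\<bar>Re (cis \<theta> * \<phi> L v)\<bar> powr \<alpha>) \<partial>lborel) < \<infinity>"
      using proj_le N by (rule le_less_trans)
  qed
  have bound: "proj_integral (\<phi> a) \<theta> powr (p / \<alpha>) \<le> enn2real N powr (p / \<alpha>)" for a \<theta>
    unfolding proj_integral_def using proj_le[of \<theta> a] N p \<alpha> by (intro powr_mono2 enn2real_mono) auto
  have I_fin: "(\<integral>\<^sup>+\<theta>\<in>{0..2 * pi}. ennreal (proj_integral (\<phi> a) \<theta> powr (p / \<alpha>)) \<partial>lborel) < \<infinity>" for a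
  proof -
    have "(\<integral>\<^sup>+\<theta>\<in>{0..2 * pi}. ennreal (proj_integral (\<phi> a) \<theta> powr (p / \<alpha>)) \<partial>lborel)
      \<le> (\<integral>\<^sup>+\<theta>\<in>{0..2 * pi}. ennreal (enn2real N powr (p / \<alpha>)) \<partial>lborel)"
      using bound by (intro nn_integral_mono mult_right_mono ennreal_leI) auto
    also have "\<dots> < \<infinity>" by (simp add: nn_integral_cmult_indicator ennreal_mult_less_top)
    finally show ?thesis .
  qed
  then have G_fin: "G a < \<infinity>" for a
    unfolding G_def using unit_moment_finite[of p] p by (simp add: ennreal_mult_less_top)
  \<comment> \<open>A second dominated convergence, now over the angle, with the constant bound
    given by the \<alpha>-th power integral of |w|.\<close>
  have G_lim: "(\<lambda>k. G (s k * \<xi> k)) \<longlonglongrightarrow> G L"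
  proof -
    have "(\<lambda>k. \<integral>\<^sup>+\<theta>\<in>{0..2 * pi}. ennreal (proj_integral (\<phi> (s k * \<xi> k)) \<theta> powr (p / \<alpha>)) \<partial>lborel) \<longlonglongrightarrow>
      (\<integral>\<^sup>+\<theta>\<in>{0..2 * pi}. ennreal (proj_integral (\<phi> L) \<theta> powr (p / \<alpha>)) \<partial>lborel)"
    proof (rule nn_integral_dominated_convergence[where w="\<lambda>\<theta>. ennreal (enn2real N powr (p / \<alpha>)) * indicator {0..2 * pi} \<theta>"])
      show "AE \<theta> in lborel. (\<lambda>k. ennreal (proj_integral (\<phi> (s k * \<xi> k)) \<theta> powr (p / \<alpha>)) * indicator {0..2 * pi} \<theta>) \<longlonglongrightarrow>
        ennreal (proj_integral (\<phi> L) \<theta> powr (p / \<alpha>)) * indicator {0..2 * pi} \<theta>"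
      proof (rule AE_I2)
        fix \<theta>
        have "(\<lambda>k. ennreal (proj_integral (\<phi> (s k * \<xi> k)) \<theta> powr (p / \<alpha>))) \<longlonglongrightarrow> ennreal (proj_integral (\<phi> L) \<theta> powr (p / \<alpha>))"
          using p \<alpha> by (intro tendsto_ennrealI tendsto_powr' tendsto_const proj_lim) (auto simp: proj_integral_def)
        then show "(\<lambda>k. ennreal (proj_integral (\<phi> (s k * \<xi> k)) \<theta> powr (p / \<alpha>)) * indicator {0..2 * pi} \<theta>) \<longlonglongrightarrow>
          ennreal (proj_integral (\<phi> L) \<theta> powr (p / \<alpha>)) * indicator {0..2 * pi} \<theta>"
          by (cases "\<theta> \<in> {0..2 * pi}") auto
      qed
    qed (use bound in \<open>auto intro!: AE_I2 mult_right_mono ennreal_leI simp: nn_integral_cmult_indicator ennreal_mult_less_top\<close>)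
    then show ?thesis unfolding G_def
      using unit_moment_finite[of p] p I_fin[of L] by (intro tendsto_mult_ennreal tendsto_const) auto
  qed
  have eval: "(\<integral>\<omega>. norm (stable_integral \<alpha> M X f \<omega>) powr p \<partial>M) =
      \<bar>r\<bar> powr (p / \<alpha>) * (enn2real (G a) / enn2real (cos_moment p))"
    if "\<And>u. f u = \<phi> a ((u - t) / r)" "r \<noteq> 0" for f a t r
  proof -
    note m = moment[OF that]
    have [measurable]: "stable_integral \<alpha> M X f \<in> borel_measurable M" using m by simp
    have "enn2real (cos_moment p) * enn2real (\<integral>\<^sup>+\<omega>. ennreal (norm (stable_integral \<alpha> M X f \<omega>) powr p) \<partial>M) =
      \<bar>r\<bar> powr (p / \<alpha>) * enn2real (G a)"
      using arg_cong[OF conjunct1[OF m], of enn2real] by (simp add: enn2real_mult)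
    moreover have "enn2real (cos_moment p) \<noteq> 0" using \<kappa> by (simp add: enn2real_eq_0_iff)
    ultimately show ?thesis by (subst integral_eq_nn_integral) (auto simp: field_simps)
  qed
  have "filter_moment M (stable_integral \<alpha> M X) w (s k) (\<xi> k) p / s k powr (p / \<alpha>) =
      enn2real (G (s k * \<xi> k)) / enn2real (cos_moment p)" for k
  proof -
    have "filter_moment_at M (stable_integral \<alpha> M X) (gabor_filter w (s k) (\<xi> k)) p t =
      s k powr (p / \<alpha>) * (enn2real (G (s k * \<xi> k)) / enn2real (cos_moment p))" for t
    proof -
      \<comment> \<open>The convolution reflects the window, hence the negative factor; the moment
        depends only on its absolute value.\<close>
      have "gabor_filter w (s k) (\<xi> k) (t - u) = \<phi> (s k * \<xi> k) ((u - t) / - s k)" for u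
      proof -
        have "(u - t) / - s k = (t - u) / s k" by (simp add: minus_divide_right[symmetric] diff_divide_distrib)
        moreover have "s k * \<xi> k * ((t - u) / s k) = \<xi> k * (t - u)" using s[of k] by simp
        ultimately show ?thesis unfolding gabor_filter_def \<phi>_def by (simp only:)
      qed
      then show ?thesis
        using eval[of "\<lambda>u. gabor_filter w (s k) (\<xi> k) (t - u)" "s k * \<xi> k" t "- s k"] s[of k]
        unfolding filter_moment_at_def by simp
    qed
    \<comment> \<open>The value found is the same for all t, so the definite description denotes
      it.\<close>
    then show ?thesis unfolding filter_moment_def using s[of k] by simp
  qed
  moreover have "(\<integral>\<omega>. norm (stable_integral \<alpha> M X (\<lambda>u. w u * iexp (L * u)) \<omega>) powr p \<partial>M) =
      enn2real (G L) / enn2real (cos_moment p)"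
    using eval[of "\<lambda>u. w u * iexp (L * u)" L 0 1] by (simp add: \<phi>_def)
  moreover have "(\<lambda>k. enn2real (G (s k * \<xi> k)) / enn2real (cos_moment p)) \<longlonglongrightarrow> enn2real (G L) / enn2real (cos_moment p)"
    using \<kappa> G_fin[of L] by (intro tendsto_divide tendsto_const tendsto_enn2real_finite G_lim) (auto simp: enn2real_eq_0_iff)
  ultimately show ?thesis by simp
qed

section \<open>Riemann-Stieltjes integrals\<close>

text \<open>Exposes the bound V, since moments are later estimated by a power of it.\<close>

definition variation_le :: "(real \<Rightarrow> complex) \<Rightarrow> real \<Rightarrow> real \<Rightarrow> real \<Rightarrow> bool" where
  "variation_le f a b V \<longleftrightarrow> (\<forall>n. \<forall>t::nat \<Rightarrow> real.
     (\<forall>j\<le>n. t j \<in> {a..b}) \<and> (\<forall>j<n. t j \<le> t (Suc j)) \<longrightarrow> (\<Sum>j<n. norm (f (t (Suc j)) - f (t j))) \<le> V)"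

lemma has_bounded_variation_on_iff: "has_bounded_variation_on f a b \<longleftrightarrow> (\<exists>V. variation_le f a b V)"
  unfolding has_bounded_variation_on_def variation_le_def ..

lemma variation_leD:
  assumes "variation_le f a b V" "\<And>j. j \<le> n \<Longrightarrow> t j \<in> {a..b}" "\<And>j. j < n \<Longrightarrow> t j \<le> t (Suc j)"
  shows "(\<Sum>j<n. norm (f (t (Suc j)) - f (t j))) \<le> V"
  using assms unfolding variation_le_def by blast

lemma variation_le_nonneg: "variation_le f a b V \<Longrightarrow> a \<le> b \<Longrightarrow> 0 \<le> V"
  using variation_leD[of f a b V 0 "\<lambda>_. a"] by simp

text \<open>Product rule for increments. Keeping the supremum H and the Lipschitz constant K of h
  apart from the data of f shows that the product has small variation as soon as H and K are
  small.\<close>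

lemma variation_le_mult_lipschitz:
  assumes f: "variation_le f a b V" and W: "\<And>u. u \<in> {a..b} \<Longrightarrow> norm (f u) \<le> W"
    and h: "\<And>u. u \<in> {a..b} \<Longrightarrow> norm (h u) \<le> H" 
    and "0 \<le> K"
    and K: "\<And>u v. u \<in> {a..b} \<Longrightarrow> v \<in> {a..b} \<Longrightarrow> u \<le> v \<Longrightarrow> norm (h v - h u) \<le> K * (v - u)"
    and "a \<le> b"
  shows "variation_le (\<lambda>u. f u * h u) a b (H * V + W * (K * (b - a)))"
  unfolding variation_le_def
proof (intro allI impI, elim conjE)
  fix n and t :: "nat \<Rightarrow> real"
  assume t: "\<forall>j\<le>n. t j \<in> {a..b}" "\<forall>j<n. t j \<le> t (Suc j)"
  have "0 \<le> H" using order.trans[OF norm_ge_zero h[of a]] \<open>a \<le> b\<close> by simp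
  have "0 \<le> W" using order.trans[OF norm_ge_zero W[of a]] \<open>a \<le> b\<close> by simp
  have "(\<Sum>j<n. norm (f (t (Suc j)) * h (t (Suc j)) - f (t j) * h (t j))) \<le>
    (\<Sum>j<n. H * norm (f (t (Suc j)) - f (t j)) + W * (K * (t (Suc j) - t j)))"
  proof (intro sum_mono)
    fix j assume "j \<in> {..<n}"
    then have j: "t j \<in> {a..b}" "t (Suc j) \<in> {a..b}" "t j \<le> t (Suc j)" using t by auto
    have "f (t (Suc j)) * h (t (Suc j)) - f (t j) * h (t j) =
      h (t (Suc j)) * (f (t (Suc j)) - f (t j)) + f (t j) * (h (t (Suc j)) - h (t j))"
      by (simp add: algebra_simps)
    also have "norm \<dots> \<le> norm (h (t (Suc j))) * norm (f (t (Suc j)) - f (t j)) + norm (f (t j)) * norm (h (t (Suc j)) - h (t j))"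
      by (metis norm_mult norm_triangle_ineq)
    also have "\<dots> \<le> H * norm (f (t (Suc j)) - f (t j)) + W * (K * (t (Suc j) - t j))"
      using j h W K \<open>0 \<le> H\<close> \<open>0 \<le> W\<close> by (intro add_mono mult_mono) auto
    finally show "norm (f (t (Suc j)) * h (t (Suc j)) - f (t j) * h (t j)) \<le>
      H * norm (f (t (Suc j)) - f (t j)) + W * (K * (t (Suc j) - t j))" .
  qed
  also have "\<dots> = H * (\<Sum>j<n. norm (f (t (Suc j)) - f (t j))) + W * (K * (t n - t 0))"
    by (simp add: sum.distrib sum_distrib_left[symmetric] sum_lessThan_telescope)
  also have "\<dots> \<le> H * V + W * (K * (b - a))"
    using variation_leD[OF f, of n t] t \<open>0 \<le> H\<close> \<open>0 \<le> W\<close> \<open>0 \<le> K\<close>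
    by (intro add_mono mult_left_mono) (auto intro!: diff_mono)
  finally show "(\<Sum>j<n. norm (f (t (Suc j)) * h (t (Suc j)) - f (t j) * h (t j))) \<le> H * V + W * (K * (b - a))" .
qed

lemma variation_le_reflect_scale:
  assumes f: "variation_le f 0 1 V" and "0 < s"
  shows "variation_le (\<lambda>u. f ((t - u) / s)) (t - s) t V"
  unfolding variation_le_def
proof (intro allI impI, elim conjE)
  fix n and v :: "nat \<Rightarrow> real"
  assume v: "\<forall>j\<le>n. v j \<in> {t - s..t}" "\<forall>j<n. v j \<le> v (Suc j)"
  \<comment> \<open>The map reverses the order, so the partition is read backwards.\<close>
  define x where "x j = (t - v (n - j)) / s" for j
  have "(\<Sum>j<n. norm (f ((t - v (Suc j)) / s) - f ((t - v j) / s))) =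
    (\<Sum>j<n. norm (f ((t - v (Suc (n - Suc j))) / s) - f ((t - v (n - Suc j)) / s)))"
    by (rule sum.nat_diff_reindex[symmetric])
  also have "\<dots> = (\<Sum>j<n. norm (f (x (Suc j)) - f (x j)))"
    by (intro sum.cong) (auto simp: x_def Suc_diff_Suc norm_minus_commute)
  also have "\<dots> \<le> V"
  proof (rule variation_leD[OF f])
    show "x j \<in> {0..1}" if "j \<le> n" for j
      using v(1)[rule_format, of "n - j"] \<open>0 < s\<close> by (auto simp: x_def field_simps)
    show "x j \<le> x (Suc j)" if "j < n" for j
      using v(2)[rule_format, of "n - Suc j"] \<open>0 < s\<close> that by (auto simp: x_def Suc_diff_Suc divide_right_mono)
  qed
  finally show "(\<Sum>j<n. norm (f ((t - v (Suc j)) / s) - f ((t - v j) / s))) \<le> V" .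
qed

lemma sum_by_parts:
  fixes f x :: "nat \<Rightarrow> complex"
  shows "(\<Sum>j<n. f j * (x (Suc j) - x j)) = f n * x n - f 0 * x 0 - (\<Sum>j<n. x (Suc j) * (f (Suc j) - f j))"
  by (induction n) (auto simp: algebra_simps)

text \<open>Summation by parts moves the increments from the integrator to the integrand; the tags,
  completed by the right endpoint, form a partition.\<close>

lemma norm_rs_sum_le:
  fixes x :: "real \<Rightarrow> real"
  assumes V: "variation_le f a b V" and F: "\<And>u. u \<in> {a..b} \<Longrightarrow> norm (f u) \<le> F"
    and t: "t 0 = a" "t n = b" "\<forall>j<n. t j \<le> t (Suc j) \<and> \<tau> j \<in> {t j..t (Suc j)}"
    and x: "\<And>j. j \<le> n \<Longrightarrow> \<bar>x (y j)\<bar> \<le> e"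
  shows "norm (\<Sum>j<n. f (\<tau> j) * complex_of_real (x (y (Suc j)) - x (y j))) \<le> (2 * F + V) * e"
proof -
  have mono: "t i \<le> t j" if "i \<le> j" "j \<le> n" for i j
    using that t(3) by (induction rule: dec_induct) (auto intro: order.trans)
  then have "a \<le> b" using t by auto
  define \<tau>' where "\<tau>' j = (if j < n then \<tau> j else b)" for j
  have \<tau>': "\<tau>' j \<in> {a..b}" if "j \<le> n" for j
    using that t mono[of 0 j] mono[of "Suc j" n] \<open>a \<le> b\<close> by (force simp: \<tau>'_def)
  have \<tau>'_mono: "\<tau>' j \<le> \<tau>' (Suc j)" if "j < n" for j
  proof (cases "Suc j < n")
    case True
    then show ?thesis using t(3)[rule_format, of j] t(3)[rule_format, of "Suc j"] that by (auto simp: \<tau>'_def)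
  next
    case False
    then show ?thesis using \<tau>'[of j] that by (auto simp: \<tau>'_def)
  qed
  have e: "0 \<le> e" using x[of 0] by auto
  have F0: "0 \<le> F" using order.trans[OF norm_ge_zero F[of a]] \<open>a \<le> b\<close> by simp
  have "(\<Sum>j<n. f (\<tau> j) * complex_of_real (x (y (Suc j)) - x (y j))) =
    (\<Sum>j<n. f (\<tau>' j) * (complex_of_real (x (y (Suc j))) - complex_of_real (x (y j))))"
    by (intro sum.cong) (auto simp: \<tau>'_def)
  also have "\<dots> = f (\<tau>' n) * x (y n) - f (\<tau>' 0) * x (y 0) - (\<Sum>j<n. x (y (Suc j)) * (f (\<tau>' (Suc j)) - f (\<tau>' j)))"
    by (rule sum_by_parts)
  also have "norm \<dots> \<le> norm (f (\<tau>' n) * x (y n)) + norm (f (\<tau>' 0) * x (y 0)) + norm (\<Sum>j<n. x (y (Suc j)) * (f (\<tau>' (Suc j)) - f (\<tau>' j)))"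
    by (intro order.trans[OF norm_triangle_ineq4] add_mono order_refl)
  also have "\<dots> \<le> F * e + F * e + (\<Sum>j<n. e * norm (f (\<tau>' (Suc j)) - f (\<tau>' j)))"
    using \<tau>' F x e F0
    by (intro add_mono order.trans[OF norm_sum sum_mono]) (auto simp: norm_mult intro!: mult_mono)
  also have "\<dots> \<le> F * e + F * e + e * V"
    using variation_leD[OF V, of n \<tau>'] \<tau>' \<tau>'_mono e by (simp add: sum_distrib_left[symmetric] mult_left_mono)
  finally show ?thesis by (simp add: algebra_simps)
qed

section \<open>Riemann sums and existence of the pathwise integral\<close>

definition fine_partition :: "real \<Rightarrow> real \<Rightarrow> real \<Rightarrow> nat \<Rightarrow> (nat \<Rightarrow> real) \<Rightarrow> (nat \<Rightarrow> real) \<Rightarrow> bool" where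
  "fine_partition a b \<delta> n t \<tau> \<longleftrightarrow> t 0 = a \<and> t n = b \<and>
     (\<forall>j<n. t j \<le> t (Suc j) \<and> t (Suc j) - t j < \<delta> \<and> \<tau> j \<in> {t j..t (Suc j)})"

lemma has_rs_integral_iff:
  "has_rs_integral a b f x I \<longleftrightarrow> (\<forall>\<epsilon>>0. \<exists>\<delta>>0. \<forall>n t \<tau>. fine_partition a b \<delta> n t \<tau> \<longrightarrow>
     norm ((\<Sum>j<n. f (\<tau> j) * complex_of_real (x (t (Suc j)) - x (t j))) - I) < \<epsilon>)"
  unfolding has_rs_integral_def fine_partition_def ..

lemma has_rs_integralD:
  assumes "has_rs_integral a b f x I" "0 < \<epsilon>"
  shows "\<exists>\<delta>>0. \<forall>n t \<tau>. fine_partition a b \<delta> n t \<tau> \<longrightarrow>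
     norm ((\<Sum>j<n. f (\<tau> j) * complex_of_real (x (t (Suc j)) - x (t j))) - I) < \<epsilon>"
  using assms unfolding has_rs_integral_iff by simp

text \<open>Parameter m stands for m + 1 equal cells, so there is always at least one.\<close>

definition grid :: "real \<Rightarrow> real \<Rightarrow> nat \<Rightarrow> nat \<Rightarrow> real" where
  "grid a b m j = a + (b - a) * (real j / real (Suc m))"

lemma grid_simps: "grid a b m 0 = a" "grid a b m (Suc m) = b"
  by (auto simp: grid_def)

lemma grid_mono: "a \<le> b \<Longrightarrow> i \<le> j \<Longrightarrow> grid a b m i \<le> grid a b m j"
  by (auto simp: grid_def intro!: mult_left_mono divide_right_mono)

lemma grid_step: "grid a b m (Suc j) - grid a b m j = (b - a) / real (Suc m)"
  by (simp add: grid_def add_divide_distrib algebra_simps)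

text \<open>Replaces the limit over all tagged partitions by a sequence that does not depend on the
  path. Measurability, laws and Fatou's lemma are applied along it.\<close>

lemma tendsto_rs_sum_grid:
  assumes I: "has_rs_integral a b f x I" and "a \<le> b"
    and \<tau>: "\<And>m j. \<tau> m j \<in> {grid a b m j..grid a b m (Suc j)}"
  shows "(\<lambda>m. \<Sum>j<Suc m. f (\<tau> m j) * complex_of_real (x (grid a b m (Suc j)) - x (grid a b m j))) \<longlonglongrightarrow> I"
proof (rule tendstoI)
  fix \<epsilon> :: real assume "0 < \<epsilon>"
  obtain \<delta> where "0 < \<delta>" and \<delta>: "\<forall>n t \<tau>. fine_partition a b \<delta> n t \<tau> \<longrightarrow>
        norm ((\<Sum>j<n. f (\<tau> j) * complex_of_real (x (t (Suc j)) - x (t j))) - I) < \<epsilon>"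
    using has_rs_integralD[OF I \<open>0 < \<epsilon>\<close>] by (elim exE conjE)
  have "(\<lambda>m. (b - a) / real (Suc m)) \<longlonglongrightarrow> 0"
    by (rule LIMSEQ_Suc) (rule lim_const_over_n)
  then have "\<forall>\<^sub>F m in sequentially. (b - a) / real (Suc m) < \<delta>"
    using \<open>0 < \<delta>\<close> by (rule order_tendstoD)
  then show "\<forall>\<^sub>F m in sequentially. dist (\<Sum>j<Suc m. f (\<tau> m j) * complex_of_real (x (grid a b m (Suc j)) - x (grid a b m j))) I < \<epsilon>"
  proof eventually_elim
    case (elim m)
    show ?case unfolding dist_norm
      by (rule \<delta>[rule_format, of _ "grid a b m"])
        (use elim \<tau> \<open>a \<le> b\<close> in \<open>auto simp: fine_partition_def grid_simps grid_step grid_mono\<close>)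
  qed
qed

lemma has_rs_integral_unique:
  assumes "has_rs_integral a b f x I" "has_rs_integral a b f x I'" "a \<le> b"
  shows "I = I'"
  by (rule LIMSEQ_unique; rule tendsto_rs_sum_grid[where \<tau>="grid a b"]) (use assms in \<open>auto simp: grid_mono\<close>)

lemma rs_integral_eqI:
  assumes "has_rs_integral a b f x I" "a \<le> b"
  shows "rs_integral a b f x = I"
  unfolding rs_integral_def using assms has_rs_integral_unique by blast

lemma integral_sum_consecutive:
  fixes f :: "real \<Rightarrow> complex"
  assumes "continuous_on UNIV f" "\<forall>j<n. t j \<le> t (Suc j)"
  shows "(\<Sum>j<n. integral {t j..t (Suc j)} f) = integral {t 0..t n} f \<and> t 0 \<le> t n"
  using assms(2)
proof (induction n)
  case (Suc n)
  then have IH: "(\<Sum>j<n. integral {t j..t (Suc j)} f) = integral {t 0..t n} f" "t 0 \<le> t n" "t n \<le> t (Suc n)" by auto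
  have "f integrable_on {t 0..t (Suc n)}"
    using assms(1) by (intro integrable_continuous_real) (auto intro: continuous_on_subset)
  then show ?case using IH Henstock_Kurzweil_Integration.integral_combine[of "t 0" "t n" "t (Suc n)" f] by simp
qed simp

text \<open>On each cell the increment of g is the integral of g', so the error is the integral of
  (f (\<tau> j) - f u) g' u, small by uniform continuity of f.\<close>

lemma has_rs_integral_smooth:
  fixes f :: "real \<Rightarrow> complex" and g g' :: "real \<Rightarrow> real"
  assumes f: "continuous_on UNIV f" and g: "\<And>u. (g has_real_derivative g' u) (at u)" and g': "continuous_on UNIV g'"
  shows "has_rs_integral a b f g (integral {a..b} (\<lambda>u. f u * complex_of_real (g' u)))"
  unfolding has_rs_integral_iff
proof (intro allI impI)
  fix \<epsilon> :: real assume "0 < \<epsilon>"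
  have "bounded (g' ` {a..b})"
    using g' by (intro compact_imp_bounded compact_continuous_image) (auto intro: continuous_on_subset)
  then obtain G where G: "\<And>u. u \<in> {a..b} \<Longrightarrow> \<bar>g' u\<bar> \<le> G" 
    unfolding bounded_iff by (metis imageI real_norm_def)
  \<comment> \<open>Oscillation of f allowed on a cell; the summands 1 keep the denominator positive
    and the final inequality strict.\<close>
  define c where "c = \<epsilon> / ((\<bar>G\<bar> + 1) * (\<bar>b - a\<bar> + 1))"
  have "0 < c" using \<open>0 < \<epsilon>\<close> by (auto simp: c_def)
  have c: "c * \<bar>G\<bar> * (b - a) < \<epsilon>"
  proof -
    have "\<bar>G\<bar> * (b - a) \<le> \<bar>G\<bar> * \<bar>b - a\<bar>" by (intro mult_left_mono) auto
    also have "\<dots> < (\<bar>G\<bar> + 1) * (\<bar>b - a\<bar> + 1)" by (simp add: algebra_simps add_pos_nonneg)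
    finally have "c * (\<bar>G\<bar> * (b - a)) < c * ((\<bar>G\<bar> + 1) * (\<bar>b - a\<bar> + 1))" using \<open>0 < c\<close> by simp
    also have "\<dots> = \<epsilon>" unfolding c_def by simp
    finally show ?thesis by (simp add: mult.assoc)
  qed
  have "uniformly_continuous_on {a..b} f"
    using f by (intro compact_uniformly_continuous) (auto intro: continuous_on_subset)
  then obtain \<delta> where \<delta>: "0 < \<delta>" "\<And>u v. u \<in> {a..b} \<Longrightarrow> v \<in> {a..b} \<Longrightarrow> dist u v < \<delta> \<Longrightarrow> dist (f u) (f v) < c"
    unfolding uniformly_continuous_on_def using \<open>0 < c\<close> by metis
  show "\<exists>\<delta>>0. \<forall>n t \<tau>. fine_partition a b \<delta> n t \<tau> \<longrightarrow>
    norm ((\<Sum>j<n. f (\<tau> j) * complex_of_real (g (t (Suc j)) - g (t j))) - integral {a..b} (\<lambda>u. f u * complex_of_real (g' u))) < \<epsilon>"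
  proof (intro exI[of _ \<delta>] conjI \<delta>(1) allI impI)
    fix n t \<tau>
    assume fine: "fine_partition a b \<delta> n t \<tau>"
    then have t: "t 0 = a" "t n = b" by (auto simp: fine_partition_def)
    have tj: "t j \<le> t (Suc j)" "t (Suc j) - t j < \<delta>" "\<tau> j \<in> {t j..t (Suc j)}" if "j < n" for j
      using that fine by (auto simp: fine_partition_def)
    have mono: "t i \<le> t j" if "i \<le> j" "j \<le> n" for i j
      using that tj(1) by (induction rule: dec_induct) (auto intro: order.trans)
    have cont: "continuous_on UNIV (\<lambda>u. f u * complex_of_real (g' u))"
      by (intro continuous_intros f g')
    have int: "h integrable_on S" if "continuous_on UNIV h" "S = {u..v}" for h :: "real \<Rightarrow> complex" and u v S
      using that by (auto intro!: integrable_continuous_real intro: continuous_on_subset)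
    have step: "norm (f (\<tau> j) * complex_of_real (g (t (Suc j)) - g (t j)) - integral {t j..t (Suc j)} (\<lambda>u. f u * complex_of_real (g' u)))
      \<le> c * \<bar>G\<bar> * (t (Suc j) - t j)" if j: "j < n" for j
    proof -
      have sub: "{t j..t (Suc j)} \<subseteq> {a..b}"
        using mono[of 0 j] mono[of "Suc j" n] j t by auto
      have "((\<lambda>u. complex_of_real (g' u)) has_integral (complex_of_real (g (t (Suc j))) - complex_of_real (g (t j)))) {t j..t (Suc j)}"
        using tj(1)[OF j] g
        by (intro fundamental_theorem_of_calculus)
          (auto simp: has_real_derivative_iff_has_vector_derivative[symmetric]
            intro!: has_vector_derivative_of_real intro: has_field_derivative_at_within)
      then have hs: "((\<lambda>u. f (\<tau> j) * complex_of_real (g' u)) has_integral f (\<tau> j) * complex_of_real (g (t (Suc j)) - g (t j))) {t j..t (Suc j)}"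
        unfolding of_real_diff by (rule has_integral_mult_right)
      have "f (\<tau> j) * complex_of_real (g (t (Suc j)) - g (t j)) - integral {t j..t (Suc j)} (\<lambda>u. f u * complex_of_real (g' u)) =
        integral {t j..t (Suc j)} (\<lambda>u. f (\<tau> j) * complex_of_real (g' u) - f u * complex_of_real (g' u))"
        using has_integral_diff[OF hs integrable_integral[OF int[OF cont refl]]]
        by (rule integral_unique[symmetric])
      also have "norm \<dots> \<le> c * \<bar>G\<bar> * (t (Suc j) - t j)"
      proof (rule integral_bound[OF tj(1)[OF j]])
        show "continuous_on {t j..t (Suc j)} (\<lambda>u. f (\<tau> j) * complex_of_real (g' u) - f u * complex_of_real (g' u))"
          by (intro continuous_intros continuous_on_subset[OF f] continuous_on_subset[OF g']) auto
        fix u assume u: "u \<in> {t j..t (Suc j)}"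
        have "dist (\<tau> j) u < \<delta>" using tj[OF j] u by (auto simp: dist_real_def)
        then have "norm (f (\<tau> j) - f u) \<le> c"
          using \<delta>(2)[of "\<tau> j" u] tj[OF j] u sub by (auto simp: dist_norm)
        moreover have "\<bar>g' u\<bar> \<le> \<bar>G\<bar>" using G[of u] u sub by force
        ultimately show "norm (f (\<tau> j) * complex_of_real (g' u) - f u * complex_of_real (g' u)) \<le> c * \<bar>G\<bar>"
          unfolding left_diff_distrib[symmetric] norm_mult norm_of_real using \<open>0 < c\<close> by (intro mult_mono) auto
      qed
      finally show ?thesis .
    qed
    have "(\<Sum>j<n. integral {t j..t (Suc j)} (\<lambda>u. f u * complex_of_real (g' u))) = integral {a..b} (\<lambda>u. f u * complex_of_real (g' u))"
      using integral_sum_consecutive[OF cont, of n t] tj(1) t by auto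
    then have "(\<Sum>j<n. f (\<tau> j) * complex_of_real (g (t (Suc j)) - g (t j))) - integral {a..b} (\<lambda>u. f u * complex_of_real (g' u)) =
      (\<Sum>j<n. f (\<tau> j) * complex_of_real (g (t (Suc j)) - g (t j)) - integral {t j..t (Suc j)} (\<lambda>u. f u * complex_of_real (g' u)))"
      by (simp only: sum_subtractf)
    also have "norm \<dots> \<le> (\<Sum>j<n. c * \<bar>G\<bar> * (t (Suc j) - t j))"
      using step by (intro order.trans[OF norm_sum sum_mono]) auto
    also have "\<dots> = c * \<bar>G\<bar> * (b - a)" using t by (simp add: sum_distrib_left[symmetric] sum_lessThan_telescope)
    also have "\<dots> < \<epsilon>" by (rule c)
    finally show "norm ((\<Sum>j<n. f (\<tau> j) * complex_of_real (g (t (Suc j)) - g (t j))) - integral {a..b} (\<lambda>u. f u * complex_of_real (g' u))) < \<epsilon>" .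
  qed
qed

text \<open>The integrator is approximated uniformly by polynomials, for which the integral is an
  ordinary one.\<close>

lemma ex_rs_integral:
  fixes f :: "real \<Rightarrow> complex" and x :: "real \<Rightarrow> real"
  assumes f: "continuous_on UNIV f" and V: "variation_le f a b V" and x: "continuous_on UNIV x" and "a \<le> b"
  shows "\<exists>I. has_rs_integral a b f x I"
proof -
  have "bounded (f ` {a..b})"
    using f by (intro compact_imp_bounded compact_continuous_image) (auto intro: continuous_on_subset)
  then obtain F where F: "\<And>u. u \<in> {a..b} \<Longrightarrow> norm (f u) \<le> F" unfolding bounded_iff by (metis imageI)
  \<comment> \<open>The constant of \<open>norm_rs_sum_le\<close>: a uniform change of the
    integrator by e changes every Riemann sum by at most K * e, whatever the partition.\<close>
  define K where "K = 2 * F + V"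
  have K: "0 \<le> K" using order.trans[OF norm_ge_zero F[of a]] variation_le_nonneg[OF V] \<open>a \<le> b\<close>
    unfolding K_def by simp
  have "\<exists>g g'. (\<forall>u. (g has_real_derivative g' u) (at u)) \<and> continuous_on UNIV g' \<and> (\<forall>u\<in>{a..b}. \<bar>x u - g u\<bar> \<le> inverse (real (Suc m)))" for m
  proof -
    obtain g where g: "real_polynomial_function g" "\<And>u. u \<in> {a..b} \<Longrightarrow> \<bar>x u - g u\<bar> < inverse (real (Suc m))"
      using Stone_Weierstrass_real_polynomial_function[of "{a..b}" x "inverse (real (Suc m))"] x
      by (metis continuous_on_subset compact_Icc subset_UNIV inverse_positive_iff_positive of_nat_0_less_iff zero_less_Suc)
    obtain g' where "real_polynomial_function g'" "\<forall>u. (g has_real_derivative g' u) (at u)"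
      using has_real_derivative_polynomial_function[OF g(1)] by blast
    then show ?thesis using g(2)
      by (intro exI[of _ g] exI[of _ g'])
        (auto intro: continuous_on_polymonial_function less_imp_le simp flip: real_polynomial_function_eq)
  qed
  then obtain g g' where g: "\<And>m u. (g m has_real_derivative g' m u) (at u)" "\<And>m. continuous_on UNIV (g' m)"
    and gx: "\<And>m u. u \<in> {a..b} \<Longrightarrow> \<bar>x u - g m u\<bar> \<le> inverse (real (Suc m))" by metis
  define J where "J m = integral {a..b} (\<lambda>u. f u * complex_of_real (g' m u))" for m
  have J: "has_rs_integral a b f (g m) (J m)" for m
    unfolding J_def by (rule has_rs_integral_smooth[OF f g])
  have diff: "norm (\<Sum>j<n. f (\<tau> j) * complex_of_real ((\<lambda>u. x u - g m u) (t (Suc j)) - (\<lambda>u. x u - g m u) (t j))) \<le> K * inverse (real (Suc m))"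
    if "t 0 = a" "t n = b" "\<forall>j<n. t j \<le> t (Suc j) \<and> \<tau> j \<in> {t j..t (Suc j)}" for n t \<tau> m
  proof -
    have "t i \<le> t j" if "i \<le> j" "j \<le> n" for i j
      using that \<open>\<forall>j<n. t j \<le> t (Suc j) \<and> _ j\<close> by (induction rule: dec_induct) (auto intro: order.trans)
    then have "t j \<in> {a..b}" if "j \<le> n" for j using that \<open>t 0 = a\<close> \<open>t n = b\<close> by force
    then show ?thesis unfolding K_def using that gx by (intro norm_rs_sum_le[OF V F]) auto
  qed
  have grid_diff: "norm (\<Sum>j<Suc k. f (grid a b k j) * complex_of_real ((x (grid a b k (Suc j)) - g m (grid a b k (Suc j))) - (x (grid a b k j) - g m (grid a b k j))))
    \<le> K * inverse (real (Suc m))" for k m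
    by (rule diff[of "grid a b k" "Suc k" "grid a b k" m]) (use \<open>a \<le> b\<close> in \<open>simp_all add: grid_simps grid_mono\<close>)
  \<comment> \<open>The two approximating integrators are compared through x on a common grid; the
    bound passes to the limit of the grid sums, so J is a Cauchy sequence.\<close>
  have JJ: "norm (J m - J l) \<le> K * inverse (real (Suc m)) + K * inverse (real (Suc l))" for m l
  proof (rule LIMSEQ_le_const2)
    let ?R = "\<lambda>y k. \<Sum>j<Suc k. f (grid a b k j) * complex_of_real (y (grid a b k (Suc j)) - y (grid a b k j))"
    show "(\<lambda>k. norm (?R (g m) k - ?R (g l) k)) \<longlonglongrightarrow> norm (J m - J l)"
      by (intro tendsto_intros tendsto_rs_sum_grid J \<open>a \<le> b\<close>) (auto intro: grid_mono \<open>a \<le> b\<close>)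
    have "norm (?R (g m) k - ?R (g l) k) \<le> K * inverse (real (Suc m)) + K * inverse (real (Suc l))" for k
    proof -
      have eq: "?R (g m) k - ?R (g l) k = ?R (\<lambda>u. x u - g l u) k - ?R (\<lambda>u. x u - g m u) k"
        by (simp only: sum_subtractf[symmetric] right_diff_distrib[symmetric] of_real_diff[symmetric]) (simp add: algebra_simps)
      show ?thesis
        unfolding eq using norm_triangle_ineq4 add_mono[OF grid_diff[of k l] grid_diff[of k m]]
        by (rule order.trans[OF _ order.trans[OF _ eq_refl[OF add.commute]]])
    qed
    then show "\<exists>N. \<forall>k\<ge>N. norm (?R (g m) k - ?R (g l) k) \<le> K * inverse (real (Suc m)) + K * inverse (real (Suc l))" by blast
  qed
  have inv0: "(\<lambda>m. K * inverse (real (Suc m))) \<longlonglongrightarrow> 0"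
    using tendsto_mult_left[OF LIMSEQ_inverse_real_of_nat, of K] by simp
  have "Cauchy J"
  proof (rule metric_CauchyI)
    fix e :: real assume "0 < e"
    then have "\<forall>\<^sub>F m in sequentially. K * inverse (real (Suc m)) < e / 2"
      by (intro order_tendstoD(2)[OF inv0]) auto
    then obtain N where N: "\<And>m. m \<ge> N \<Longrightarrow> K * inverse (real (Suc m)) < e / 2" by (auto simp: eventually_sequentially)
    then have "dist (J m) (J l) < e" if "m \<ge> N" "l \<ge> N" for m l
      using JJ[of m l] N[OF that(1)] N[OF that(2)] unfolding dist_norm by linarith
    then show "\<exists>N. \<forall>m\<ge>N. \<forall>l\<ge>N. dist (J m) (J l) < e" by blast
  qed
  then obtain I where I: "J \<longlonglongrightarrow> I" by (auto simp: Cauchy_convergent_iff convergent_def)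
  have "has_rs_integral a b f x I"
    unfolding has_rs_integral_iff
  proof (intro allI impI)
    fix e :: real assume "0 < e"
    then have "\<forall>\<^sub>F m in sequentially. K * inverse (real (Suc m)) < e / 3" "\<forall>\<^sub>F m in sequentially. dist (J m) I < e / 3"
      by (intro order_tendstoD(2)[OF inv0] tendstoD[OF I]; simp)+
    then have "\<forall>\<^sub>F m in sequentially. K * inverse (real (Suc m)) < e / 3 \<and> dist (J m) I < e / 3"
      by (rule eventually_conj)
    then obtain m where m: "K * inverse (real (Suc m)) < e / 3" "norm (J m - I) < e / 3"
      by (auto simp: eventually_sequentially dist_norm)
    have "0 < e / 3" using \<open>0 < e\<close> by simp
    obtain \<delta> where "0 < \<delta>" and \<delta>: "\<forall>n t \<tau>. fine_partition a b \<delta> n t \<tau> \<longrightarrow>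
        norm ((\<Sum>j<n. f (\<tau> j) * complex_of_real (g m (t (Suc j)) - g m (t j))) - J m) < e / 3"
      using has_rs_integralD[OF J[of m] \<open>0 < e / 3\<close>] by (elim exE conjE)
    show "\<exists>\<delta>>0. \<forall>n t \<tau>. fine_partition a b \<delta> n t \<tau> \<longrightarrow>
      norm ((\<Sum>j<n. f (\<tau> j) * complex_of_real (x (t (Suc j)) - x (t j))) - I) < e"
    proof (intro exI[of _ \<delta>] conjI \<open>0 < \<delta>\<close> allI impI)
      fix n t \<tau>
      assume t: "fine_partition a b \<delta> n t \<tau>"
      let ?R = "\<lambda>y. \<Sum>j<n. f (\<tau> j) * complex_of_real (y (t (Suc j)) - y (t j))"
      have 1: "norm (?R (\<lambda>u. x u - g m u)) \<le> K * inverse (real (Suc m))"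
        using t by (intro diff[of t n \<tau> m]) (auto simp: fine_partition_def)
      have 2: "norm (?R (g m) - J m) < e / 3" by (rule \<delta>[rule_format, OF t])
      have "?R x = ?R (\<lambda>u. x u - g m u) + ?R (g m)"
        by (simp only: sum.distrib[symmetric]) (simp add: algebra_simps)
      then have eq: "?R x - I = ?R (\<lambda>u. x u - g m u) + (?R (g m) - J m) + (J m - I)" by simp
      have "norm (?R x - I) \<le> norm (?R (\<lambda>u. x u - g m u)) + norm (?R (g m) - J m) + norm (J m - I)"
        unfolding eq using norm_triangle_mono norm_triangle_ineq order_refl by blast
      then show "norm (?R x - I) < e" using 1 2 m by linarith
    qed
  qed
  then show ?thesis by blast
qed

text \<open>A tagged partition of a larger interval is clamped to \<open>[a, b]\<close>. The two Riemann sums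
  only differ in the cells that contain an endpoint of \<open>[a, b]\<close>, where the increments of the
  integrator are small.\<close>

lemma has_rs_integral_superinterval:
  fixes f :: "real \<Rightarrow> complex" and x :: "real \<Rightarrow> real"
  assumes I: "has_rs_integral a b f x I" and V: "variation_le f a b V" and F: "\<And>u. norm (f u) \<le> F"
    and x: "continuous_on UNIV x" and ab: "a \<le> b" "A \<le> a" "b \<le> B" and zero: "\<And>u. u \<notin> {a<..<b} \<Longrightarrow> f u = 0"
  shows "has_rs_integral A B f x I"
  unfolding has_rs_integral_iff
proof (intro allI impI)
  fix \<epsilon> :: real assume "0 < \<epsilon>"
  define K where "K = 2 * F + V"
  have K: "0 \<le> K" unfolding K_def using variation_le_nonneg[OF V ab(1)] order.trans[OF norm_ge_zero F[of a]] by simp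
  have "0 < \<epsilon> / 2" using \<open>0 < \<epsilon>\<close> by simp
  obtain \<delta>1 where "0 < \<delta>1" and \<delta>1: "\<forall>n t \<tau>. fine_partition a b \<delta>1 n t \<tau> \<longrightarrow>
        norm ((\<Sum>j<n. f (\<tau> j) * complex_of_real (x (t (Suc j)) - x (t j))) - I) < \<epsilon> / 2"
    using has_rs_integralD[OF I \<open>0 < \<epsilon> / 2\<close>] by (elim exE conjE)
  define \<eta> where "\<eta> = \<epsilon> / (2 * (K + 1))"
  have \<eta>: "0 < \<eta>" "K * \<eta> < \<epsilon> / 2" using \<open>0 < \<epsilon>\<close> K by (auto simp: \<eta>_def field_simps)
  have "uniformly_continuous_on {A..B} x"
    using x by (intro compact_uniformly_continuous) (auto intro: continuous_on_subset)
  then obtain \<delta>2 where \<delta>2: "0 < \<delta>2" "\<And>u v. u \<in> {A..B} \<Longrightarrow> v \<in> {A..B} \<Longrightarrow> dist u v < \<delta>2 \<Longrightarrow> dist (x u) (x v) < \<eta>"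
    unfolding uniformly_continuous_on_def using \<eta>(1) by metis
  define cl where "cl u = max a (min b u)" for u :: real
  define \<delta> where "\<delta> = min \<delta>1 \<delta>2"
  \<comment> \<open>Clamping the tags is harmless because f vanishes at a, at b and outside.\<close>
  have f_cl: "f (cl u) = f u" for u using zero[of u] zero[of a] zero[of b] ab by (auto simp: cl_def max_def min_def)
  show "\<exists>\<delta>>0. \<forall>n t \<tau>. fine_partition A B \<delta> n t \<tau> \<longrightarrow>
      norm ((\<Sum>j<n. f (\<tau> j) * complex_of_real (x (t (Suc j)) - x (t j))) - I) < \<epsilon>"
  proof (intro exI[of _ \<delta>] conjI allI impI, goal_cases)
    case 1
    show ?case using \<open>0 < \<delta>1\<close> \<delta>2(1) by (simp add: \<delta>_def)
  next
    case (2 n t \<tau>)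
    then have t: "t 0 = A" "t n = B" by (auto simp: fine_partition_def)
    from 2 have tj: "\<And>j. j < n \<Longrightarrow> t j \<le> t (Suc j) \<and> t (Suc j) - t j < \<delta> \<and> \<tau> j \<in> {t j..t (Suc j)}"
      by (auto simp: fine_partition_def)
    have mono: "t i \<le> t j" if "i \<le> j" "j \<le> n" for i j
      using that tj by (induction rule: dec_induct) (auto intro: order.trans)
    then have in_AB: "t j \<in> {A..B}" if "j \<le> n" for j using that t by force
    have clamped: "cl (t 0) = a" "cl (t n) = b"
      "\<forall>j<n. cl (t j) \<le> cl (t (Suc j)) \<and> cl (t (Suc j)) - cl (t j) < \<delta>1 \<and> cl (\<tau> j) \<in> {cl (t j)..cl (t (Suc j))}"
    proof -
      show "cl (t 0) = a" "cl (t n) = b" using t ab by (auto simp: cl_def)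
      show "\<forall>j<n. cl (t j) \<le> cl (t (Suc j)) \<and> cl (t (Suc j)) - cl (t j) < \<delta>1 \<and> cl (\<tau> j) \<in> {cl (t j)..cl (t (Suc j))}"
      proof (intro allI impI)
        fix j assume "j < n"
        then show "cl (t j) \<le> cl (t (Suc j)) \<and> cl (t (Suc j)) - cl (t j) < \<delta>1 \<and> cl (\<tau> j) \<in> {cl (t j)..cl (t (Suc j))}"
          using tj[of j] \<open>0 < \<delta>1\<close> by (auto simp: cl_def \<delta>_def)
      qed
    qed
    \<comment> \<open>Far from [a, b] the difference between x and the clamped integrator need not
      be small, so it is cut off there. A cell with tag in (a, b) has both endpoints within \<delta>
      of [a, b] and does not notice the cut-off; for other tags f is zero.\<close>
    define e where "e u = (if a - \<delta> < u \<and> u < b + \<delta> then x u - x (cl u) else 0)" for u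
    have e: "\<bar>e (t j)\<bar> \<le> \<eta>" if "j \<le> n" for j
    proof (cases "a - \<delta> < t j \<and> t j < b + \<delta>")
      case True
      have "dist (t j) (cl (t j)) < \<delta>2" using True \<delta>2(1) ab by (auto simp: cl_def dist_real_def \<delta>_def)
      moreover have "cl (t j) \<in> {A..B}" using ab by (auto simp: cl_def)
      ultimately have "dist (x (t j)) (x (cl (t j))) < \<eta>" using in_AB[OF that] by (intro \<delta>2(2)) auto
      then show ?thesis using True by (simp add: e_def dist_real_def)
    qed (use \<eta> in \<open>auto simp: e_def\<close>)
    have "f (\<tau> j) * complex_of_real (x (t (Suc j)) - x (t j)) =
      f (cl (\<tau> j)) * complex_of_real (x (cl (t (Suc j))) - x (cl (t j))) + f (cl (\<tau> j)) * complex_of_real (e (t (Suc j)) - e (t j))"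
      if "j < n" for j
    proof (cases "\<tau> j \<in> {a<..<b}")
      case True
      then have "e (t j) = x (t j) - x (cl (t j))" "e (t (Suc j)) = x (t (Suc j)) - x (cl (t (Suc j)))"
        using tj[OF that] by (auto simp: e_def)
      then show ?thesis by (simp only: f_cl of_real_diff) (simp add: algebra_simps)
    qed (simp add: f_cl zero)
    then have "(\<Sum>j<n. f (\<tau> j) * complex_of_real (x (t (Suc j)) - x (t j))) - I =
      ((\<Sum>j<n. f (cl (\<tau> j)) * complex_of_real (x (cl (t (Suc j))) - x (cl (t j)))) - I) + (\<Sum>j<n. f (cl (\<tau> j)) * complex_of_real (e (t (Suc j)) - e (t j)))"
      by (simp add: sum.distrib)
    moreover have "norm ((\<Sum>j<n. f (cl (\<tau> j)) * complex_of_real (x (cl (t (Suc j))) - x (cl (t j)))) - I) < \<epsilon> / 2"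
      by (rule \<delta>1[rule_format]) (use clamped in \<open>simp add: fine_partition_def\<close>)
    moreover have "norm (\<Sum>j<n. f (cl (\<tau> j)) * complex_of_real (e (t (Suc j)) - e (t j))) < \<epsilon> / 2"
    proof -
      \<comment> \<open>Here the tags belong to the clamped partition while the integrator is
        evaluated at the original points, which is why \<open>norm_rs_sum_le\<close> has the
        separate points y.\<close>
      have "norm (\<Sum>j<n. f (cl (\<tau> j)) * complex_of_real (e (t (Suc j)) - e (t j))) \<le> K * \<eta>"
        unfolding K_def using clamped e F
        by (intro norm_rs_sum_le[OF V, where t="\<lambda>j. cl (t j)" and \<tau>="\<lambda>j. cl (\<tau> j)"]) auto
      then show ?thesis using \<eta> by simp
    qed
    ultimately show ?case
      by (simp only:) (rule order.strict_trans1[OF norm_triangle_ineq], simp)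
  qed
qed

text \<open>Once [-N, N] contains [a, b], the integrals no longer change, so the limit over N is
  that of an eventually constant sequence. The second claim justifies the definite description in
  \<open>rs_integral\<close>.\<close>

lemma rs_integral_line_eq:
  fixes f :: "real \<Rightarrow> complex" and x :: "real \<Rightarrow> real"
  assumes f: "continuous_on UNIV f" and V: "variation_le f a b V" and F: "\<And>u. norm (f u) \<le> F"
    and x: "continuous_on UNIV x" and "a \<le> b" and zero: "\<And>u. u \<notin> {a<..<b} \<Longrightarrow> f u = 0"
  shows "rs_integral_line f x = rs_integral a b f x" "has_rs_integral a b f x (rs_integral a b f x)"
proof -
  obtain I where I: "has_rs_integral a b f x I" using ex_rs_integral[OF f V x \<open>a \<le> b\<close>] by blast
  then have ab: "rs_integral a b f x = I" using \<open>a \<le> b\<close> by (rule rs_integral_eqI)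
  with I show "has_rs_integral a b f x (rs_integral a b f x)" by simp
  have "rs_integral (- real N) (real N) f x = I" if "N \<ge> nat \<lceil>\<bar>a\<bar> + \<bar>b\<bar>\<rceil>" for N
  proof -
    have "\<bar>a\<bar> + \<bar>b\<bar> \<le> real N" using that by linarith
    then show ?thesis
      using \<open>a \<le> b\<close> by (intro rs_integral_eqI has_rs_integral_superinterval[OF I V F x _ _ _ zero]) auto
  qed
  then have "\<forall>\<^sub>F N in sequentially. rs_integral (- real N) (real N) f x = I"
    unfolding eventually_sequentially by blast
  then have "(\<lambda>N. rs_integral (- real N) (real N) f x) \<longlonglongrightarrow> I" by (rule tendsto_eventually)
  then show "rs_integral_line f x = rs_integral a b f x"
    unfolding rs_integral_line_def ab by (rule limI)
qed

section \<open>Fractional Brownian motion\<close>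

text \<open>Covariance of X b - X a and X d - X c. The terms of the covariance function in a single
  time cancel, leaving an expression in time differences that is homogeneous of degree 2 H.\<close>

definition increment_cov :: "real \<Rightarrow> real \<Rightarrow> real \<Rightarrow> real \<Rightarrow> real \<Rightarrow> real \<Rightarrow> real" where
  "increment_cov \<sigma> H a b c d = \<sigma>\<^sup>2 / 2 *
     (\<bar>b - c\<bar> powr (2 * H) + \<bar>a - d\<bar> powr (2 * H) - \<bar>b - d\<bar> powr (2 * H) - \<bar>a - c\<bar> powr (2 * H))"

section \<open>Centred Gaussian variables\<close>

context prob_space
begin

lemma gaussian_rv_centred:
  assumes Y: "gaussian_rv M Y" and mean: "expectation Y = 0"
  shows "integrable M (\<lambda>\<omega>. (Y \<omega>)\<^sup>2)"
    and "char (distr M borel Y) \<theta> = complex_of_real (exp (- (\<theta>\<^sup>2 * expectation (\<lambda>\<omega>. (Y \<omega>)\<^sup>2) / 2)))"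
proof -
  have [measurable]: "Y \<in> borel_measurable M" using Y by (simp add: gaussian_rv_def)
  have "integrable M (\<lambda>\<omega>. (Y \<omega>)\<^sup>2) \<and>
    char (distr M borel Y) \<theta> = complex_of_real (exp (- (\<theta>\<^sup>2 * expectation (\<lambda>\<omega>. (Y \<omega>)\<^sup>2) / 2)))"
    using Y[unfolded gaussian_rv_def, THEN conjunct2]
  proof (elim disjE exE conjE)
    fix \<mu> s :: real
    assume s: "0 < s" and D: "distributed M lborel Y (\<lambda>x. ennreal (normal_density \<mu> s x))"
    have \<mu>: "\<mu> = 0" using normal_distributed_expectation[OF s D] mean by simp
    have var: "expectation (\<lambda>\<omega>. (Y \<omega>)\<^sup>2) = s\<^sup>2"
      using normal_distributed_variance[OF s D] mean by simp
    have int: "integrable M (\<lambda>\<omega>. (Y \<omega>)\<^sup>2)"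
      using integrable_normal_moment[OF s, of \<mu> 2] distributed_integrable[OF D, of "\<lambda>x. x\<^sup>2"] by (simp add: \<mu>)
    define Z where "Z \<omega> = Y \<omega> / s" for \<omega>
    have "distributed M lborel Z std_normal_density"
      using D normal_standard_normal_convert[OF s, of Y \<mu>] by (simp add: \<mu> Z_def[abs_def])
    then have "distr M lborel Z = std_normal_distribution" by (rule distributed_distr_eq_density)
    then have "distr M borel Z = std_normal_distribution" by (simp cong: distr_cong)
    moreover have [measurable]: "Z \<in> borel_measurable M" unfolding Z_def by measurable
    moreover have "char (distr M borel Y) \<theta> = char (distr M borel Z) (\<theta> * s)"
      using s by (simp add: char_distr Z_def)
    ultimately show ?thesis using int
      by (simp add: char_std_normal_distribution var power_mult_distrib)
  next
    \<comment> \<open>A centred constant is 0 almost surely, and the formula holds with variance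
      0.\<close>
    fix c assume c: "AE \<omega> in M. Y \<omega> = c"
    have "expectation Y = expectation (\<lambda>_. c)" using c by (intro integral_cong_AE) auto
    then have "c = 0" using mean by (simp add: prob_space)
    then have Y0: "AE \<omega> in M. Y \<omega> = 0" using c by simp
    have 1: "integrable M (\<lambda>\<omega>. (Y \<omega>)\<^sup>2)"
      by (rule integrable_cong_AE_imp[of M "\<lambda>_. 0"]) (use Y0 in auto)
    have 2: "expectation (\<lambda>\<omega>. (Y \<omega>)\<^sup>2) = expectation (\<lambda>_. 0)" using Y0 by (intro integral_cong_AE) auto
    have 3: "expectation (\<lambda>\<omega>. iexp (\<theta> * Y \<omega>)) = expectation (\<lambda>_. 1)" using Y0 by (intro integral_cong_AE) auto
    show ?thesis using 1 2 3 by (simp add: char_distr prob_space)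
  qed
  then show "integrable M (\<lambda>\<omega>. (Y \<omega>)\<^sup>2)"
    and "char (distr M borel Y) \<theta> = complex_of_real (exp (- (\<theta>\<^sup>2 * expectation (\<lambda>\<omega>. (Y \<omega>)\<^sup>2) / 2)))" by auto
qed

lemma integrable_mult_if_square_integrable:
  fixes U V :: "'a \<Rightarrow> real"
  assumes [measurable]: "U \<in> borel_measurable M" "V \<in> borel_measurable M"
    and "integrable M (\<lambda>\<omega>. (U \<omega>)\<^sup>2)" "integrable M (\<lambda>\<omega>. (V \<omega>)\<^sup>2)"
  shows "integrable M (\<lambda>\<omega>. U \<omega> * V \<omega>)"
proof (rule Bochner_Integration.integrable_bound[of M "\<lambda>\<omega>. (U \<omega>)\<^sup>2 + (V \<omega>)\<^sup>2"])
  show "AE \<omega> in M. norm (U \<omega> * V \<omega>) \<le> norm ((U \<omega>)\<^sup>2 + (V \<omega>)\<^sup>2)"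
  proof (rule AE_I2)
    fix \<omega>
    have "2 * (\<bar>U \<omega>\<bar> * \<bar>V \<omega>\<bar>) \<le> (U \<omega>)\<^sup>2 + (V \<omega>)\<^sup>2"
      using sum_squares_bound[of "\<bar>U \<omega>\<bar>" "\<bar>V \<omega>\<bar>"] by simp
    moreover have "0 \<le> \<bar>U \<omega>\<bar> * \<bar>V \<omega>\<bar>" by simp
    ultimately show "norm (U \<omega> * V \<omega>) \<le> norm ((U \<omega>)\<^sup>2 + (V \<omega>)\<^sup>2)"
      unfolding real_norm_def abs_mult by linarith
  qed
qed (use assms in auto)

text \<open>By Levy's uniqueness theorem Z has the law of \<sigma> times a standard normal variable,
  and |x|^p is dominated by 1 plus an even power, whose moments are finite.\<close>

lemma nn_integral_powr_finite_if_char_normal: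
  fixes Z :: "'a \<Rightarrow> real"
  assumes [measurable]: "Z \<in> borel_measurable M"
    and char: "\<And>\<theta>. char (distr M borel Z) \<theta> = complex_of_real (exp (- ((\<sigma> * \<theta>)\<^sup>2 / 2)))" and "0 \<le> p"
  shows "(\<integral>\<^sup>+\<omega>. ennreal (\<bar>Z \<omega>\<bar> powr p) \<partial>M) < \<infinity>"
proof -
  interpret N: real_distribution std_normal_distribution by (rule real_dist_normal_dist)
  have eq: "distr M borel Z = distr std_normal_distribution borel (\<lambda>x. \<sigma> * x)"
  proof (rule Levy_uniqueness)
    show "char (distr M borel Z) = char (distr std_normal_distribution borel (\<lambda>x. \<sigma> * x))"
    proof
      fix \<theta>
      have "char (distr std_normal_distribution borel (\<lambda>x. \<sigma> * x)) \<theta> = char std_normal_distribution (\<theta> * \<sigma>)"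
        by (subst N.char_distr) (auto simp: char_def mult.assoc)
      then show "char (distr M borel Z) \<theta> = char (distr std_normal_distribution borel (\<lambda>x. \<sigma> * x)) \<theta>"
        by (simp add: char char_std_normal_distribution mult.commute)
    qed
  qed (auto intro!: real_distribution_distr N.real_distribution_distr)
  define n where "n = nat \<lceil>p\<rceil>"
  have bound: "\<bar>x\<bar> powr p \<le> 1 + x ^ (2 * n)" for x :: real
  proof (cases "\<bar>x\<bar> \<le> 1")
    case True
    then have "\<bar>x\<bar> powr p \<le> 1 powr p" using \<open>0 \<le> p\<close> by (intro powr_mono2) auto
    then show ?thesis by (simp add: add_increasing2)
  next
    case False
    have "p \<le> real (2 * n)" using \<open>0 \<le> p\<close> unfolding n_def by linarith
    then have "\<bar>x\<bar> powr p \<le> \<bar>x\<bar> powr real (2 * n)" using False by (intro powr_mono) auto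
    also have "\<dots> = x ^ (2 * n)" using False by (subst powr_realpow) (auto simp: power_even_abs)
    finally show ?thesis by simp
  qed
  have "(\<integral>\<^sup>+\<omega>. ennreal (\<bar>Z \<omega>\<bar> powr p) \<partial>M) = (\<integral>\<^sup>+x. ennreal (\<bar>x\<bar> powr p) \<partial>distr M borel Z)"
    by (simp add: nn_integral_distr)
  also have "\<dots> = (\<integral>\<^sup>+x. ennreal (\<bar>\<sigma> * x\<bar> powr p) \<partial>std_normal_distribution)"
    unfolding eq by (simp add: nn_integral_distr)
  also have "\<dots> \<le> (\<integral>\<^sup>+x. ennreal (1 + \<sigma> ^ (2 * n) * x ^ (2 * n)) \<partial>std_normal_distribution)"
    using bound by (intro nn_integral_mono ennreal_leI) (simp add: power_mult_distrib[symmetric])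
  also have "\<dots> < \<infinity>"
  proof -
    have "integrable std_normal_distribution (\<lambda>x. 1 + \<sigma> ^ (2 * n) * x ^ (2 * n))"
      by (intro Bochner_Integration.integrable_add integrable_mult_right integrable_std_normal_distribution_moment) auto
    then show ?thesis
      by (subst nn_integral_eq_integral) auto
  qed
  finally show ?thesis .
qed

end

text \<open>X plays the role of the Hoelder modification, of which continuity of every path is kept.
  The joint Gaussian law of the increments is recorded through their linear combinations, the form
  in which projected Riemann sums present themselves.\<close>

locale fbm = prob_space M for M :: "'a measure" +
  fixes X :: "real \<Rightarrow> 'a \<Rightarrow> real" and H \<sigma> :: real
  assumes measurable_X[measurable]: "\<And>t. X t \<in> borel_measurable M"
    and H: "0 < H"
    and continuous_paths: "\<And>\<omega>. \<omega> \<in> space M \<Longrightarrow> continuous_on UNIV (\<lambda>t. X t \<omega>)"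
    and char_increments: "\<And>n d a b \<theta>. char (distr M borel (\<lambda>\<omega>. \<Sum>i<n::nat. d i * (X (b i) \<omega> - X (a i) \<omega>))) \<theta> =
      complex_of_real (exp (- (\<theta>\<^sup>2 * (\<Sum>i<n. \<Sum>k<n. d i * d k * increment_cov \<sigma> H (a i) (b i) (a k) (b k)) / 2)))"

lemma continuous_on_if_holder:
  fixes x :: "real \<Rightarrow> real"
  assumes "0 < \<beta>" and holder: "\<And>a b. \<exists>C. \<forall>s\<in>{a..b}. \<forall>t\<in>{a..b}. \<bar>x s - x t\<bar> \<le> C * \<bar>s - t\<bar> powr \<beta>"
  shows "continuous_on UNIV x"
  unfolding continuous_on_def
proof
  fix t
  obtain C where C: "\<And>u. u \<in> {t - 1..t + 1} \<Longrightarrow> \<bar>x u - x t\<bar> \<le> C * \<bar>u - t\<bar> powr \<beta>"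
    using holder[of "t - 1" "t + 1"] by force
  have "((\<lambda>u. C * \<bar>u - t\<bar> powr \<beta>) \<longlongrightarrow> C * \<bar>t - t\<bar> powr \<beta>) (at t)"
    using \<open>0 < \<beta>\<close> by (intro tendsto_intros tendsto_powr') auto
  then have lim: "((\<lambda>u. C * \<bar>u - t\<bar> powr \<beta>) \<longlongrightarrow> 0) (at t)" by simp
  have "\<forall>\<^sub>F u in at t. u \<in> {t - 1<..<t + 1}"
    by (rule eventually_at_topological[THEN iffD2]) (auto intro: exI[of _ "{t - 1<..<t + 1}"])
  then have "\<forall>\<^sub>F u in at t. norm (x u - x t) \<le> C * \<bar>u - t\<bar> powr \<beta>"
    by eventually_elim (use C in auto)
  then have "((\<lambda>u. x u - x t) \<longlongrightarrow> 0) (at t)" using lim by (rule Lim_null_comparison)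
  then show "(x \<longlongrightarrow> x t) (at t within UNIV)" by (simp add: LIM_zero_iff)
qed

lemma fbm_if_fractional_brownian_motion:
  assumes X: "fractional_brownian_motion H M X" and mod: "modification M X X'" and holder: "holder_paths M X'"
    and "0 < H"
  obtains \<sigma> where "fbm M X' H \<sigma>"
proof -
  from X have "prob_space M" and gauss: "\<And>I a. finite I \<Longrightarrow> gaussian_rv M (\<lambda>\<omega>. \<Sum>t\<in>I. a t * X t \<omega>)"
    and mean: "\<And>t. (\<integral>\<omega>. X t \<omega> \<partial>M) = 0"
    unfolding fractional_brownian_motion_def gaussian_process_def by auto
  from X obtain \<sigma> where cov: "\<And>s t. (\<integral>\<omega>. X s \<omega> * X t \<omega> \<partial>M) =
        \<sigma>\<^sup>2 / 2 * (\<bar>s\<bar> powr (2 * H) + \<bar>t\<bar> powr (2 * H) - \<bar>s - t\<bar> powr (2 * H))"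
    unfolding fractional_brownian_motion_def by auto
  interpret prob_space M by fact
  have X_gauss: "gaussian_rv M (X t)" for t
    using gauss[of "{t}" "\<lambda>_. 1"] by simp
  then have [measurable]: "X t \<in> borel_measurable M" for t by (simp add: gaussian_rv_def)
  have [measurable]: "X' t \<in> borel_measurable M" and X'_X: "AE \<omega> in M. X' t \<omega> = X t \<omega>" for t
    using mod unfolding modification_def by auto
  have sq: "integrable M (\<lambda>\<omega>. (X t \<omega>)\<^sup>2)" for t
    using gaussian_rv_centred(1)[OF X_gauss mean] .
  have int: "integrable M (\<lambda>\<omega>. X s \<omega> * X t \<omega>)" for s t
    by (rule integrable_mult_if_square_integrable) (auto simp: sq)
  have int1: "integrable M (X t)" for t
    using integrable_mult_if_square_integrable[of "X t" "\<lambda>_. 1"] sq by simp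
  have incr_int: "integrable M (\<lambda>\<omega>. (X b \<omega> - X a \<omega>) * (X d \<omega> - X c \<omega>))" for a b c d
    unfolding left_diff_distrib right_diff_distrib by (intro Bochner_Integration.integrable_diff int)
  have incr_cov: "expectation (\<lambda>\<omega>. (X b \<omega> - X a \<omega>) * (X d \<omega> - X c \<omega>)) = increment_cov \<sigma> H a b c d" for a b c d
    unfolding left_diff_distrib right_diff_distrib
    by (simp add: int cov increment_cov_def algebra_simps)
  have "char (distr M borel (\<lambda>\<omega>. \<Sum>i<n::nat. d i * (X' (b i) \<omega> - X' (a i) \<omega>))) \<theta> =
      complex_of_real (exp (- (\<theta>\<^sup>2 * (\<Sum>i<n. \<Sum>k<n. d i * d k * increment_cov \<sigma> H (a i) (b i) (a k) (b k)) / 2)))" for n d a b \<theta>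
  proof -
    define Y where "Y \<omega> = (\<Sum>i<n. d i * (X (b i) \<omega> - X (a i) \<omega>))" for \<omega>
    have [measurable]: "Y \<in> borel_measurable M" unfolding Y_def by measurable
    define I where "I = b ` {..<n} \<union> a ` {..<n}"
    \<comment> \<open>The times a i and b i may coincide, whereas a Gaussian process is described by
      sums over sets of times; A collects the total coefficient of each time.\<close>
    define A where "A t = (\<Sum>i<n. d i * ((if t = b i then 1 else 0) - (if t = a i then 1 else 0)))" for t
    have "Y \<omega> = (\<Sum>t\<in>I. A t * X t \<omega>)" for \<omega>
    proof -
      have "(\<Sum>t\<in>I. A t * X t \<omega>) = (\<Sum>i<n. \<Sum>t\<in>I. d i * ((if t = b i then X t \<omega> else 0) - (if t = a i then X t \<omega> else 0)))"
        unfolding A_def sum_distrib_right by (subst sum.swap) (intro sum.cong refl, auto)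
      also have "\<dots> = Y \<omega>"
        unfolding Y_def sum_distrib_left[symmetric] sum_subtractf
        by (intro sum.cong refl) (auto simp: I_def)
      finally show ?thesis by simp
    qed
    then have Y_eq: "Y = (\<lambda>\<omega>. \<Sum>t\<in>I. A t * X t \<omega>)" by (rule ext)
    have Y: "gaussian_rv M Y" unfolding Y_eq by (rule gauss) (auto simp: I_def)
    have EY: "expectation Y = 0" unfolding Y_def using int1 by (simp add: mean)
    have "(Y \<omega>)\<^sup>2 = (\<Sum>i<n. \<Sum>k<n. d i * d k * ((X (b i) \<omega> - X (a i) \<omega>) * (X (b k) \<omega> - X (a k) \<omega>)))" for \<omega>
      unfolding Y_def power2_eq_square sum_product by (intro sum.cong refl) (simp add: ac_simps)
    then have "expectation (\<lambda>\<omega>. (Y \<omega>)\<^sup>2) = (\<Sum>i<n. \<Sum>k<n. d i * d k * increment_cov \<sigma> H (a i) (b i) (a k) (b k))"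
      by (simp add: incr_int incr_cov)
    moreover have "char (distr M borel (\<lambda>\<omega>. \<Sum>i<n. d i * (X' (b i) \<omega> - X' (a i) \<omega>))) \<theta> = char (distr M borel Y) \<theta>"
    proof -
      \<comment> \<open>Only finitely many times occur, so one null set serves them all.\<close>
      have "AE \<omega> in M. \<forall>i\<in>{..<n}. X' (b i) \<omega> = X (b i) \<omega> \<and> X' (a i) \<omega> = X (a i) \<omega>"
        using X'_X by (intro AE_finite_allI) auto
      then have "AE \<omega> in M. (\<Sum>i<n. d i * (X' (b i) \<omega> - X' (a i) \<omega>)) = Y \<omega>"
        by eventually_elim (auto simp: Y_def)
      then have "distr M borel (\<lambda>\<omega>. \<Sum>i<n. d i * (X' (b i) \<omega> - X' (a i) \<omega>)) = distr M borel Y"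
        by (intro distr_cong_AE) auto
      then show ?thesis by simp
    qed
    ultimately show ?thesis using gaussian_rv_centred(2)[OF Y EY] by simp
  qed
  moreover obtain \<beta> where "0 < \<beta>" "\<forall>\<omega>\<in>space M. \<forall>a b. \<exists>C. \<forall>s\<in>{a..b}. \<forall>t\<in>{a..b}. \<bar>X' s \<omega> - X' t \<omega>\<bar> \<le> C * \<bar>s - t\<bar> powr \<beta>"
    using holder unfolding holder_paths_def by auto
  then have "continuous_on UNIV (\<lambda>t. X' t \<omega>)" if "\<omega> \<in> space M" for \<omega>
    using that by (intro continuous_on_if_holder[of \<beta>]) auto
  ultimately have "fbm M X' H \<sigma>"
    using \<open>0 < H\<close> by unfold_locales auto
  then show thesis by (rule that)
qed

section \<open>Scaling and moment bounds for pathwise integrals\<close>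

context fbm
begin

definition unit_moment :: "real \<Rightarrow> ennreal" where
  "unit_moment p = (\<integral>\<^sup>+\<omega>. ennreal (\<bar>X 1 \<omega> - X 0 \<omega>\<bar> powr p) \<partial>M)"

lemma char_increment:
  "char (distr M borel (\<lambda>\<omega>. X t \<omega> - X 0 \<omega>)) \<theta> = complex_of_real (exp (- (\<theta>\<^sup>2 * (\<sigma>\<^sup>2 * \<bar>t\<bar> powr (2 * H)) / 2)))"
  using char_increments[where n=1 and d="\<lambda>_. 1" and b="\<lambda>_. t" and a="\<lambda>_. 0" and \<theta>=\<theta>] H
  by (simp add: increment_cov_def)

lemma unit_moment_finite: "0 \<le> p \<Longrightarrow> unit_moment p < \<infinity>"
  unfolding unit_moment_def using char_increment[of 1]
  by (intro nn_integral_powr_finite_if_char_normal[where \<sigma>=\<sigma>]) (auto simp: power_mult_distrib mult.commute)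

text \<open>The increment has the law of t^H times the unit increment, and t^H \<le> 1.\<close>

lemma nn_integral_increment_powr_le:
  assumes "t \<in> {0..1}" "0 \<le> p"
  shows "(\<integral>\<^sup>+\<omega>. ennreal (\<bar>X t \<omega> - X 0 \<omega>\<bar> powr p) \<partial>M) \<le> unit_moment p"
proof -
  have "(\<integral>\<^sup>+\<omega>. ennreal (\<bar>X t \<omega> - X 0 \<omega>\<bar> powr p) \<partial>M) = ennreal ((t powr H) powr p) * unit_moment p"
    unfolding unit_moment_def
  proof (rule nn_integral_powr_eq_if_char_eq)
    fix \<theta>
    have "(t powr H)\<^sup>2 = \<bar>t\<bar> powr (2 * H)"
      using assms(1) by (simp add: power2_eq_square flip: powr_add)
    then show "char (distr M borel (\<lambda>\<omega>. X t \<omega> - X 0 \<omega>)) \<theta> = char (distr M borel (\<lambda>\<omega>. X 1 \<omega> - X 0 \<omega>)) (t powr H * \<theta>)"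
      unfolding char_increment by (simp add: power_mult_distrib ac_simps)
  qed auto
  also have "(t powr H) powr p \<le> 1 powr p"
    using assms H powr_mono2[of H t 1] by (intro powr_mono2) auto
  then have "ennreal ((t powr H) powr p) * unit_moment p \<le> 1 * unit_moment p"
    by (intro mult_right_mono) (auto simp: ennreal_le_1)
  finally show ?thesis by simp
qed

text \<open>Stationarity, reflection symmetry and self-similarity at once: under u \<mapsto> t - s u
  all increment covariances are multiplied by s^(2 H). The reflection exchanges the endpoints a i
  and b i, which keeps increments forward in time.\<close>

lemma char_scaled_increments:
  fixes c :: "nat \<Rightarrow> complex"
  assumes "0 < s"
  shows "char (distr M borel (\<lambda>\<omega>. Re (z * (\<Sum>i<n. c i * complex_of_real (X (t - s * a i) \<omega> - X (t - s * b i) \<omega>))))) \<theta> =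
    char (distr M borel (\<lambda>\<omega>. Re (z * (\<Sum>i<n. c i * complex_of_real (X (b i) \<omega> - X (a i) \<omega>))))) (s powr H * \<theta>)"
proof -
  have Re_sum: "Re (z * (\<Sum>i<n. c i * complex_of_real (g i))) = (\<Sum>i<n. Re (z * c i) * g i)" for g
    by (simp add: sum_distrib_left Re_sum left_diff_distrib algebra_simps)
  have s: "(s powr H)\<^sup>2 = s powr (2 * H)" using \<open>0 < s\<close> by (simp add: power2_eq_square flip: powr_add)
  have scale: "\<bar>s * x\<bar> powr (2 * H) = s powr (2 * H) * \<bar>x\<bar> powr (2 * H)" for x
    using \<open>0 < s\<close> by (simp add: abs_mult powr_mult)
  have cov: "increment_cov \<sigma> H (t - s * b i) (t - s * a i) (t - s * b k) (t - s * a k) =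
    (s powr H)\<^sup>2 * increment_cov \<sigma> H (a i) (b i) (a k) (b k)" for i k
  proof -
    have "t - s * x - (t - s * y) = s * (y - x)" for x y by (simp add: algebra_simps)
    then show ?thesis unfolding increment_cov_def s
      by (simp only: scale) (simp add: abs_minus_commute algebra_simps)
  qed
  show ?thesis
    unfolding Re_sum char_increments cov
    by (simp add: power_mult_distrib sum_distrib_left ac_simps)
qed

text \<open>Jensen's inequality with weights a j / S bounds the power of the sum by a weighted sum
  of powers. Hence only the moments of single increments matter, although the increments are
  dependent.\<close>

lemma nn_integral_weighted_sum_powr_le:
  fixes n :: nat
  assumes a: "\<And>j. j < n \<Longrightarrow> 0 \<le> a j" "(\<Sum>j<n. a j) \<le> V" and u: "\<And>j. j < n \<Longrightarrow> u j \<in> {0..1}" and "1 \<le> p"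
  shows "(\<integral>\<^sup>+\<omega>. ennreal ((\<Sum>j<n. a j * \<bar>X (u j) \<omega> - X 0 \<omega>\<bar>) powr p) \<partial>M) \<le> ennreal (V powr p) * unit_moment p"
proof -
  \<comment> \<open>The actual total weight, possibly smaller than V; normalising by it makes the
    weights sum to 1.\<close>
  define S where "S = (\<Sum>j<n. a j)"
  show ?thesis
  proof (cases "S = 0")
    case True
    then have "a j = 0" if "j < n" for j
      using a that unfolding S_def by (subst (asm) sum_nonneg_eq_0_iff) auto
    then show ?thesis using \<open>1 \<le> p\<close> by simp
  next
    case False
    moreover have "0 \<le> S" unfolding S_def using a by (intro sum_nonneg) auto
    ultimately have S: "0 < S" "S \<le> V" using a unfolding S_def by auto
    have "n \<noteq> 0" using False unfolding S_def by (intro notI) simp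
    have jensen: "(\<Sum>j<n. a j * y j) powr p \<le> (\<Sum>j<n. S powr (p - 1) * a j * y j powr p)"
      if y: "\<And>j. j < n \<Longrightarrow> 0 \<le> y j" for y
    proof -
      have "(\<Sum>j<n. a j * y j) = S * (\<Sum>j<n. (a j / S) *\<^sub>R y j)"
        using S by (simp add: sum_distrib_left)
      also have "\<dots> powr p = S powr p * (\<Sum>j<n. (a j / S) *\<^sub>R y j) powr p"
        using S a y by (intro powr_mult)
      also have "(\<Sum>j<n. (a j / S) *\<^sub>R y j) powr p \<le> (\<Sum>j<n. (a j / S) * y j powr p)"
        using S a y \<open>n \<noteq> 0\<close>
        by (intro convex_on_sum[OF _ _ convex_on_powr_nonneg[OF \<open>1 \<le> p\<close>]])
          (auto simp: S_def[symmetric] sum_divide_distrib[symmetric])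
      finally show ?thesis using S by (simp add: sum_distrib_left powr_diff mult.assoc)
    qed
    have "(\<integral>\<^sup>+\<omega>. ennreal ((\<Sum>j<n. a j * \<bar>X (u j) \<omega> - X 0 \<omega>\<bar>) powr p) \<partial>M) \<le>
      (\<integral>\<^sup>+\<omega>. (\<Sum>j<n. ennreal (S powr (p - 1) * a j) * ennreal (\<bar>X (u j) \<omega> - X 0 \<omega>\<bar> powr p)) \<partial>M)"
    proof (intro nn_integral_mono)
      fix \<omega>
      have "(\<Sum>j<n. ennreal (S powr (p - 1) * a j) * ennreal (\<bar>X (u j) \<omega> - X 0 \<omega>\<bar> powr p)) =
        ennreal (\<Sum>j<n. S powr (p - 1) * a j * \<bar>X (u j) \<omega> - X 0 \<omega>\<bar> powr p)"
        using a by (subst sum_ennreal[symmetric]) (auto simp: ennreal_mult' intro!: sum.cong)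
      then show "ennreal ((\<Sum>j<n. a j * \<bar>X (u j) \<omega> - X 0 \<omega>\<bar>) powr p) \<le>
        (\<Sum>j<n. ennreal (S powr (p - 1) * a j) * ennreal (\<bar>X (u j) \<omega> - X 0 \<omega>\<bar> powr p))"
        using jensen[of "\<lambda>j. \<bar>X (u j) \<omega> - X 0 \<omega>\<bar>"] by (simp add: ennreal_leI)
    qed
    also have "\<dots> = (\<Sum>j<n. ennreal (S powr (p - 1) * a j) * (\<integral>\<^sup>+\<omega>. ennreal (\<bar>X (u j) \<omega> - X 0 \<omega>\<bar> powr p) \<partial>M))"
      by (subst nn_integral_sum) (auto simp: nn_integral_cmult)
    also have "\<dots> \<le> (\<Sum>j<n. ennreal (S powr (p - 1) * a j) * unit_moment p)"
      using u \<open>1 \<le> p\<close> by (intro sum_mono mult_left_mono nn_integral_increment_powr_le) auto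
    also have "\<dots> = ennreal (S powr p) * unit_moment p"
    proof -
      have "(\<Sum>j<n. ennreal (S powr (p - 1) * a j)) = ennreal (S powr (p - 1) * S)"
        using a by (subst sum_ennreal) (auto simp: S_def sum_distrib_left)
      also have "S powr (p - 1) * S = S powr p" using S by (simp add: powr_diff)
      finally show ?thesis by (simp add: sum_distrib_right[symmetric])
    qed
    also have "\<dots> \<le> ennreal (V powr p) * unit_moment p"
      using S \<open>1 \<le> p\<close> by (intro mult_right_mono ennreal_leI powr_mono2) auto
    finally show ?thesis .
  qed
qed

definition rs_sum :: "(real \<Rightarrow> complex) \<Rightarrow> nat \<Rightarrow> 'a \<Rightarrow> complex" where
  "rs_sum \<phi> m \<omega> = (\<Sum>j<Suc m. \<phi> (grid 0 1 m j) * complex_of_real (X (grid 0 1 m (Suc j)) \<omega> - X (grid 0 1 m j) \<omega>))"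

lemma measurable_rs_sum[measurable]: "rs_sum \<phi> m \<in> borel_measurable M"
  unfolding rs_sum_def by measurable

lemma grid_unit: "j \<le> Suc m \<Longrightarrow> grid 0 1 m j \<in> {0..1}"
  by (auto simp: grid_def)

text \<open>Summation by parts makes the increments of \<phi> the weights, whose sum is at most V;
  Fatou's lemma passes to the limit. A general limit U is allowed so that differences of integrals
  are covered too.\<close>

lemma nn_integral_rs_limit_powr_le:
  assumes V: "variation_le \<phi> 0 1 V" and zero: "\<phi> 0 = 0" "\<phi> 1 = 0" and "1 \<le> p"
    and lim: "\<And>\<omega>. \<omega> \<in> space M \<Longrightarrow> (\<lambda>m. rs_sum \<phi> m \<omega>) \<longlonglongrightarrow> U \<omega>"
  shows "(\<integral>\<^sup>+\<omega>. ennreal (norm (U \<omega>) powr p) \<partial>M) \<le> ennreal (V powr p) * unit_moment p"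
proof -
  have bound: "(\<integral>\<^sup>+\<omega>. ennreal (norm (rs_sum \<phi> m \<omega>) powr p) \<partial>M) \<le> ennreal (V powr p) * unit_moment p" for m
  proof -
    let ?g = "grid 0 1 m"
    have "norm (rs_sum \<phi> m \<omega>) \<le> (\<Sum>j<Suc m. norm (\<phi> (?g (Suc j)) - \<phi> (?g j)) * \<bar>X (?g (Suc j)) \<omega> - X 0 \<omega>\<bar>)" for \<omega>
    proof -
      \<comment> \<open>Centring at X 0 leaves the increments unchanged and yields variables with
        controlled moments.\<close>
      define x where "x j = complex_of_real (X (?g j) \<omega> - X 0 \<omega>)" for j
      have "rs_sum \<phi> m \<omega> = (\<Sum>j<Suc m. \<phi> (?g j) * (x (Suc j) - x j))"
        unfolding rs_sum_def x_def by simp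
      also have "\<dots> = \<phi> (?g (Suc m)) * x (Suc m) - \<phi> (?g 0) * x 0 - (\<Sum>j<Suc m. x (Suc j) * (\<phi> (?g (Suc j)) - \<phi> (?g j)))"
        by (rule sum_by_parts)
      also have "\<dots> = - (\<Sum>j<Suc m. x (Suc j) * (\<phi> (?g (Suc j)) - \<phi> (?g j)))"
        unfolding grid_simps zero by simp
      also have "norm \<dots> \<le> (\<Sum>j<Suc m. norm (x (Suc j) * (\<phi> (?g (Suc j)) - \<phi> (?g j))))"
        unfolding norm_minus_cancel by (rule norm_sum)
      also have "\<dots> = (\<Sum>j<Suc m. norm (\<phi> (?g (Suc j)) - \<phi> (?g j)) * \<bar>X (?g (Suc j)) \<omega> - X 0 \<omega>\<bar>)"
        by (intro sum.cong refl) (simp only: x_def norm_mult norm_of_real real_norm_def mult.commute)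
      finally show ?thesis .
    qed
    then have "(\<integral>\<^sup>+\<omega>. ennreal (norm (rs_sum \<phi> m \<omega>) powr p) \<partial>M) \<le>
      (\<integral>\<^sup>+\<omega>. ennreal ((\<Sum>j<Suc m. norm (\<phi> (?g (Suc j)) - \<phi> (?g j)) * \<bar>X (?g (Suc j)) \<omega> - X 0 \<omega>\<bar>) powr p) \<partial>M)"
      using \<open>1 \<le> p\<close> by (intro nn_integral_mono ennreal_leI powr_mono2) auto
    also have "\<dots> \<le> ennreal (V powr p) * unit_moment p"
      using \<open>1 \<le> p\<close> grid_unit
      by (intro nn_integral_weighted_sum_powr_le variation_leD[OF V]) (auto intro: grid_mono)
    finally show ?thesis .
  qed
  have "(\<integral>\<^sup>+\<omega>. ennreal (norm (U \<omega>) powr p) \<partial>M) = (\<integral>\<^sup>+\<omega>. liminf (\<lambda>m. ennreal (norm (rs_sum \<phi> m \<omega>) powr p)) \<partial>M)"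
  proof (intro nn_integral_cong)
    fix \<omega> assume "\<omega> \<in> space M"
    then have "(\<lambda>m. ennreal (norm (rs_sum \<phi> m \<omega>) powr p)) \<longlonglongrightarrow> ennreal (norm (U \<omega>) powr p)"
      using \<open>1 \<le> p\<close> by (intro tendsto_ennrealI tendsto_powr' tendsto_norm lim tendsto_const) auto
    then show "ennreal (norm (U \<omega>) powr p) = liminf (\<lambda>m. ennreal (norm (rs_sum \<phi> m \<omega>) powr p))"
      by (intro lim_imp_Liminf[symmetric]) auto
  qed
  also have "\<dots> \<le> liminf (\<lambda>m. \<integral>\<^sup>+\<omega>. ennreal (norm (rs_sum \<phi> m \<omega>) powr p) \<partial>M)"
    by (rule nn_integral_liminf) measurable
  also have "\<dots> \<le> liminf (\<lambda>m. ennreal (V powr p) * unit_moment p)"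
    using bound by (intro Liminf_mono) auto
  finally show ?thesis by (simp add: Liminf_const)
qed

text \<open>The map u \<mapsto> t - s u carries Riemann sums on [0, 1] to Riemann sums on
  [t - s, t]. By \<open>char_scaled_increments\<close> the projections correspond in law up to the
  factor s^H, and this survives the pathwise limit.\<close>

lemma nn_integral_rs_integral_scaled:
  fixes s t :: real
  assumes \<phi>: "continuous_on UNIV \<phi>" "variation_le \<phi> 0 1 V" "\<And>u. norm (\<phi> u) \<le> F" "\<And>u. u \<notin> {0<..<1} \<Longrightarrow> \<phi> u = 0"
    and "0 < s" "0 \<le> p"
  defines "I \<equiv> \<lambda>\<omega>. rs_integral 0 1 \<phi> (\<lambda>u. X u \<omega>)"
    and "J \<equiv> \<lambda>\<omega>. rs_integral_line (\<lambda>u. \<phi> ((t - u) / s)) (\<lambda>u. X u \<omega>)"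
  shows "\<And>\<omega>. \<omega> \<in> space M \<Longrightarrow> (\<lambda>m. rs_sum \<phi> m \<omega>) \<longlonglongrightarrow> I \<omega>" "I \<in> borel_measurable M" "J \<in> borel_measurable M"
    "(\<integral>\<^sup>+\<omega>. ennreal (norm (J \<omega>) powr p) \<partial>M) = ennreal (s powr (p * H)) * (\<integral>\<^sup>+\<omega>. ennreal (norm (I \<omega>) powr p) \<partial>M)"
proof -
  \<comment> \<open>The Riemann sum for J, indexed by the unit grid so that its terms match those of
    \<open>rs_sum\<close>.\<close>
  define R where "R m \<omega> = (\<Sum>i<Suc m. \<phi> (grid 0 1 m i) * complex_of_real (X (t - s * grid 0 1 m i) \<omega> - X (t - s * grid 0 1 m (Suc i)) \<omega>))" for m \<omega>
  have [measurable]: "R m \<in> borel_measurable M" for m unfolding R_def by measurable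
  have I_lim: "(\<lambda>m. rs_sum \<phi> m \<omega>) \<longlonglongrightarrow> I \<omega>" if "\<omega> \<in> space M" for \<omega>
    unfolding I_def rs_sum_def
    by (rule tendsto_rs_sum_grid[OF rs_integral_line_eq(2)[OF \<phi>(1-3) continuous_paths[OF that] _ \<phi>(4)]]) (auto intro: grid_mono)
  then show "\<And>\<omega>. \<omega> \<in> space M \<Longrightarrow> (\<lambda>m. rs_sum \<phi> m \<omega>) \<longlonglongrightarrow> I \<omega>" .
  have J_lim: "(\<lambda>m. R m \<omega>) \<longlonglongrightarrow> J \<omega>" if "\<omega> \<in> space M" for \<omega>
  proof -
    let ?f = "\<lambda>u. \<phi> ((t - u) / s)"
    have cont: "continuous_on UNIV ?f"
      using \<open>0 < s\<close> by (intro continuous_on_compose2[OF \<phi>(1)] continuous_intros) auto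
    have zero: "?f u = 0" if "u \<notin> {t - s<..<t}" for u
      using that \<open>0 < s\<close> by (intro \<phi>(4)) (auto simp: field_simps)
    have f: "J \<omega> = rs_integral (t - s) t ?f (\<lambda>t. X t \<omega>)"
      "has_rs_integral (t - s) t ?f (\<lambda>t. X t \<omega>) (rs_integral (t - s) t ?f (\<lambda>t. X t \<omega>))"
      unfolding J_def using \<open>0 < s\<close>
      by (intro rs_integral_line_eq[OF cont variation_le_reflect_scale[OF \<phi>(2) \<open>0 < s\<close>] \<phi>(3) continuous_paths[OF that] _ zero]; simp)+
    \<comment> \<open>Right endpoints as tags: the reflection turns them into the left endpoints
      used in \<open>rs_sum\<close>.\<close>
    have "(\<lambda>m. \<Sum>j<Suc m. ?f (grid (t - s) t m (Suc j)) *
        complex_of_real (X (grid (t - s) t m (Suc j)) \<omega> - X (grid (t - s) t m j) \<omega>)) \<longlonglongrightarrow> J \<omega>"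
      unfolding f(1) using \<open>0 < s\<close> by (intro tendsto_rs_sum_grid[OF f(2)]) (auto intro: grid_mono)
    moreover have "(\<Sum>j<Suc m. ?f (grid (t - s) t m (Suc j)) *
        complex_of_real (X (grid (t - s) t m (Suc j)) \<omega> - X (grid (t - s) t m j) \<omega>)) = R m \<omega>" for m
    proof -
      have g: "grid (t - s) t m j = t - s * grid 0 1 m (Suc m - j)" if "j \<le> Suc m" for j
        using that by (simp add: grid_def of_nat_diff field_simps)
      have "(\<Sum>j<Suc m. ?f (grid (t - s) t m (Suc j)) *
          complex_of_real (X (grid (t - s) t m (Suc j)) \<omega> - X (grid (t - s) t m j) \<omega>)) =
        (\<Sum>i<Suc m. ?f (grid (t - s) t m (Suc (Suc m - Suc i))) *
          complex_of_real (X (grid (t - s) t m (Suc (Suc m - Suc i))) \<omega> - X (grid (t - s) t m (Suc m - Suc i)) \<omega>))"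
        by (rule sum.nat_diff_reindex[symmetric])
      also have "\<dots> = R m \<omega>"
        unfolding R_def
      proof (intro sum.cong refl)
        fix i assume "i \<in> {..<Suc m}"
        then have i: "Suc (Suc m - Suc i) \<le> Suc m" "Suc m - Suc (Suc m - Suc i) = i" "Suc m - (Suc m - Suc i) = Suc i" "Suc m - Suc i \<le> Suc m" by auto
        have "(t - (t - s * grid 0 1 m i)) / s = grid 0 1 m i" using \<open>0 < s\<close> by simp
        then show "?f (grid (t - s) t m (Suc (Suc m - Suc i))) *
          complex_of_real (X (grid (t - s) t m (Suc (Suc m - Suc i))) \<omega> - X (grid (t - s) t m (Suc m - Suc i)) \<omega>) =
          \<phi> (grid 0 1 m i) * complex_of_real (X (t - s * grid 0 1 m i) \<omega> - X (t - s * grid 0 1 m (Suc i)) \<omega>)"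
          using g[OF i(1)] g[OF i(4)] unfolding i(2,3) by simp
      qed
      finally show ?thesis .
    qed
    ultimately show ?thesis by simp
  qed
  show [measurable]: "I \<in> borel_measurable M"
    by (rule borel_measurable_LIMSEQ_metric[OF _ I_lim]) auto
  show [measurable]: "J \<in> borel_measurable M"
    by (rule borel_measurable_LIMSEQ_metric[OF _ J_lim]) auto
  show "(\<integral>\<^sup>+\<omega>. ennreal (norm (J \<omega>) powr p) \<partial>M) = ennreal (s powr (p * H)) * (\<integral>\<^sup>+\<omega>. ennreal (norm (I \<omega>) powr p) \<partial>M)"
  proof (rule nn_integral_norm_powr_eq_projections)
    fix \<theta>
    have "(\<integral>\<^sup>+\<omega>. ennreal (\<bar>Re (cis \<theta> * J \<omega>)\<bar> powr p) \<partial>M) =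
      ennreal ((s powr H) powr p) * (\<integral>\<^sup>+\<omega>. ennreal (\<bar>Re (cis \<theta> * I \<omega>)\<bar> powr p) \<partial>M)"
    proof (rule nn_integral_powr_eq_if_char_eq)
      fix l
      have "(\<lambda>m. char (distr M borel (\<lambda>\<omega>. Re (cis \<theta> * R m \<omega>))) l) \<longlonglongrightarrow> char (distr M borel (\<lambda>\<omega>. Re (cis \<theta> * J \<omega>))) l"
        by (intro tendsto_char_pointwise AE_I2 tendsto_intros J_lim) auto
      moreover have "char (distr M borel (\<lambda>\<omega>. Re (cis \<theta> * R m \<omega>))) l = char (distr M borel (\<lambda>\<omega>. Re (cis \<theta> * rs_sum \<phi> m \<omega>))) (s powr H * l)" for m
        unfolding R_def rs_sum_def by (rule char_scaled_increments[OF \<open>0 < s\<close>])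
      moreover have "(\<lambda>m. char (distr M borel (\<lambda>\<omega>. Re (cis \<theta> * rs_sum \<phi> m \<omega>))) (s powr H * l)) \<longlonglongrightarrow> char (distr M borel (\<lambda>\<omega>. Re (cis \<theta> * I \<omega>))) (s powr H * l)"
        by (intro tendsto_char_pointwise AE_I2 tendsto_intros I_lim) auto
      ultimately show "char (distr M borel (\<lambda>\<omega>. Re (cis \<theta> * J \<omega>))) l = char (distr M borel (\<lambda>\<omega>. Re (cis \<theta> * I \<omega>))) (s powr H * l)"
        using LIMSEQ_unique by auto
    qed auto
    then show "(\<integral>\<^sup>+\<omega>. ennreal (\<bar>Re (cis \<theta> * J \<omega>)\<bar> powr p) \<partial>M) =
      ennreal (s powr (p * H)) * (\<integral>\<^sup>+\<omega>. ennreal (\<bar>Re (cis \<theta> * I \<omega>)\<bar> powr p) \<partial>M)"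
      by (simp add: powr_powr mult.commute)
  qed (use sigma_finite_measure_axioms \<open>0 \<le> p\<close> in auto)
qed

end

section \<open>The limit for fractional Brownian motion\<close>

lemma norm_iexp_diff_le: "norm (iexp u - iexp v) \<le> \<bar>u - v\<bar>" for u v :: real
proof -
  have "iexp u - iexp v = iexp v * (iexp (u - v) - 1)"
    by (simp only: right_diff_distrib mult_1_right of_real_diff exp_diff) simp
  also have "norm \<dots> = norm (iexp (u - v) - 1)" by (simp add: norm_mult)
  also have "\<dots> \<le> \<bar>u - v\<bar>" using iexp_approx1[of "u - v" 0] by simp
  finally show ?thesis .
qed

text \<open>After rescaling, the moment depends only on a = s \<xi>. Linearity of the Riemann sums
  makes I a - I L the limit of the sums for \<phi> a - \<phi> L, so the variation bound gives
  convergence in L^p and hence of the moments.\<close>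

lemma (in fbm) filter_moment_tendsto:
  fixes w :: "real \<Rightarrow> complex" and s \<xi> :: "nat \<Rightarrow> real"
  assumes cont: "continuous_on UNIV w" and zero: "\<And>v. v \<notin> {0<..<1} \<Longrightarrow> w v = 0"
    and bv: "has_bounded_variation_on w 0 1"
    and p: "1 \<le> p" and s: "\<And>k. 0 < s k" and lim: "(\<lambda>k. s k * \<xi> k) \<longlonglongrightarrow> L"
  shows "(\<lambda>k. filter_moment M (\<lambda>f \<omega>. rs_integral_line f (\<lambda>t. X t \<omega>)) w (s k) (\<xi> k) p / s k powr (p * H))
    \<longlonglongrightarrow> (\<integral>\<omega>. norm (rs_integral 0 1 (\<lambda>u. w u * iexp (L * u)) (\<lambda>t. X t \<omega>)) powr p \<partial>M)"
proof -
  define \<phi> where "\<phi> a v = w v * iexp (a * v)" for a v :: real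
  define I where "I a \<omega> = rs_integral 0 1 (\<phi> a) (\<lambda>t. X t \<omega>)" for a \<omega>
  obtain V where V: "variation_le w 0 1 V" using bv by (auto simp: has_bounded_variation_on_iff)
  have "bounded (w ` {0..1})"
    using cont by (intro compact_imp_bounded compact_continuous_image) (auto intro: continuous_on_subset)
  then obtain W where W01: "\<And>v. v \<in> {0..1} \<Longrightarrow> norm (w v) \<le> W" unfolding bounded_iff by (metis imageI)
  have "0 \<le> W" using order.trans[OF norm_ge_zero W01[of 0]] by simp
  then have W: "norm (w v) \<le> W" for v using W01[of v] zero[of v] by (cases "v \<in> {0..1}") auto
  have \<phi>_cont: "continuous_on UNIV (\<phi> a)" for a unfolding \<phi>_def by (intro continuous_intros cont)
  have \<phi>_le: "norm (\<phi> a v) \<le> W" for a v unfolding \<phi>_def using W by (simp add: norm_mult)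
  have \<phi>_zero: "\<phi> a v = 0" if "v \<notin> {0<..<1}" for a v unfolding \<phi>_def using zero[OF that] by simp
  have "norm (iexp (a * v) - iexp (a * u)) \<le> \<bar>a\<bar> * (v - u)" if "u \<le> v" for a u v :: real
    using norm_iexp_diff_le[of "a * v" "a * u"] that by (simp add: abs_mult flip: right_diff_distrib)
  then have \<phi>_var: "variation_le (\<phi> a) 0 1 (1 * V + W * (\<bar>a\<bar> * (1 - 0)))" for a
    unfolding \<phi>_def by (intro variation_le_mult_lipschitz V W) auto
  have diff_var: "variation_le (\<lambda>v. \<phi> a v - \<phi> L v) 0 1 (\<bar>a - L\<bar> * V + W * (\<bar>a - L\<bar> * (1 + \<bar>L\<bar>) * (1 - 0)))" (is "variation_le _ _ _ (_ + W * (?K * _))") for a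
  proof -
    define h where "h v = iexp (a * v) - iexp (L * v)" for v :: real
    have le: "norm (h v) \<le> \<bar>a - L\<bar>" if "v \<in> {0..1}" for v
    proof -
      have "norm (h v) \<le> \<bar>a - L\<bar> * \<bar>v\<bar>"
        using norm_iexp_diff_le[of "a * v" "L * v"] by (simp add: h_def abs_mult flip: left_diff_distrib)
      also have "\<dots> \<le> \<bar>a - L\<bar> * 1" using that by (intro mult_left_mono) auto
      finally show ?thesis by simp
    qed
    have lip: "norm (h v - h u) \<le> ?K * (v - u)" if "u \<in> {0..1}" "u \<le> v" for u v
    proof -
      \<comment> \<open>Factoring exp (i a x) = exp (i L x) exp (i b x) makes both parts of the
        increment of h proportional to |b|; the Lipschitz constant |b| (1 + |L|) collects
        them.\<close>
      define b where "b = a - L"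
      have split: "iexp (a * x) = iexp (L * x) * iexp (b * x)" for x
        by (simp add: b_def exp_add[symmetric] algebra_simps)
      have "h v - h u = iexp (L * v) * (iexp (b * v) - iexp (b * u)) + (iexp (L * v) - iexp (L * u)) * (iexp (b * u) - 1)"
        unfolding h_def split by (simp add: algebra_simps)
      also have "norm \<dots> \<le> norm (iexp (L * v) * (iexp (b * v) - iexp (b * u))) + norm ((iexp (L * v) - iexp (L * u)) * (iexp (b * u) - 1))"
        by (rule norm_triangle_ineq)
      also have "\<dots> = norm (iexp (b * v) - iexp (b * u)) + norm (iexp (L * v) - iexp (L * u)) * norm (iexp (b * u) - iexp 0)"
        by (simp add: norm_mult)
      also have "\<dots> \<le> \<bar>b * v - b * u\<bar> + \<bar>L * v - L * u\<bar> * \<bar>b * u - 0\<bar>"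
        by (intro add_mono mult_mono norm_iexp_diff_le norm_iexp_diff_le[of _ 0, simplified]) auto
      also have "\<dots> = \<bar>b\<bar> * (v - u) + \<bar>L\<bar> * (v - u) * (\<bar>b\<bar> * u)"
        using that by (simp add: abs_mult flip: right_diff_distrib)
      also have "\<dots> \<le> \<bar>b\<bar> * (v - u) + \<bar>L\<bar> * (v - u) * (\<bar>b\<bar> * 1)"
        using that by (intro add_left_mono mult_left_mono) auto
      finally show ?thesis by (simp add: b_def algebra_simps)
    qed
    have "variation_le (\<lambda>v. w v * h v) 0 1 (\<bar>a - L\<bar> * V + W * (?K * (1 - 0)))"
      by (intro variation_le_mult_lipschitz V W le lip) auto
    then show ?thesis by (simp add: \<phi>_def h_def right_diff_distrib)
  qed
  have \<phi>_scaled: "(\<lambda>m. rs_sum (\<phi> a) m \<omega>) \<longlonglongrightarrow> I a \<omega>" if "\<omega> \<in> space M" for a \<omega>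
    unfolding I_def
    by (rule nn_integral_rs_integral_scaled(1)[OF \<phi>_cont \<phi>_var \<phi>_le \<phi>_zero, where s=1 and p=0]) (use that in auto)
  have [measurable]: "I a \<in> borel_measurable M" for a
    unfolding I_def
    by (rule nn_integral_rs_integral_scaled(2)[OF \<phi>_cont \<phi>_var \<phi>_le \<phi>_zero, where s=1 and p=0]) auto
  have unit_fin: "unit_moment p < \<infinity>" using p by (intro unit_moment_finite) auto
  define D where "D a = (\<integral>\<^sup>+\<omega>. ennreal (norm (I a \<omega>) powr p) \<partial>M)" for a
  have D_fin: "D a < \<infinity>" for a
  proof -
    have "D a \<le> ennreal ((1 * V + W * (\<bar>a\<bar> * (1 - 0))) powr p) * unit_moment p"
      unfolding D_def using \<phi>_zero by (intro nn_integral_rs_limit_powr_le[OF \<phi>_var _ _ p \<phi>_scaled]) auto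
    also have "\<dots> < \<infinity>" using unit_fin by (simp add: ennreal_mult_less_top)
    finally show ?thesis .
  qed
  have "(\<lambda>k. D (s k * \<xi> k)) \<longlonglongrightarrow> D L"
    unfolding D_def
  proof (rule tendsto_nn_integral_powr[OF _ _ p])
    show "(\<lambda>k. \<integral>\<^sup>+\<omega>. ennreal (norm (I (s k * \<xi> k) \<omega> - I L \<omega>) powr p) \<partial>M) \<longlonglongrightarrow> 0"
    proof (rule tendsto_sandwich[OF _ _ tendsto_const])
      \<comment> \<open>The bound of \<open>diff_var\<close>, continuous in a and zero at a =
        L.\<close>
      define B where "B a = \<bar>a - L\<bar> * V + W * (\<bar>a - L\<bar> * (1 + \<bar>L\<bar>) * (1 - 0))" for a
      have "(\<integral>\<^sup>+\<omega>. ennreal (norm (I a \<omega> - I L \<omega>) powr p) \<partial>M) \<le> ennreal (B a powr p) * unit_moment p" for a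
      proof (rule nn_integral_rs_limit_powr_le[OF _ _ _ p])
        show "variation_le (\<lambda>v. \<phi> a v - \<phi> L v) 0 1 (B a)" unfolding B_def by (rule diff_var)
        fix \<omega> assume "\<omega> \<in> space M"
        then have "(\<lambda>m. rs_sum (\<phi> a) m \<omega> - rs_sum (\<phi> L) m \<omega>) \<longlonglongrightarrow> I a \<omega> - I L \<omega>"
          by (intro tendsto_diff \<phi>_scaled)
        moreover have "rs_sum (\<lambda>v. \<phi> a v - \<phi> L v) m \<omega> = rs_sum (\<phi> a) m \<omega> - rs_sum (\<phi> L) m \<omega>" for m
          unfolding rs_sum_def left_diff_distrib by (rule sum_subtractf)
        ultimately show "(\<lambda>m. rs_sum (\<lambda>v. \<phi> a v - \<phi> L v) m \<omega>) \<longlonglongrightarrow> I a \<omega> - I L \<omega>" by simp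
      qed (use \<phi>_zero in auto)
      then show "\<forall>\<^sub>F k in sequentially. (\<integral>\<^sup>+\<omega>. ennreal (norm (I (s k * \<xi> k) \<omega> - I L \<omega>) powr p) \<partial>M) \<le> ennreal (B (s k * \<xi> k) powr p) * unit_moment p"
        by simp
      have "0 \<le> V" using V by (rule variation_le_nonneg) simp
      then have "(\<lambda>k. B (s k * \<xi> k) powr p) \<longlonglongrightarrow> B L powr p"
        unfolding B_def using p \<open>0 \<le> W\<close> by (intro tendsto_powr' tendsto_intros lim) auto
      then have "(\<lambda>k. ennreal (B (s k * \<xi> k) powr p) * unit_moment p) \<longlonglongrightarrow> ennreal (B L powr p) * unit_moment p"
        using unit_fin by (intro tendsto_mult_ennreal tendsto_ennrealI tendsto_const) auto
      then show "(\<lambda>k. ennreal (B (s k * \<xi> k) powr p) * unit_moment p) \<longlonglongrightarrow> 0" by (simp add: B_def)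
    qed simp
    show "(\<integral>\<^sup>+\<omega>. ennreal (norm (I L \<omega>) powr p) \<partial>M) < \<infinity>" using D_fin[of L] by (simp add: D_def)
  qed auto
  then have D_lim: "(\<lambda>k. enn2real (D (s k * \<xi> k))) \<longlonglongrightarrow> enn2real (D L)"
    using D_fin by (rule tendsto_enn2real_finite)
  have "filter_moment M (\<lambda>f \<omega>. rs_integral_line f (\<lambda>t. X t \<omega>)) w (s k) (\<xi> k) p / s k powr (p * H) = enn2real (D (s k * \<xi> k))" for k
  proof -
    have "filter_moment_at M (\<lambda>f \<omega>. rs_integral_line f (\<lambda>t. X t \<omega>)) (gabor_filter w (s k) (\<xi> k)) p t = s k powr (p * H) * enn2real (D (s k * \<xi> k))" for t
    proof -
      let ?J = "\<lambda>\<omega>. rs_integral_line (\<lambda>u. \<phi> (s k * \<xi> k) ((t - u) / s k)) (\<lambda>t. X t \<omega>)"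
      note J = nn_integral_rs_integral_scaled[OF \<phi>_cont[of "s k * \<xi> k"] \<phi>_var \<phi>_le \<phi>_zero s[of k]]
      have [measurable]: "?J \<in> borel_measurable M" using p by (intro J(3)[where p=p]) auto
      have "gabor_filter w (s k) (\<xi> k) (t - u) = \<phi> (s k * \<xi> k) ((t - u) / s k)" for u
      proof -
        have "s k * \<xi> k * ((t - u) / s k) = \<xi> k * (t - u)" using s[of k] by simp
        then show ?thesis unfolding gabor_filter_def \<phi>_def by (simp only:)
      qed
      then have "filter_moment_at M (\<lambda>f \<omega>. rs_integral_line f (\<lambda>t. X t \<omega>)) (gabor_filter w (s k) (\<xi> k)) p t = (\<integral>\<omega>. norm (?J \<omega>) powr p \<partial>M)"
        unfolding filter_moment_at_def by simp
      also have "\<dots> = enn2real (ennreal (s k powr (p * H)) * D (s k * \<xi> k))"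
        unfolding D_def I_def using p J(4)[where p=p and t=t] by (subst integral_eq_nn_integral) auto
      finally show ?thesis by (simp add: enn2real_mult)
    qed
    then show ?thesis unfolding filter_moment_def using s[of k] by simp
  qed
  moreover have "(\<integral>\<omega>. norm (rs_integral 0 1 (\<lambda>u. w u * iexp (L * u)) (\<lambda>t. X t \<omega>)) powr p \<partial>M) = enn2real (D L)"
  proof -
    have "(\<lambda>u. w u * iexp (L * u)) = \<phi> L" unfolding \<phi>_def ..
    then show ?thesis unfolding D_def by (simp only: I_def[symmetric]) (subst integral_eq_nn_integral; simp)
  qed
  ultimately show ?thesis using D_lim by simp
qed

theorem theorem5:
  fixes w :: "real \<Rightarrow> complex" and s \<xi> :: "nat \<Rightarrow> real" and L p :: real
    and M :: "'a measure" and X :: "real \<Rightarrow> 'a \<Rightarrow> real"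
  assumes "continuous_on UNIV w"
    and "closure {t. w t \<noteq> 0} \<subseteq> {0..1}"
    and "integrable lborel (\<lambda>t. (norm (w t))\<^sup>2)"
    and "1 \<le> p"
    and "\<And>k. 0 < s k"
    and "s \<longlonglongrightarrow> 0"
    and "(\<lambda>k. s k * \<xi> k) \<longlonglongrightarrow> L"
  shows
    "(\<forall>\<alpha>. p < \<alpha> \<and> \<alpha> \<le> 2 \<and> symmetric_stable_process \<alpha> M X \<longrightarrow>
        (\<lambda>k. filter_moment M (stable_integral \<alpha> M X) w (s k) (\<xi> k) p / s k powr (p / \<alpha>))
          \<longlonglongrightarrow> (\<integral>\<omega>. norm (stable_integral \<alpha> M X
                  (\<lambda>u. indicator {0..1} u * (w u * iexp (L * u))) \<omega>) powr p \<partial>M))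
     \<and>
     (\<forall>H X'. 0 < H \<and> H < 1 \<and> fractional_brownian_motion H M X \<and>
        modification M X X' \<and> holder_paths M X' \<and> has_bounded_variation_on w 0 1 \<longrightarrow>
        (\<lambda>k. filter_moment M (\<lambda>f \<omega>. rs_integral_line f (\<lambda>t. X' t \<omega>)) w (s k) (\<xi> k) p
               / s k powr (p * H))
          \<longlonglongrightarrow> (\<integral>\<omega>. norm (rs_integral 0 1
                  (\<lambda>u. w u * iexp (L * u)) (\<lambda>t. X' t \<omega>)) powr p \<partial>M))"
proof (intro conjI allI impI; elim conjE)
  note zero = window_eq_0[OF assms(1,2)]
  fix \<alpha> assume stable: "p < \<alpha>" "symmetric_stable_process \<alpha> M X"
  then have "1 < \<alpha>" using assms(4) by simp
  obtain \<sigma> where "stable_process M X \<alpha> \<sigma>"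
    by (rule stable_process_if_symmetric_stable_process[OF stable(2) \<open>1 < \<alpha>\<close>])
  then interpret stable_process M X \<alpha> \<sigma> .
  \<comment> \<open>Restricting the integral to [0, 1] changes nothing, as w vanishes
    outside.\<close>
  have "(\<lambda>u. indicator {0..1} u * (w u * iexp (L * u))) = (\<lambda>u. w u * iexp (L * u))"
  proof
    fix u
    show "indicator {0..1} u * (w u * iexp (L * u)) = w u * iexp (L * u)"
      using zero[of u] by (cases "u \<in> {0..1}") auto
  qed
  then show "(\<lambda>k. filter_moment M (stable_integral \<alpha> M X) w (s k) (\<xi> k) p / s k powr (p / \<alpha>))
    \<longlonglongrightarrow> (\<integral>\<omega>. norm (stable_integral \<alpha> M X (\<lambda>u. indicator {0..1} u * (w u * iexp (L * u))) \<omega>) powr p \<partial>M)"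
    using filter_moment_tendsto[OF assms(1) zero assms(4) stable(1) assms(5,7)] by simp
next
  fix H X'
  assume "0 < H" and X: "fractional_brownian_motion H M X" "modification M X X'" "holder_paths M X'"
    and bv: "has_bounded_variation_on w 0 1"
  obtain \<sigma> where "fbm M X' H \<sigma>"
    by (rule fbm_if_fractional_brownian_motion[OF X \<open>0 < H\<close>])
  then interpret fbm M X' H \<sigma> .
  show "(\<lambda>k. filter_moment M (\<lambda>f \<omega>. rs_integral_line f (\<lambda>t. X' t \<omega>)) w (s k) (\<xi> k) p / s k powr (p * H))
    \<longlonglongrightarrow> (\<integral>\<omega>. norm (rs_integral 0 1 (\<lambda>u. w u * iexp (L * u)) (\<lambda>t. X' t \<omega>)) powr p \<partial>M)"
    by (rule filter_moment_tendsto[OF assms(1) window_eq_0[OF assms(1,2)] bv assms(4,5,7)])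
qed

end
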